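(* There is a canonical natural transformation $\varphi\colon\mathrm{Spcnt}\to\mathrm{Spc}^\vee$ of the functors $(\mathsf{rttcat}_\wedge^{\mathrm{loc}})^{\mathrm{op}}\to\mathsf{Sob}$, i.e. for every rigid tt-category $\mathsf{T}$ there is a canonical comparison map $$\varphi_{\mathsf{T}}\colon\mathrm{Spcnt}\,\mathsf{T}\to(\mathrm{Spc}\,\mathsf{T})^\vee$$ which is natural with respect to confluent monoidal localizations.
   Context: A tt-category is an essentially small triangulated category with a symmetric monoidal structure exact in each variable; it is rigid if it is closed and every object is rigid (dualizable). $\mathsf{Sob}$ is the category of sober spaces (every irreducible closed subset has a unique generic point) and continuous maps. $T(\mathsf{K})$ denotes the complete lattice of thick subcategories (full subcategories closed under isomorphisms, suspensions, cones and direct summands) of an essentially small triangulated category $\mathsf{K}$, ordered by inclusion, with meets given by intersection; $\mathrm{thick}(C)$ is the smallest thick subcategory containing $C$. An exact functor $F\colon\mathsf{K}\to\mathsf{L}$ is confluent if $\mathrm{thick}(F\mathsf{K})=\mathsf{L}$ and $\mathrm{thick}(F\mathsf{M})\cap\mathrm{thick}(F\mathsf{N})=\mathrm{thick}(F(\mathsf{M}\cap\mathsf{N}))$ for all thick subcategories $\mathsf{M},\mathsf{N}$ of $\mathsf{K}$. $\mathsf{rttcat}_\wedge^{\mathrm{loc}}$ is the category of rigid tt-categories whose morphisms are the exact monoidal localizations which are confluent. For a complete lattice $L$, its space of points is the set of poset maps $L\to\mathbf{2}=\{0\le1\}$ preserving finite meets and arbitrary joins (including empty ones), with open subsets $\{p\mid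 p(l)=1\}$ for $l\in L$. The non-tensor spectrum $\mathrm{Spcnt}\,\mathsf{K}$ is the space of points of $T(\mathsf{K})$; a confluent functor $F$ induces a map of spaces by precomposition with $\mathsf{M}\mapsto\mathrm{thick}(F\mathsf{M})$. $\mathrm{Spc}\,\mathsf{T}$ is the Balmer spectrum of a tt-category $\mathsf{T}$, which is a spectral space: the set of prime thick $\otimes$-ideals (proper thick $\otimes$-ideals $\mathsf{P}$ such that $x\otimes y\in\mathsf{P}$ implies $x\in\mathsf{P}$ or $y\in\mathsf{P}$), with closed subsets generated by the $\mathrm{supp}(x)=\{\mathsf{P}\mid x\notin\mathsf{P}\}$ for $x\in\mathsf{T}$; exact monoidal functors act by preimage. For a spectral space $X$, the Hochster dual $X^\vee$ has the same points as $X$ and the topology with basis of open subsets given by the closed subsets of $X$ with quasi-compact open complement. $\mathrm{Spc}^\vee$ denotes the functor $\mathsf{T}\mapsto(\mathrm{Spc}\,\mathsf{T})^\vee$. *)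

theory Defs
  imports "HOL-Analysis.Analysis" "HOL-Algebra.Complete_Lattice" "HOL-Algebra.Group"
begin

section \<open>Categories and functors\<close>

record ('o, 'm) cat =
  Obj :: "'o set"
  Arr :: "'m set"
  Dom :: "'m \<Rightarrow> 'o"
  Cod :: "'m \<Rightarrow> 'o"
  Ident :: "'o \<Rightarrow> 'm"  (\<open>\<I>\<index>\<close>)
  Comp :: "'m \<Rightarrow> 'm \<Rightarrow> 'm"  (infixr \<open>\<cdot>\<index>\<close> 75)

definition Hom :: "('o, 'm, 'r) cat_scheme \<Rightarrow> 'o \<Rightarrow> 'o \<Rightarrow> 'm set"
  where "Hom C x y = {f \<in> Arr C. Dom C f = x \<and> Cod C f = y}"

locale category =
  fixes C :: "('o, 'm, 'r) cat_scheme" (structure)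
  assumes dom_in: "f \<in> Arr C \<Longrightarrow> Dom C f \<in> Obj C"
    and cod_in: "f \<in> Arr C \<Longrightarrow> Cod C f \<in> Obj C"
    and ident_in: "x \<in> Obj C \<Longrightarrow> \<I> x \<in> Hom C x x"
    and comp_in: "\<lbrakk>f \<in> Hom C x y; g \<in> Hom C y z\<rbrakk> \<Longrightarrow> g \<cdot> f \<in> Hom C x z"
    and ident_left: "f \<in> Hom C x y \<Longrightarrow> \<I> y \<cdot> f = f"
    and ident_right: "f \<in> Hom C x y \<Longrightarrow> f \<cdot> \<I> x = f"
    and comp_assoc: "\<lbrakk>f \<in> Hom C x y; g \<in> Hom C y z; h \<in> Hom C z w\<rbrakk>
           \<Longrightarrow> (h \<cdot> g) \<cdot> f = h \<cdot> (g \<cdot> f)"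

definition op_cat :: "('o, 'm, 'r) cat_scheme \<Rightarrow> ('o, 'm) cat"
  where "op_cat C = \<lparr>Obj = Obj C, Arr = Arr C, Dom = Cod C, Cod = Dom C, Ident = Ident C,
           Comp = (\<lambda>g f. f \<cdot>\<^bsub>C\<^esub> g)\<rparr>"

definition inverse_pair :: "('o, 'm, 'r) cat_scheme \<Rightarrow> 'm \<Rightarrow> 'm \<Rightarrow> bool"
  where "inverse_pair C f g \<longleftrightarrow> f \<in> Arr C \<and> g \<in> Hom C (Cod C f) (Dom C f)
           \<and> g \<cdot>\<^bsub>C\<^esub> f = \<I>\<^bsub>C\<^esub> (Dom C f) \<and> f \<cdot>\<^bsub>C\<^esub> g = \<I>\<^bsub>C\<^esub> (Cod C f)"

definition invertible_arr :: "('o, 'm, 'r) cat_scheme \<Rightarrow> 'm \<Rightarrow> bool"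
  where "invertible_arr C f \<longleftrightarrow> (\<exists>g. inverse_pair C f g)"

definition inverse_arr :: "('o, 'm, 'r) cat_scheme \<Rightarrow> 'm \<Rightarrow> 'm"
  where "inverse_arr C f = (THE g. inverse_pair C f g)"

definition Iso :: "('o, 'm, 'r) cat_scheme \<Rightarrow> 'o \<Rightarrow> 'o \<Rightarrow> 'm set"
  where "Iso C x y = {f \<in> Hom C x y. invertible_arr C f}"

definition is_functor :: "('o, 'm, 'r) cat_scheme \<Rightarrow> ('p, 'n, 's) cat_scheme
    \<Rightarrow> ('o \<Rightarrow> 'p) \<Rightarrow> ('m \<Rightarrow> 'n) \<Rightarrow> bool"
  where "is_functor C D Fo Fm \<longleftrightarrow> category C \<and> category D
    \<and> (\<forall>x\<in>Obj C. Fo x \<in> Obj D)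
    \<and> (\<forall>x\<in>Obj C. \<forall>y\<in>Obj C. \<forall>f\<in>Hom C x y. Fm f \<in> Hom D (Fo x) (Fo y))
    \<and> (\<forall>x\<in>Obj C. Fm (\<I>\<^bsub>C\<^esub> x) = \<I>\<^bsub>D\<^esub> (Fo x))
    \<and> (\<forall>x\<in>Obj C. \<forall>y\<in>Obj C. \<forall>z\<in>Obj C. \<forall>f\<in>Hom C x y. \<forall>g\<in>Hom C y z.
         Fm (g \<cdot>\<^bsub>C\<^esub> f) = Fm g \<cdot>\<^bsub>D\<^esub> Fm f)"

definition is_equivalence :: "('o, 'm, 'r) cat_scheme \<Rightarrow> ('p, 'n, 's) cat_scheme
    \<Rightarrow> ('o \<Rightarrow> 'p) \<Rightarrow> ('m \<Rightarrow> 'n) \<Rightarrow> bool"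
  where "is_equivalence C D Fo Fm \<longleftrightarrow> is_functor C D Fo Fm
    \<and> (\<forall>x\<in>Obj C. \<forall>y\<in>Obj C. bij_betw Fm (Hom C x y) (Hom D (Fo x) (Fo y)))
    \<and> (\<forall>d\<in>Obj D. \<exists>x\<in>Obj C. Iso D (Fo x) d \<noteq> {})"


section \<open>Triangulated categories\<close>

text \<open>
  The object and morphism classes are sets, so every category here is small.  The suspension is
  an additive auto-equivalence; \<open>Tri\<close> is the class of distinguished triangles
  \<open>x \<rightarrow> y \<rightarrow> z \<rightarrow> \<Sigma>x\<close>, written as triples of morphisms.
\<close>

record ('o, 'm) tricat = "('o, 'm) cat" +
  Plus :: "'m \<Rightarrow> 'm \<Rightarrow> 'm"
  Zero :: "'o \<Rightarrow> 'o \<Rightarrow> 'm"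
  Sh :: "'o \<Rightarrow> 'o"
  Shm :: "'m \<Rightarrow> 'm"
  Tri :: "('m \<times> 'm \<times> 'm) set"

definition hom_group :: "('o, 'm, 'r) tricat_scheme \<Rightarrow> 'o \<Rightarrow> 'o \<Rightarrow> 'm monoid"
  where "hom_group K x y = \<lparr>carrier = Hom K x y, mult = Plus K, one = Zero K x y\<rparr>"

definition Neg :: "('o, 'm, 'r) tricat_scheme \<Rightarrow> 'm \<Rightarrow> 'm"
  where "Neg K f = inv\<^bsub>hom_group K (Dom K f) (Cod K f)\<^esub> f"

definition zero_object :: "('o, 'm, 'r) cat_scheme \<Rightarrow> 'o \<Rightarrow> bool"
  where "zero_object C z \<longleftrightarrow> z \<in> Obj C
    \<and> (\<forall>x\<in>Obj C. (\<exists>!f. f \<in> Hom C x z) \<and> (\<exists>!f. f \<in> Hom C z x))"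

definition is_biproduct ::
    "('o, 'm, 'r) tricat_scheme \<Rightarrow> 'o \<Rightarrow> 'o \<Rightarrow> 'o \<Rightarrow> 'm \<Rightarrow> 'm \<Rightarrow> 'm \<Rightarrow> 'm \<Rightarrow> bool"
  where "is_biproduct K x y b i j p q \<longleftrightarrow>
    i \<in> Hom K x b \<and> j \<in> Hom K y b \<and> p \<in> Hom K b x \<and> q \<in> Hom K b y
    \<and> p \<cdot>\<^bsub>K\<^esub> i = \<I>\<^bsub>K\<^esub> x \<and> q \<cdot>\<^bsub>K\<^esub> j = \<I>\<^bsub>K\<^esub> y
    \<and> p \<cdot>\<^bsub>K\<^esub> j = Zero K y x \<and> q \<cdot>\<^bsub>K\<^esub> i = Zero K x y
    \<and> Plus K (i \<cdot>\<^bsub>K\<^esub> p) (j \<cdot>\<^bsub>K\<^esub> q) = \<I>\<^bsub>K\<^esub> b"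

definition is_direct_sum :: "('o, 'm, 'r) tricat_scheme \<Rightarrow> 'o \<Rightarrow> 'o \<Rightarrow> 'o \<Rightarrow> bool"
  where "is_direct_sum K x y b \<longleftrightarrow> x \<in> Obj K \<and> y \<in> Obj K \<and> b \<in> Obj K
    \<and> (\<exists>i j p q. is_biproduct K x y b i j p q)"

definition is_additive :: "('o, 'm, 'r) tricat_scheme \<Rightarrow> ('p, 'n, 's) tricat_scheme
    \<Rightarrow> ('o \<Rightarrow> 'p) \<Rightarrow> ('m \<Rightarrow> 'n) \<Rightarrow> bool"
  where "is_additive K L Fo Fm \<longleftrightarrow> is_functor K L Fo Fm
    \<and> (\<forall>x\<in>Obj K. \<forall>y\<in>Obj K. \<forall>f\<in>Hom K x y. \<forall>g\<in>Hom K x y.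
         Fm (Plus K f g) = Plus L (Fm f) (Fm g))"

locale additive_category = category K
  for K :: "('o, 'm, 'r) tricat_scheme" (structure) +
  assumes hom_comm_group: "\<lbrakk>x \<in> Obj K; y \<in> Obj K\<rbrakk> \<Longrightarrow> comm_group (hom_group K x y)"
    and comp_plus_left: "\<lbrakk>f \<in> Hom K x y; g \<in> Hom K y z; g' \<in> Hom K y z\<rbrakk>
           \<Longrightarrow> Plus K g g' \<cdot> f = Plus K (g \<cdot> f) (g' \<cdot> f)"
    and comp_plus_right: "\<lbrakk>f \<in> Hom K x y; f' \<in> Hom K x y; g \<in> Hom K y z\<rbrakk>
           \<Longrightarrow> g \<cdot> Plus K f f' = Plus K (g \<cdot> f) (g \<cdot> f')"
    and zero_exists: "\<exists>z. zero_object K z"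
    and direct_sum_exists: "\<lbrakk>x \<in> Obj K; y \<in> Obj K\<rbrakk> \<Longrightarrow> \<exists>b. is_direct_sum K x y b"

definition is_triangle :: "('o, 'm, 'r) tricat_scheme \<Rightarrow> 'm \<Rightarrow> 'm \<Rightarrow> 'm \<Rightarrow> bool"
  where "is_triangle K f g h \<longleftrightarrow> f \<in> Arr K \<and> g \<in> Arr K \<and> h \<in> Arr K
    \<and> Cod K f = Dom K g \<and> Cod K g = Dom K h \<and> Cod K h = Sh K (Dom K f)"

definition triangle_map :: "('o, 'm, 'r) tricat_scheme \<Rightarrow> 'm \<times> 'm \<times> 'm \<Rightarrow> 'm \<times> 'm \<times> 'm
    \<Rightarrow> 'm \<Rightarrow> 'm \<Rightarrow> 'm \<Rightarrow> bool"
  where "triangle_map K T T' u v w \<longleftrightarrow> (case T of (f, g, h) \<Rightarrow> case T' of (f', g', h') \<Rightarrow>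
    u \<in> Hom K (Dom K f) (Dom K f') \<and> v \<in> Hom K (Dom K g) (Dom K g')
    \<and> w \<in> Hom K (Dom K h) (Dom K h')
    \<and> f' \<cdot>\<^bsub>K\<^esub> u = v \<cdot>\<^bsub>K\<^esub> f \<and> g' \<cdot>\<^bsub>K\<^esub> v = w \<cdot>\<^bsub>K\<^esub> g \<and> h' \<cdot>\<^bsub>K\<^esub> w = Shm K u \<cdot>\<^bsub>K\<^esub> h)"

locale triangulated_category = additive_category K
  for K :: "('o, 'm, 'r) tricat_scheme" (structure) +
  assumes shift_equivalence: "is_equivalence K K (Sh K) (Shm K)"
    and shift_additive: "is_additive K K (Sh K) (Shm K)"
    and Tri_triangle: "(f, g, h) \<in> Tri K \<Longrightarrow> is_triangle K f g h"
    and TR1_iso: "\<lbrakk>T \<in> Tri K; is_triangle K f g h; triangle_map K T (f, g, h) u v w;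
            invertible_arr K u; invertible_arr K v; invertible_arr K w\<rbrakk> \<Longrightarrow> (f, g, h) \<in> Tri K"
    and TR1_ident: "\<lbrakk>x \<in> Obj K; zero_object K z\<rbrakk>
           \<Longrightarrow> (\<I> x, Zero K x z, Zero K z (Sh K x)) \<in> Tri K"
    and TR1_cone: "f \<in> Arr K \<Longrightarrow> \<exists>g h. (f, g, h) \<in> Tri K"
    and TR2: "is_triangle K f g h \<Longrightarrow> (f, g, h) \<in> Tri K \<longleftrightarrow> (g, h, Neg K (Shm K f)) \<in> Tri K"
    and TR3: "\<lbrakk>(f, g, h) \<in> Tri K; (f', g', h') \<in> Tri K;
            u \<in> Hom K (Dom K f) (Dom K f'); v \<in> Hom K (Dom K g) (Dom K g'); f' \<cdot> u = v \<cdot> f\<rbrakk>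
           \<Longrightarrow> \<exists>w. triangle_map K (f, g, h) (f', g', h') u v w"
    and TR4: "\<lbrakk>f \<in> Hom K x y; g \<in> Hom K y z;
            (f, a, a') \<in> Tri K; (g, b, b') \<in> Tri K; (g \<cdot> f, e, e') \<in> Tri K\<rbrakk>
           \<Longrightarrow> \<exists>m\<in>Hom K (Cod K a) (Cod K e). \<exists>n\<in>Hom K (Cod K e) (Cod K b).
                 (m, n, Shm K a \<cdot> b') \<in> Tri K \<and> m \<cdot> a = e \<cdot> g \<and> e' \<cdot> m = a'
                 \<and> n \<cdot> e = b \<and> b' \<cdot> n = Shm K f \<cdot> e'"

text \<open>Exact functors carry a natural isomorphism \<open>\<zeta>\<^sub>x : F(\<Sigma>x) \<cong> \<Sigma>(Fx)\<close>.\<close>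

definition is_exact :: "('o, 'm, 'r) tricat_scheme \<Rightarrow> ('p, 'n, 's) tricat_scheme
    \<Rightarrow> ('o \<Rightarrow> 'p) \<Rightarrow> ('m \<Rightarrow> 'n) \<Rightarrow> ('o \<Rightarrow> 'n) \<Rightarrow> bool"
  where "is_exact K L Fo Fm \<zeta> \<longleftrightarrow> is_additive K L Fo Fm
    \<and> (\<forall>x\<in>Obj K. \<zeta> x \<in> Iso L (Fo (Sh K x)) (Sh L (Fo x)))
    \<and> (\<forall>x\<in>Obj K. \<forall>y\<in>Obj K. \<forall>f\<in>Hom K x y. \<zeta> y \<cdot>\<^bsub>L\<^esub> Fm (Shm K f) = Shm L (Fm f) \<cdot>\<^bsub>L\<^esub> \<zeta> x)
    \<and> (\<forall>f g h. (f, g, h) \<in> Tri K \<longrightarrow> (Fm f, Fm g, \<zeta> (Dom K f) \<cdot>\<^bsub>L\<^esub> Fm h) \<in> Tri L)"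

text \<open>
  Full isomorphism-closed subcategories are identified with their sets of objects.  Closure under
  suspensions means closure under all powers of \<open>\<Sigma>\<close>, negative ones included, whence the \<open>\<longleftrightarrow>\<close>.
\<close>

definition thick :: "('o, 'm, 'r) tricat_scheme \<Rightarrow> 'o set \<Rightarrow> bool"
  where "thick K M \<longleftrightarrow> M \<subseteq> Obj K
    \<and> (\<forall>z. zero_object K z \<longrightarrow> z \<in> M)
    \<and> (\<forall>x y. x \<in> M \<and> Iso K x y \<noteq> {} \<longrightarrow> y \<in> M)
    \<and> (\<forall>x\<in>Obj K. x \<in> M \<longleftrightarrow> Sh K x \<in> M)
    \<and> (\<forall>f g h. (f, g, h) \<in> Tri K \<and> Dom K f \<in> M \<and> Cod K f \<in> M \<longrightarrow> Cod K g \<in> M)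
    \<and> (\<forall>x y b. is_direct_sum K x y b \<and> b \<in> M \<longrightarrow> x \<in> M)"

definition thick_closure :: "('o, 'm, 'r) tricat_scheme \<Rightarrow> 'o set \<Rightarrow> 'o set"
  where "thick_closure K S = \<Inter>{M. thick K M \<and> S \<subseteq> M}"

definition inclusion_order :: "'a set set \<Rightarrow> 'a set gorder"
  where "inclusion_order A = \<lparr>carrier = A, eq = (=), le = (\<subseteq>)\<rparr>"

definition thick_lattice :: "('o, 'm, 'r) tricat_scheme \<Rightarrow> 'o set gorder"
  where "thick_lattice K = inclusion_order {M. thick K M}"

definition confluent :: "('o, 'm, 'r) tricat_scheme \<Rightarrow> ('p, 'n, 's) tricat_scheme
    \<Rightarrow> ('o \<Rightarrow> 'p) \<Rightarrow> bool"
  where "confluent K L Fo \<longleftrightarrow> thick_closure L (Fo ` Obj K) = Obj L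
    \<and> (\<forall>M N. thick K M \<and> thick K N \<longrightarrow>
         thick_closure L (Fo ` M) \<inter> thick_closure L (Fo ` N) = thick_closure L (Fo ` (M \<inter> N)))"


section \<open>Localizations\<close>

text \<open>
  In the Verdier quotient \<open>K/N\<close> a morphism \<open>x \<rightarrow> y\<close> is a class of roofs
  \<open>x \<leftarrow>s\<midarrow> z \<midarrow>f\<rightarrow> y\<close> with the cone of \<open>s\<close> in \<open>N\<close>, two roofs being identified if they
  are dominated by a common one.
\<close>

definition cone_in :: "('o, 'm, 'r) tricat_scheme \<Rightarrow> 'o set \<Rightarrow> 'm set"
  where "cone_in K N = {s. \<exists>g h. (s, g, h) \<in> Tri K \<and> Cod K g \<in> N}"

definition roofs :: "('o, 'm, 'r) tricat_scheme \<Rightarrow> 'o set \<Rightarrow> 'o \<Rightarrow> 'o \<Rightarrow> ('m \<times> 'm) set"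
  where "roofs K N x y = {(s, f). s \<in> Arr K \<and> f \<in> Arr K \<and> s \<in> cone_in K N
           \<and> Dom K s = Dom K f \<and> Cod K s = x \<and> Cod K f = y}"

definition roof_equiv :: "('o, 'm, 'r) tricat_scheme \<Rightarrow> 'o set \<Rightarrow> 'm \<times> 'm \<Rightarrow> 'm \<times> 'm \<Rightarrow> bool"
  where "roof_equiv K N \<rho> \<sigma> \<longleftrightarrow> (case \<rho> of (s, f) \<Rightarrow> case \<sigma> of (t, g) \<Rightarrow>
    \<exists>w\<in>Obj K. \<exists>a\<in>Hom K w (Dom K s). \<exists>b\<in>Hom K w (Dom K t).
      s \<cdot>\<^bsub>K\<^esub> a = t \<cdot>\<^bsub>K\<^esub> b \<and> f \<cdot>\<^bsub>K\<^esub> a = g \<cdot>\<^bsub>K\<^esub> b \<and> s \<cdot>\<^bsub>K\<^esub> a \<in> cone_in K N)"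

definition kernel :: "('o, 'm, 'r) cat_scheme \<Rightarrow> ('p, 'n, 's) cat_scheme
    \<Rightarrow> ('o \<Rightarrow> 'p) \<Rightarrow> 'o set"
  where "kernel K L Fo = {x \<in> Obj K. zero_object L (Fo x)}"

definition roof_image :: "('p, 'n, 's) cat_scheme \<Rightarrow> ('m \<Rightarrow> 'n) \<Rightarrow> 'm \<times> 'm \<Rightarrow> 'n"
  where "roof_image L Fm = (\<lambda>(s, f). Fm f \<cdot>\<^bsub>L\<^esub> inverse_arr L (Fm s))"

text \<open>
  A localization: the functor \<open>K/ker F \<rightarrow> L\<close> induced by the exact functor \<open>F\<close> is an equivalence,
  i.e. essentially surjective, full and faithful.
\<close>

definition is_localization :: "('o, 'm, 'r) tricat_scheme \<Rightarrow> ('p, 'n, 's) tricat_scheme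
    \<Rightarrow> ('o \<Rightarrow> 'p) \<Rightarrow> ('m \<Rightarrow> 'n) \<Rightarrow> bool"
  where "is_localization K L Fo Fm \<longleftrightarrow>
    (\<forall>d\<in>Obj L. \<exists>x\<in>Obj K. Iso L (Fo x) d \<noteq> {})
    \<and> (\<forall>x\<in>Obj K. \<forall>y\<in>Obj K.
         roof_image L Fm ` roofs K (kernel K L Fo) x y = Hom L (Fo x) (Fo y)
         \<and> (\<forall>\<rho>\<in>roofs K (kernel K L Fo) x y. \<forall>\<sigma>\<in>roofs K (kernel K L Fo) x y.
              roof_image L Fm \<rho> = roof_image L Fm \<sigma> \<longrightarrow> roof_equiv K (kernel K L Fo) \<rho> \<sigma>))"


section \<open>Rigid tensor triangulated categories\<close>

record ('o, 'm) ttcat = "('o, 'm) tricat" +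
  Ten :: "'o \<Rightarrow> 'o \<Rightarrow> 'o"  (infixl \<open>\<otimes>\<^sub>o\<index>\<close> 80)
  Tenm :: "'m \<Rightarrow> 'm \<Rightarrow> 'm"  (infixl \<open>\<otimes>\<^sub>m\<index>\<close> 80)
  Unt :: 'o
  Asc :: "'o \<Rightarrow> 'o \<Rightarrow> 'o \<Rightarrow> 'm"
  Lun :: "'o \<Rightarrow> 'm"
  Run :: "'o \<Rightarrow> 'm"
  Brd :: "'o \<Rightarrow> 'o \<Rightarrow> 'm"

locale tt_category = triangulated_category K
  for K :: "('o, 'm, 'r) ttcat_scheme" (structure) +
  assumes unit_in: "Unt K \<in> Obj K"
    and tensor_in: "\<lbrakk>x \<in> Obj K; y \<in> Obj K\<rbrakk> \<Longrightarrow> x \<otimes>\<^sub>o y \<in> Obj K"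
    and tensor_hom: "\<lbrakk>f \<in> Hom K x x'; g \<in> Hom K y y'\<rbrakk>
           \<Longrightarrow> f \<otimes>\<^sub>m g \<in> Hom K (x \<otimes>\<^sub>o y) (x' \<otimes>\<^sub>o y')"
    and tensor_ident: "\<lbrakk>x \<in> Obj K; y \<in> Obj K\<rbrakk> \<Longrightarrow> \<I> x \<otimes>\<^sub>m \<I> y = \<I> (x \<otimes>\<^sub>o y)"
    and tensor_comp: "\<lbrakk>f \<in> Hom K x x'; f' \<in> Hom K x' x''; g \<in> Hom K y y'; g' \<in> Hom K y' y''\<rbrakk>
           \<Longrightarrow> (f' \<cdot> f) \<otimes>\<^sub>m (g' \<cdot> g) = (f' \<otimes>\<^sub>m g') \<cdot> (f \<otimes>\<^sub>m g)"
    and assoc_iso: "\<lbrakk>x \<in> Obj K; y \<in> Obj K; z \<in> Obj K\<rbrakk>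
           \<Longrightarrow> Asc K x y z \<in> Iso K ((x \<otimes>\<^sub>o y) \<otimes>\<^sub>o z) (x \<otimes>\<^sub>o (y \<otimes>\<^sub>o z))"
    and assoc_natural: "\<lbrakk>f \<in> Hom K x x'; g \<in> Hom K y y'; h \<in> Hom K z z'\<rbrakk>
           \<Longrightarrow> Asc K x' y' z' \<cdot> ((f \<otimes>\<^sub>m g) \<otimes>\<^sub>m h) = (f \<otimes>\<^sub>m (g \<otimes>\<^sub>m h)) \<cdot> Asc K x y z"
    and lunit_iso: "x \<in> Obj K \<Longrightarrow> Lun K x \<in> Iso K (Unt K \<otimes>\<^sub>o x) x"
    and lunit_natural: "f \<in> Hom K x x' \<Longrightarrow> Lun K x' \<cdot> (\<I> (Unt K) \<otimes>\<^sub>m f) = f \<cdot> Lun K x"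
    and runit_iso: "x \<in> Obj K \<Longrightarrow> Run K x \<in> Iso K (x \<otimes>\<^sub>o Unt K) x"
    and runit_natural: "f \<in> Hom K x x' \<Longrightarrow> Run K x' \<cdot> (f \<otimes>\<^sub>m \<I> (Unt K)) = f \<cdot> Run K x"
    and braid_iso: "\<lbrakk>x \<in> Obj K; y \<in> Obj K\<rbrakk> \<Longrightarrow> Brd K x y \<in> Iso K (x \<otimes>\<^sub>o y) (y \<otimes>\<^sub>o x)"
    and braid_natural: "\<lbrakk>f \<in> Hom K x x'; g \<in> Hom K y y'\<rbrakk>
           \<Longrightarrow> Brd K x' y' \<cdot> (f \<otimes>\<^sub>m g) = (g \<otimes>\<^sub>m f) \<cdot> Brd K x y"
    and pentagon: "\<lbrakk>w \<in> Obj K; x \<in> Obj K; y \<in> Obj K; z \<in> Obj K\<rbrakk>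
           \<Longrightarrow> Asc K w x (y \<otimes>\<^sub>o z) \<cdot> Asc K (w \<otimes>\<^sub>o x) y z
             = (\<I> w \<otimes>\<^sub>m Asc K x y z) \<cdot> Asc K w (x \<otimes>\<^sub>o y) z \<cdot> (Asc K w x y \<otimes>\<^sub>m \<I> z)"
    and unit_triangle: "\<lbrakk>x \<in> Obj K; y \<in> Obj K\<rbrakk>
           \<Longrightarrow> (\<I> x \<otimes>\<^sub>m Lun K y) \<cdot> Asc K x (Unt K) y = Run K x \<otimes>\<^sub>m \<I> y"
    and hexagon: "\<lbrakk>x \<in> Obj K; y \<in> Obj K; z \<in> Obj K\<rbrakk>
           \<Longrightarrow> Asc K y z x \<cdot> Brd K x (y \<otimes>\<^sub>o z) \<cdot> Asc K x y z
             = (\<I> y \<otimes>\<^sub>m Brd K x z) \<cdot> Asc K y x z \<cdot> (Brd K x y \<otimes>\<^sub>m \<I> z)"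
    and symmetric: "\<lbrakk>x \<in> Obj K; y \<in> Obj K\<rbrakk> \<Longrightarrow> Brd K y x \<cdot> Brd K x y = \<I> (x \<otimes>\<^sub>o y)"
    and tensor_exact_right: "a \<in> Obj K
           \<Longrightarrow> \<exists>\<zeta>. is_exact K K (\<lambda>x. a \<otimes>\<^sub>o x) (\<lambda>f. \<I> a \<otimes>\<^sub>m f) \<zeta>"
    and tensor_exact_left: "a \<in> Obj K
           \<Longrightarrow> \<exists>\<zeta>. is_exact K K (\<lambda>x. x \<otimes>\<^sub>o a) (\<lambda>f. f \<otimes>\<^sub>m \<I> a) \<zeta>"

definition is_internal_hom :: "('o, 'm, 'r) ttcat_scheme \<Rightarrow> 'o \<Rightarrow> 'o \<Rightarrow> 'o \<Rightarrow> 'm \<Rightarrow> bool"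
  where "is_internal_hom K x y h ev \<longleftrightarrow> h \<in> Obj K \<and> ev \<in> Hom K (h \<otimes>\<^sub>o\<^bsub>K\<^esub> x) y
    \<and> (\<forall>z\<in>Obj K. \<forall>f\<in>Hom K (z \<otimes>\<^sub>o\<^bsub>K\<^esub> x) y.
         \<exists>!u. u \<in> Hom K z h \<and> ev \<cdot>\<^bsub>K\<^esub> (u \<otimes>\<^sub>m\<^bsub>K\<^esub> \<I>\<^bsub>K\<^esub> x) = f)"

text \<open>
  \<open>ev : d \<otimes> x \<rightarrow> 1\<close> and \<open>co : 1 \<rightarrow> x \<otimes> d\<close> exhibit \<open>d\<close> as a dual of \<open>x\<close> (the two zigzag identities).
\<close>

definition is_dual :: "('o, 'm, 'r) ttcat_scheme \<Rightarrow> 'o \<Rightarrow> 'o \<Rightarrow> 'm \<Rightarrow> 'm \<Rightarrow> bool"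
  where "is_dual K x d ev co \<longleftrightarrow> d \<in> Obj K
    \<and> ev \<in> Hom K (d \<otimes>\<^sub>o\<^bsub>K\<^esub> x) (Unt K) \<and> co \<in> Hom K (Unt K) (x \<otimes>\<^sub>o\<^bsub>K\<^esub> d)
    \<and> Run K x \<cdot>\<^bsub>K\<^esub> (\<I>\<^bsub>K\<^esub> x \<otimes>\<^sub>m\<^bsub>K\<^esub> ev) \<cdot>\<^bsub>K\<^esub> Asc K x d x \<cdot>\<^bsub>K\<^esub> (co \<otimes>\<^sub>m\<^bsub>K\<^esub> \<I>\<^bsub>K\<^esub> x) = Lun K x
    \<and> Lun K d \<cdot>\<^bsub>K\<^esub> (ev \<otimes>\<^sub>m\<^bsub>K\<^esub> \<I>\<^bsub>K\<^esub> d) \<cdot>\<^bsub>K\<^esub> inverse_arr K (Asc K d x d) \<cdot>\<^bsub>K\<^esub> (\<I>\<^bsub>K\<^esub> d \<otimes>\<^sub>m\<^bsub>K\<^esub> co)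
        = Run K d"

locale rigid_tt_category = tt_category K
  for K :: "('o, 'm, 'r) ttcat_scheme" (structure) +
  assumes closed: "\<lbrakk>x \<in> Obj K; y \<in> Obj K\<rbrakk> \<Longrightarrow> \<exists>h ev. is_internal_hom K x y h ev"
    and dualizable: "x \<in> Obj K \<Longrightarrow> \<exists>d ev co. is_dual K x d ev co"

definition is_monoidal :: "('o, 'm, 'r) ttcat_scheme \<Rightarrow> ('p, 'n, 's) ttcat_scheme
    \<Rightarrow> ('o \<Rightarrow> 'p) \<Rightarrow> ('m \<Rightarrow> 'n) \<Rightarrow> ('o \<times> 'o \<Rightarrow> 'n) \<Rightarrow> 'n \<Rightarrow> bool"
  where "is_monoidal K L Fo Fm \<mu> \<epsilon> \<longleftrightarrow> is_functor K L Fo Fm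
    \<and> \<epsilon> \<in> Iso L (Unt L) (Fo (Unt K))
    \<and> (\<forall>x\<in>Obj K. \<forall>y\<in>Obj K. \<mu> (x, y) \<in> Iso L (Fo x \<otimes>\<^sub>o\<^bsub>L\<^esub> Fo y) (Fo (x \<otimes>\<^sub>o\<^bsub>K\<^esub> y)))
    \<and> (\<forall>x\<in>Obj K. \<forall>x'\<in>Obj K. \<forall>y\<in>Obj K. \<forall>y'\<in>Obj K. \<forall>f\<in>Hom K x x'. \<forall>g\<in>Hom K y y'.
         \<mu> (x', y') \<cdot>\<^bsub>L\<^esub> (Fm f \<otimes>\<^sub>m\<^bsub>L\<^esub> Fm g) = Fm (f \<otimes>\<^sub>m\<^bsub>K\<^esub> g) \<cdot>\<^bsub>L\<^esub> \<mu> (x, y))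
    \<and> (\<forall>x\<in>Obj K. \<forall>y\<in>Obj K. \<forall>z\<in>Obj K.
         Fm (Asc K x y z) \<cdot>\<^bsub>L\<^esub> \<mu> (x \<otimes>\<^sub>o\<^bsub>K\<^esub> y, z) \<cdot>\<^bsub>L\<^esub> (\<mu> (x, y) \<otimes>\<^sub>m\<^bsub>L\<^esub> \<I>\<^bsub>L\<^esub> (Fo z))
         = \<mu> (x, y \<otimes>\<^sub>o\<^bsub>K\<^esub> z) \<cdot>\<^bsub>L\<^esub> (\<I>\<^bsub>L\<^esub> (Fo x) \<otimes>\<^sub>m\<^bsub>L\<^esub> \<mu> (y, z)) \<cdot>\<^bsub>L\<^esub> Asc L (Fo x) (Fo y) (Fo z))
    \<and> (\<forall>x\<in>Obj K. Fm (Lun K x) \<cdot>\<^bsub>L\<^esub> \<mu> (Unt K, x) \<cdot>\<^bsub>L\<^esub> (\<epsilon> \<otimes>\<^sub>m\<^bsub>L\<^esub> \<I>\<^bsub>L\<^esub> (Fo x)) = Lun L (Fo x))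
    \<and> (\<forall>x\<in>Obj K. Fm (Run K x) \<cdot>\<^bsub>L\<^esub> \<mu> (x, Unt K) \<cdot>\<^bsub>L\<^esub> (\<I>\<^bsub>L\<^esub> (Fo x) \<otimes>\<^sub>m\<^bsub>L\<^esub> \<epsilon>) = Run L (Fo x))"


section \<open>The category of rigid tt-categories and confluent monoidal localizations\<close>

text \<open>
  A morphism consists of source, target, the functor on objects and morphisms, and its structure
  isomorphisms \<open>F(\<Sigma>x) \<cong> \<Sigma>(Fx)\<close>, \<open>Fx \<otimes> Fy \<cong> F(x \<otimes> y)\<close> and \<open>1 \<cong> F1\<close>.  The functions are required to
  be \<open>extensional\<close> so that equality of the records is equality of monoidal exact functors.
\<close>

record ('o, 'm) ttmor =
  Src :: "('o, 'm) ttcat"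
  Tgt :: "('o, 'm) ttcat"
  FO :: "'o \<Rightarrow> 'o"
  FM :: "'m \<Rightarrow> 'm"
  FShift :: "'o \<Rightarrow> 'm"
  FTensor :: "'o \<times> 'o \<Rightarrow> 'm"
  FUnit :: 'm

definition confluent_monoidal_localization :: "('o, 'm) ttmor \<Rightarrow> bool"
  where "confluent_monoidal_localization F \<longleftrightarrow>
    is_exact (Src F) (Tgt F) (FO F) (FM F) (FShift F)
    \<and> is_monoidal (Src F) (Tgt F) (FO F) (FM F) (FTensor F) (FUnit F)
    \<and> is_localization (Src F) (Tgt F) (FO F) (FM F)
    \<and> confluent (Src F) (Tgt F) (FO F)"

definition ttmor_extensional :: "('o, 'm) ttmor \<Rightarrow> bool"
  where "ttmor_extensional F \<longleftrightarrow> FO F \<in> extensional (Obj (Src F)) \<and> FM F \<in> extensional (Arr (Src F))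
    \<and> FShift F \<in> extensional (Obj (Src F)) \<and> FTensor F \<in> extensional (Obj (Src F) \<times> Obj (Src F))"

definition ttmor_ident :: "('o, 'm) ttcat \<Rightarrow> ('o, 'm) ttmor"
  where "ttmor_ident K = \<lparr>Src = K, Tgt = K,
    FO = (\<lambda>x\<in>Obj K. x),
    FM = (\<lambda>f\<in>Arr K. f),
    FShift = (\<lambda>x\<in>Obj K. \<I>\<^bsub>K\<^esub> (Sh K x)),
    FTensor = (\<lambda>(x, y)\<in>Obj K \<times> Obj K. \<I>\<^bsub>K\<^esub> (x \<otimes>\<^sub>o\<^bsub>K\<^esub> y)),
    FUnit = \<I>\<^bsub>K\<^esub> (Unt K)\<rparr>"

definition ttmor_comp :: "('o, 'm) ttmor \<Rightarrow> ('o, 'm) ttmor \<Rightarrow> ('o, 'm) ttmor"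
  where "ttmor_comp G F = \<lparr>Src = Src F, Tgt = Tgt G,
    FO = (\<lambda>x\<in>Obj (Src F). FO G (FO F x)),
    FM = (\<lambda>f\<in>Arr (Src F). FM G (FM F f)),
    FShift = (\<lambda>x\<in>Obj (Src F). FShift G (FO F x) \<cdot>\<^bsub>Tgt G\<^esub> FM G (FShift F x)),
    FTensor = (\<lambda>(x, y)\<in>Obj (Src F) \<times> Obj (Src F).
                 FM G (FTensor F (x, y)) \<cdot>\<^bsub>Tgt G\<^esub> FTensor G (FO F x, FO F y)),
    FUnit = FM G (FUnit F) \<cdot>\<^bsub>Tgt G\<^esub> FUnit G\<rparr>"

definition rttcat_conf_loc :: "(('o, 'm) ttcat, ('o, 'm) ttmor) cat"
  where "rttcat_conf_loc = \<lparr>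
    Obj = {K. rigid_tt_category K},
    Arr = {F. rigid_tt_category (Src F) \<and> rigid_tt_category (Tgt F)
              \<and> ttmor_extensional F \<and> confluent_monoidal_localization F},
    Dom = Src, Cod = Tgt, Ident = ttmor_ident, Comp = ttmor_comp\<rparr>"


section \<open>Functors to sober spaces\<close>

definition irreducible_closedin :: "'a topology \<Rightarrow> 'a set \<Rightarrow> bool"
  where "irreducible_closedin X Z \<longleftrightarrow> closedin X Z \<and> Z \<noteq> {}
    \<and> (\<forall>A B. closedin X A \<and> closedin X B \<and> Z = A \<union> B \<longrightarrow> Z = A \<or> Z = B)"

definition sober_space :: "'a topology \<Rightarrow> bool"
  where "sober_space X \<longleftrightarrow>
    (\<forall>Z. irreducible_closedin X Z \<longrightarrow> (\<exists>!z. z \<in> topspace X \<and> X closure_of {z} = Z))"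

text \<open>
  Covariant functors from a category \<open>C\<close> to the category of sober spaces and continuous maps, and
  natural transformations between them.  The underlying sets of the spaces in the values of the two
  functors may live in different types; continuous maps are compared on the underlying sets.
\<close>

definition sob_functor :: "('o, 'm, 'r) cat_scheme \<Rightarrow> ('o \<Rightarrow> 'a topology) \<Rightarrow> ('m \<Rightarrow> 'a \<Rightarrow> 'a) \<Rightarrow> bool"
  where "sob_functor C X Xm \<longleftrightarrow> category C
    \<and> (\<forall>c\<in>Obj C. sober_space (X c))
    \<and> (\<forall>u\<in>Arr C. continuous_map (X (Dom C u)) (X (Cod C u)) (Xm u))
    \<and> (\<forall>c\<in>Obj C. \<forall>p\<in>topspace (X c). Xm (\<I>\<^bsub>C\<^esub> c) p = p)
    \<and> (\<forall>u\<in>Arr C. \<forall>v\<in>Arr C. Cod C u = Dom C v \<longrightarrow>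
         (\<forall>p\<in>topspace (X (Dom C u)). Xm (v \<cdot>\<^bsub>C\<^esub> u) p = Xm v (Xm u p)))"

definition sob_natural_transformation :: "('o, 'm, 'r) cat_scheme
    \<Rightarrow> ('o \<Rightarrow> 'a topology) \<Rightarrow> ('m \<Rightarrow> 'a \<Rightarrow> 'a)
    \<Rightarrow> ('o \<Rightarrow> 'b topology) \<Rightarrow> ('m \<Rightarrow> 'b \<Rightarrow> 'b) \<Rightarrow> ('o \<Rightarrow> 'a \<Rightarrow> 'b) \<Rightarrow> bool"
  where "sob_natural_transformation C X Xm Y Ym \<phi> \<longleftrightarrow>
    sob_functor C X Xm \<and> sob_functor C Y Ym
    \<and> (\<forall>c\<in>Obj C. continuous_map (X c) (Y c) (\<phi> c))
    \<and> (\<forall>u\<in>Arr C. \<forall>p\<in>topspace (X (Dom C u)). \<phi> (Cod C u) (Xm u p) = Ym u (\<phi> (Dom C u) p))"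


section \<open>The non-tensor spectrum\<close>

definition points :: "('a, 'r) gorder_scheme \<Rightarrow> ('a \<Rightarrow> bool) set"
  where "points L = {p \<in> extensional (carrier L).
    (\<forall>x\<in>carrier L. \<forall>y\<in>carrier L. x \<sqsubseteq>\<^bsub>L\<^esub> y \<longrightarrow> p x \<le> p y)
    \<and> p \<top>\<^bsub>L\<^esub> \<and> (\<forall>x\<in>carrier L. \<forall>y\<in>carrier L. p (x \<sqinter>\<^bsub>L\<^esub> y) \<longleftrightarrow> p x \<and> p y)
    \<and> (\<forall>A\<subseteq>carrier L. p (\<Squnion>\<^bsub>L\<^esub>A) \<longleftrightarrow> (\<exists>a\<in>A. p a))}"

definition point_space :: "('a, 'r) gorder_scheme \<Rightarrow> ('a \<Rightarrow> bool) topology"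
  where "point_space L = topology (\<lambda>U. \<exists>l\<in>carrier L. U = {p \<in> points L. p l})"

definition Spcnt :: "('o, 'm, 'r) tricat_scheme \<Rightarrow> ('o set \<Rightarrow> bool) topology"
  where "Spcnt K = point_space (thick_lattice K)"

definition Spcnt_map :: "('o, 'm) ttmor \<Rightarrow> ('o set \<Rightarrow> bool) \<Rightarrow> 'o set \<Rightarrow> bool"
  where "Spcnt_map F p = (\<lambda>M\<in>carrier (thick_lattice (Src F)). p (thick_closure (Tgt F) (FO F ` M)))"


section \<open>The Hochster dual of the Balmer spectrum\<close>

definition thick_ideal :: "('o, 'm, 'r) ttcat_scheme \<Rightarrow> 'o set \<Rightarrow> bool"
  where "thick_ideal K J \<longleftrightarrow> thick K J \<and> (\<forall>x\<in>Obj K. \<forall>y\<in>J. x \<otimes>\<^sub>o\<^bsub>K\<^esub> y \<in> J)"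

definition prime_ideal :: "('o, 'm, 'r) ttcat_scheme \<Rightarrow> 'o set \<Rightarrow> bool"
  where "prime_ideal K P \<longleftrightarrow> thick_ideal K P \<and> P \<noteq> Obj K
    \<and> (\<forall>x\<in>Obj K. \<forall>y\<in>Obj K. x \<otimes>\<^sub>o\<^bsub>K\<^esub> y \<in> P \<longrightarrow> x \<in> P \<or> y \<in> P)"

definition supp :: "('o, 'm, 'r) ttcat_scheme \<Rightarrow> 'o \<Rightarrow> 'o set set"
  where "supp K x = {P. prime_ideal K P \<and> x \<notin> P}"

definition Spc :: "('o, 'm, 'r) ttcat_scheme \<Rightarrow> 'o set topology"
  where "Spc K = topology_generated_by ((\<lambda>x. {P. prime_ideal K P} - supp K x) ` Obj K)"

definition hochster_dual :: "'a topology \<Rightarrow> 'a topology"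
  where "hochster_dual X = topology_generated_by {C. closedin X C \<and> compactin X (topspace X - C)}"

definition Spc_dual :: "('o, 'm, 'r) ttcat_scheme \<Rightarrow> 'o set topology"
  where "Spc_dual K = hochster_dual (Spc K)"

definition Spc_map :: "('o, 'm) ttmor \<Rightarrow> 'o set \<Rightarrow> 'o set"
  where "Spc_map F P = {x \<in> Obj (Src F). FO F x \<in> P}"


section \<open>The comparison map\<close>

definition ideal_closure :: "('o, 'm, 'r) ttcat_scheme \<Rightarrow> 'o set \<Rightarrow> 'o set"
  where "ideal_closure K S = \<Inter>{J. thick_ideal K J \<and> S \<subseteq> J}"

definition ideal_lattice :: "('o, 'm, 'r) ttcat_scheme \<Rightarrow> 'o set gorder"
  where "ideal_lattice K = inclusion_order {J. thick_ideal K J}"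

text \<open>
  The inclusion of the lattice of thick \<open>\<otimes>\<close>-ideals into the lattice of all thick subcategories
  preserves meets and joins, so a point of the latter restricts to a point of the former.  The space
  of points of the ideal lattice is the Hochster dual of the Balmer spectrum: a point \<open>q\<close> corresponds
  to the prime ideal that is the join of the thick ideals sent to \<open>0\<close> by \<open>q\<close>, namely the ideal of all
  objects \<open>x\<close> whose generated thick ideal is sent to \<open>0\<close>.
\<close>

definition prime_of_point :: "('o, 'm, 'r) ttcat_scheme \<Rightarrow> ('o set \<Rightarrow> bool) \<Rightarrow> 'o set"
  where "prime_of_point K q = {x \<in> Obj K. \<not> q (ideal_closure K {x})}"

definition comparison :: "('o, 'm, 'r) ttcat_scheme \<Rightarrow> ('o set \<Rightarrow> bool) \<Rightarrow> 'o set"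
  where "comparison K p = prime_of_point K (restrict p (carrier (ideal_lattice K)))"

end

theory Submission
  imports Defs
begin

text \<open>
  A point \<open>p\<close> of the lattice of thick subcategories is determined by the largest thick subcategory
  \<open>N\<close> that it sends to \<open>0\<close>.  The comparison map sends \<open>p\<close> to the largest thick \<open>\<otimes>\<close>-ideal contained
  in \<open>N\<close>.  Rigidity makes this ideal prime: an object \<open>z\<close> is a retract of \<open>z \<otimes> d \<otimes> z\<close>, where \<open>d\<close> is
  its dual, so thick ideals are radical (\<open>thick_ideal_radical\<close>) and the ideals generated by single
  objects satisfy \<open>\<langle>x\<rangle> \<inter> \<langle>y\<rangle> = \<langle>x \<otimes> y\<rangle>\<close> (\<open>ideal_closure_Int\<close>); since \<open>p\<close> preserves binary meets,
  primality follows (\<open>comparison_prime\<close>).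

  The topology of the Hochster dual is generated by the supports (\<open>Spc_dual_eq\<close>).  This rests on the
  quasi-compactness of the open sets \<open>{P | x \<in> P}\<close>, which is a form of Krull's lemma: an ideal maximal
  among those avoiding a \<open>\<otimes>\<close>-multiplicative set is prime (\<open>prime_ideal_avoiding\<close>).  The preimage of
  \<open>supp x\<close> under the comparison map is \<open>{p | p \<langle>x\<rangle> = 1}\<close>, an open set, so the map is continuous.
  Both kinds of spaces are sober for the same reason: for an irreducible closed set \<open>Z\<close>, the property
  of meeting \<open>Z\<close> is compatible with finite intersections of open sets, and this defines a generic
  point.

  Naturality along \<open>F : K \<rightarrow> L\<close> amounts to \<open>thick(F\<langle>x\<rangle>) = \<langle>Fx\<rangle>\<close>.  The inclusion from right to left
  needs \<open>thick(F\<langle>x\<rangle>)\<close> to be an ideal of \<open>L\<close>, which holds because \<open>F\<close> is monoidal and essentially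
  surjective (\<open>thick_closure_image_ideal_closure\<close>).

  That confluent monoidal localizations form a category requires them to be closed under composition.
  An exact functor \<open>F\<close> inverts exactly the morphisms with cone in its kernel
  (\<open>cone_in_kernel_iff\<close>), so \<open>F\<close> is a localization iff it is essentially surjective, every morphism
  \<open>h : Fx \<rightarrow> Fy\<close> satisfies \<open>h \<cdot> Fs = Ff\<close> with \<open>Fs\<close> invertible, and any two morphisms identified by
  \<open>F\<close> are equalized by some \<open>s\<close> with \<open>Fs\<close> invertible (\<open>is_localization_iff\<close>).  In this form the
  property is visibly stable under composition, without manipulating roofs.
\<close>


section \<open>Categories and functors\<close>

context category
begin

lemma HomI: "\<lbrakk>f \<in> Arr C; Dom C f = x; Cod C f = y\<rbrakk> \<Longrightarrow> f \<in> Hom C x y"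
  by (simp add: Hom_def)

lemma ident_arr [simp]: "x \<in> Obj C \<Longrightarrow> \<I> x \<in> Arr C"
  and ident_dom [simp]: "x \<in> Obj C \<Longrightarrow> Dom C (\<I> x) = x"
  and ident_cod [simp]: "x \<in> Obj C \<Longrightarrow> Cod C (\<I> x) = x"
  using ident_in by (auto simp: Hom_def)

lemma comp_arr [simp]: "\<lbrakk>f \<in> Arr C; g \<in> Arr C; Cod C f = Dom C g\<rbrakk> \<Longrightarrow> g \<cdot> f \<in> Arr C"
  and comp_dom [simp]: "\<lbrakk>f \<in> Arr C; g \<in> Arr C; Cod C f = Dom C g\<rbrakk> \<Longrightarrow> Dom C (g \<cdot> f) = Dom C f"
  and comp_cod [simp]: "\<lbrakk>f \<in> Arr C; g \<in> Arr C; Cod C f = Dom C g\<rbrakk> \<Longrightarrow> Cod C (g \<cdot> f) = Cod C g"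
  using comp_in[of f "Dom C f" "Cod C f" g "Cod C g"] by (auto simp: Hom_def)

lemma comp_ident_left [simp]: "\<lbrakk>f \<in> Arr C; Cod C f = y\<rbrakk> \<Longrightarrow> \<I> y \<cdot> f = f"
  and comp_ident_right [simp]: "\<lbrakk>f \<in> Arr C; Dom C f = x\<rbrakk> \<Longrightarrow> f \<cdot> \<I> x = f"
  using ident_left ident_right by (auto simp: Hom_def)

lemma assoc [simp]:
  "\<lbrakk>f \<in> Arr C; g \<in> Arr C; h \<in> Arr C; Cod C f = Dom C g; Cod C g = Dom C h\<rbrakk>
     \<Longrightarrow> (h \<cdot> g) \<cdot> f = h \<cdot> g \<cdot> f"
  using comp_assoc[of f "Dom C f" "Dom C g" g "Dom C h" h "Cod C h"] by (auto simp: Hom_def)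

declare dom_in [simp] cod_in [simp]

lemma inverse_pairI:
  assumes "f \<in> Arr C" "g \<in> Arr C" "Dom C g = Cod C f" "Cod C g = Dom C f"
    "g \<cdot> f = \<I> (Dom C f)" "f \<cdot> g = \<I> (Cod C f)"
  shows "inverse_pair C f g"
  using assms by (simp add: inverse_pair_def Hom_def)

lemma left_right_inverse_eq:
  assumes "f \<in> Arr C" "g \<in> Arr C" "h \<in> Arr C" "Dom C g = Cod C f" "Cod C g = Dom C f"
    "Dom C h = Cod C f" "Cod C h = Dom C f" "g \<cdot> f = \<I> (Dom C f)" "f \<cdot> h = \<I> (Cod C f)"
  shows "g = h"
proof -
  have "g = g \<cdot> \<I> (Cod C f)" using assms(1,2,4) by simp
  also have "\<dots> = (g \<cdot> f) \<cdot> h" unfolding assms(9)[symmetric] using assms(1-7) by simp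
  also have "\<dots> = h" unfolding assms(8) using assms(1-7) by simp
  finally show ?thesis .
qed

lemma inverse_arr_eqI:
  assumes "inverse_pair C f g"
  shows "inverse_arr C f = g"
  unfolding inverse_arr_def
proof (rule the_equality[where P = "inverse_pair C f", OF assms])
  fix h assume "inverse_pair C f h"
  then show "h = g"
    using assms left_right_inverse_eq[of f h g] by (auto simp: inverse_pair_def Hom_def)
qed

lemma inverse_arr_pair: "invertible_arr C f \<Longrightarrow> inverse_pair C f (inverse_arr C f)"
  using inverse_arr_eqI by (auto simp: invertible_arr_def)

lemma invertible_arr_arr: "invertible_arr C f \<Longrightarrow> f \<in> Arr C"
  by (auto simp: invertible_arr_def inverse_pair_def)

lemma inverse_arr_simps [simp]:
  assumes "invertible_arr C f"
  shows "inverse_arr C f \<in> Arr C" "Dom C (inverse_arr C f) = Cod C f"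
    "Cod C (inverse_arr C f) = Dom C f"
    "inverse_arr C f \<cdot> f = \<I> (Dom C f)" "f \<cdot> inverse_arr C f = \<I> (Cod C f)"
  using inverse_arr_pair[OF assms] by (auto simp: inverse_pair_def Hom_def)

lemma inverse_arr_cancel [simp]:
  assumes "invertible_arr C f" "h \<in> Arr C"
  shows "Cod C h = Dom C f \<Longrightarrow> inverse_arr C f \<cdot> f \<cdot> h = h"
    "Cod C h = Cod C f \<Longrightarrow> f \<cdot> inverse_arr C f \<cdot> h = h"
proof -
  note f = invertible_arr_arr[OF assms(1)]
  show "inverse_arr C f \<cdot> f \<cdot> h = h" if "Cod C h = Dom C f"
    using assms that f by (subst assoc[symmetric]) auto
  show "f \<cdot> inverse_arr C f \<cdot> h = h" if "Cod C h = Cod C f"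
    using assms that f by (subst assoc[symmetric]) auto
qed

lemma invertible_arrI:
  assumes "f \<in> Arr C" "g \<in> Arr C" "Dom C g = Cod C f" "Cod C g = Dom C f"
    "g \<cdot> f = \<I> (Dom C f)" "f \<cdot> g = \<I> (Cod C f)"
  shows "invertible_arr C f"
  using inverse_pairI[OF assms] by (auto simp: invertible_arr_def)

lemma invertible_ident [simp]: "x \<in> Obj C \<Longrightarrow> invertible_arr C (\<I> x)"
  by (rule invertible_arrI[where g = "\<I> x"]) auto

lemma invertible_inverse [simp]: "invertible_arr C f \<Longrightarrow> invertible_arr C (inverse_arr C f)"
  by (rule invertible_arrI[where g = f]) (auto dest: invertible_arr_arr)

lemma invertible_comp [simp]:
  assumes "invertible_arr C f" "invertible_arr C g" "Cod C f = Dom C g"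
  shows "invertible_arr C (g \<cdot> f)"
  using assms invertible_arr_arr[OF assms(1)] invertible_arr_arr[OF assms(2)]
  by (intro invertible_arrI[where g = "inverse_arr C f \<cdot> inverse_arr C g"]) auto

lemma Iso_iff: "f \<in> Iso C x y \<longleftrightarrow> f \<in> Arr C \<and> Dom C f = x \<and> Cod C f = y \<and> invertible_arr C f"
  by (auto simp: Iso_def Hom_def)

lemma Iso_sym: "Iso C x y \<noteq> {} \<Longrightarrow> Iso C y x \<noteq> {}"
proof -
  assume "Iso C x y \<noteq> {}"
  then obtain f where "f \<in> Iso C x y" by auto
  then have "inverse_arr C f \<in> Iso C y x" by (auto simp: Iso_iff)
  then show ?thesis by auto
qed

lemma Iso_trans: "\<lbrakk>Iso C x y \<noteq> {}; Iso C y z \<noteq> {}\<rbrakk> \<Longrightarrow> Iso C x z \<noteq> {}"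
proof -
  assume "Iso C x y \<noteq> {}" "Iso C y z \<noteq> {}"
  then obtain f g where "f \<in> Iso C x y" "g \<in> Iso C y z" by auto
  then have "g \<cdot> f \<in> Iso C x z" by (auto simp: Iso_iff)
  then show ?thesis by auto
qed

lemma category_op_cat: "category (op_cat C)"
  by unfold_locales (auto simp: op_cat_def Hom_def)

end

locale cat_functor = C: category C + D: category D
  for C :: "('o, 'm, 'r) cat_scheme" and D :: "('p, 'n, 's) cat_scheme" +
  fixes Fo :: "'o \<Rightarrow> 'p" and Fm :: "'m \<Rightarrow> 'n"
  assumes is_functor: "is_functor C D Fo Fm"
begin

lemma obj [simp]: "x \<in> Obj C \<Longrightarrow> Fo x \<in> Obj D"
  using is_functor by (simp add: is_functor_def)

lemma arr [simp]: "f \<in> Arr C \<Longrightarrow> Fm f \<in> Arr D"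
  and dom [simp]: "f \<in> Arr C \<Longrightarrow> Dom D (Fm f) = Fo (Dom C f)"
  and cod [simp]: "f \<in> Arr C \<Longrightarrow> Cod D (Fm f) = Fo (Cod C f)"
proof -
  assume f: "f \<in> Arr C"
  then have "Fm f \<in> Hom D (Fo (Dom C f)) (Fo (Cod C f))"
    using is_functor C.HomI[of f] C.dom_in[of f] C.cod_in[of f] by (auto simp: is_functor_def)
  then show "Fm f \<in> Arr D" "Dom D (Fm f) = Fo (Dom C f)" "Cod D (Fm f) = Fo (Cod C f)"
    by (auto simp: Hom_def)
qed

lemma ident [simp]: "x \<in> Obj C \<Longrightarrow> Fm (\<I>\<^bsub>C\<^esub> x) = \<I>\<^bsub>D\<^esub> (Fo x)"
  using is_functor by (simp add: is_functor_def)

lemma comp [simp]: "\<lbrakk>f \<in> Arr C; g \<in> Arr C; Cod C f = Dom C g\<rbrakk> \<Longrightarrow> Fm (g \<cdot>\<^bsub>C\<^esub> f) = Fm g \<cdot>\<^bsub>D\<^esub> Fm f"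
  using is_functor C.HomI[of f "Dom C f" "Cod C f"] C.HomI[of g "Dom C g" "Cod C g"]
    C.dom_in[of f] C.cod_in[of f] C.cod_in[of g]
  unfolding is_functor_def by metis

lemma invertible [simp]: "invertible_arr C f \<Longrightarrow> invertible_arr D (Fm f)"
proof -
  assume f: "invertible_arr C f"
  note [simp] = C.invertible_arr_arr[OF f] f
  show ?thesis
    by (rule D.invertible_arrI[where g = "Fm (inverse_arr C f)"]) (auto simp flip: comp)
qed

lemma Iso: "Iso C x y \<noteq> {} \<Longrightarrow> Iso D (Fo x) (Fo y) \<noteq> {}"
proof -
  assume "Iso C x y \<noteq> {}"
  then obtain f where "f \<in> Iso C x y" by auto
  then have "Fm f \<in> Iso D (Fo x) (Fo y)" by (auto simp: C.Iso_iff D.Iso_iff)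
  then show ?thesis by auto
qed

end

lemma is_functorI:
  assumes "category C" "category D"
    and "\<And>x. x \<in> Obj C \<Longrightarrow> Fo x \<in> Obj D"
    and "\<And>f. f \<in> Arr C \<Longrightarrow> Fm f \<in> Arr D"
    and "\<And>f. f \<in> Arr C \<Longrightarrow> Dom D (Fm f) = Fo (Dom C f)"
    and "\<And>f. f \<in> Arr C \<Longrightarrow> Cod D (Fm f) = Fo (Cod C f)"
    and "\<And>x. x \<in> Obj C \<Longrightarrow> Fm (\<I>\<^bsub>C\<^esub> x) = \<I>\<^bsub>D\<^esub> (Fo x)"
    and "\<And>f g. \<lbrakk>f \<in> Arr C; g \<in> Arr C; Cod C f = Dom C g\<rbrakk> \<Longrightarrow> Fm (g \<cdot>\<^bsub>C\<^esub> f) = Fm g \<cdot>\<^bsub>D\<^esub> Fm f"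
  shows "is_functor C D Fo Fm"
  using assms by (auto simp: is_functor_def Hom_def)


section \<open>Zero morphisms and zero objects\<close>

context additive_category
begin

lemma Plus_Hom:
  assumes "f \<in> Hom K x y" "g \<in> Hom K x y" "x \<in> Obj K" "y \<in> Obj K"
  shows "Plus K f g \<in> Hom K x y"
proof -
  interpret G: comm_group "hom_group K x y" by (rule hom_comm_group) fact+
  show ?thesis using G.m_closed[of f g] assms by (simp add: hom_group_def)
qed

lemma Zero_Hom:
  assumes "x \<in> Obj K" "y \<in> Obj K"
  shows "Zero K x y \<in> Hom K x y"
proof -
  interpret G: comm_group "hom_group K x y" by (rule hom_comm_group) fact+
  show ?thesis using G.one_closed by (simp add: hom_group_def)
qed

lemma Plus_simps [simp]:
  assumes "f \<in> Arr K" "g \<in> Arr K" "Dom K g = Dom K f" "Cod K g = Cod K f"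
  shows "Plus K f g \<in> Arr K" "Dom K (Plus K f g) = Dom K f" "Cod K (Plus K f g) = Cod K f"
  using Plus_Hom[of f "Dom K f" "Cod K f" g] assms by (auto simp: Hom_def)

lemma Zero_simps [simp]:
  assumes "x \<in> Obj K" "y \<in> Obj K"
  shows "Zero K x y \<in> Arr K" "Dom K (Zero K x y) = x" "Cod K (Zero K x y) = y"
  using Zero_Hom[OF assms] by (auto simp: Hom_def)

lemma Plus_Zero [simp]:
  assumes "f \<in> Arr K" "Dom K f = x" "Cod K f = y"
  shows "Plus K f (Zero K x y) = f" "Plus K (Zero K x y) f = f"
proof -
  interpret G: comm_group "hom_group K x y" by (rule hom_comm_group) (use assms in auto)
  show "Plus K f (Zero K x y) = f" "Plus K (Zero K x y) f = f"
    using G.r_one[of f] G.l_one[of f] assms by (auto simp: hom_group_def Hom_def)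
qed

lemma Plus_idem_Zero:
  assumes "f \<in> Arr K" "Plus K f f = f"
  shows "f = Zero K (Dom K f) (Cod K f)"
proof -
  interpret G: comm_group "hom_group K (Dom K f) (Cod K f)" by (rule hom_comm_group) (use assms in auto)
  show ?thesis
    using G.l_cancel_one'[of f f] assms by (auto simp: hom_group_def Hom_def)
qed

lemma comp_Zero_right [simp]:
  assumes "g \<in> Arr K" "Dom K g = y" "x \<in> Obj K"
  shows "g \<cdot> Zero K x y = Zero K x (Cod K g)"
proof -
  have "y \<in> Obj K" using assms by auto
  then have "Plus K (g \<cdot> Zero K x y) (g \<cdot> Zero K x y) = g \<cdot> Zero K x y"
    using assms comp_plus_right[of "Zero K x y" x y "Zero K x y" g "Cod K g"]
    by (simp add: Hom_def)
  from Plus_idem_Zero[OF _ this] show ?thesis using assms \<open>y \<in> Obj K\<close> by simp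
qed

lemma comp_Zero_left [simp]:
  assumes "f \<in> Arr K" "Cod K f = y" "z \<in> Obj K"
  shows "Zero K y z \<cdot> f = Zero K (Dom K f) z"
proof -
  have "y \<in> Obj K" using assms by auto
  then have "Plus K (Zero K y z \<cdot> f) (Zero K y z \<cdot> f) = Zero K y z \<cdot> f"
    using assms comp_plus_left[of f "Dom K f" y "Zero K y z" z "Zero K y z"]
    by (simp add: Hom_def)
  from Plus_idem_Zero[OF _ this] show ?thesis using assms \<open>y \<in> Obj K\<close> by simp
qed

lemma Neg_simps [simp]:
  assumes "f \<in> Arr K"
  shows "Neg K f \<in> Arr K" "Dom K (Neg K f) = Dom K f" "Cod K (Neg K f) = Cod K f"
    "Plus K f (Neg K f) = Zero K (Dom K f) (Cod K f)"
proof -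
  interpret G: comm_group "hom_group K (Dom K f) (Cod K f)" by (rule hom_comm_group) (use assms in auto)
  have "f \<in> carrier (hom_group K (Dom K f) (Cod K f))" using assms by (simp add: hom_group_def Hom_def)
  from G.inv_closed[OF this] G.r_inv[OF this]
  show "Neg K f \<in> Arr K" "Dom K (Neg K f) = Dom K f" "Cod K (Neg K f) = Cod K f"
    "Plus K f (Neg K f) = Zero K (Dom K f) (Cod K f)"
    unfolding Neg_def by (auto simp: hom_group_def Hom_def)
qed

lemma Plus_commute:
  assumes "f \<in> Arr K" "g \<in> Arr K" "Dom K g = Dom K f" "Cod K g = Cod K f"
  shows "Plus K f g = Plus K g f"
proof -
  interpret G: comm_group "hom_group K (Dom K f) (Cod K f)" by (rule hom_comm_group) (use assms in auto)
  show ?thesis using G.m_comm[of f g] assms by (auto simp: hom_group_def Hom_def)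
qed

lemma Neg_eqI:
  assumes "f \<in> Arr K" "g \<in> Arr K" "Dom K g = Dom K f" "Cod K g = Cod K f"
    "Plus K f g = Zero K (Dom K f) (Cod K f)"
  shows "Neg K f = g"
proof -
  interpret G: comm_group "hom_group K (Dom K f) (Cod K f)" by (rule hom_comm_group) (use assms in auto)
  have "g \<otimes>\<^bsub>hom_group K (Dom K f) (Cod K f)\<^esub> f = \<one>\<^bsub>hom_group K (Dom K f) (Cod K f)\<^esub>"
    using assms Plus_commute[of f g] by (simp add: hom_group_def)
  from G.inv_equality[OF this] show ?thesis
    using assms by (auto simp: Neg_def hom_group_def Hom_def)
qed

lemma comp_Neg [simp]:
  assumes "f \<in> Arr K" "g \<in> Arr K" "Cod K f = Dom K g"
  shows "g \<cdot> Neg K f = Neg K (g \<cdot> f)" "Neg K g \<cdot> f = Neg K (g \<cdot> f)"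
proof -
  show "g \<cdot> Neg K f = Neg K (g \<cdot> f)"
    using comp_plus_right[of f "Dom K f" "Cod K f" "Neg K f" g "Cod K g"] assms
    by (intro Neg_eqI[symmetric]) (auto simp: Hom_def)
  show "Neg K g \<cdot> f = Neg K (g \<cdot> f)"
    using comp_plus_left[of f "Dom K f" "Cod K f" g "Cod K g" "Neg K g"] assms
    by (intro Neg_eqI[symmetric]) (auto simp: Hom_def)
qed

lemma Neg_Neg [simp]: "f \<in> Arr K \<Longrightarrow> Neg K (Neg K f) = f"
  using Plus_commute[of f "Neg K f"] by (intro Neg_eqI) auto

lemma Neg_Zero [simp]: "\<lbrakk>x \<in> Obj K; y \<in> Obj K\<rbrakk> \<Longrightarrow> Neg K (Zero K x y) = Zero K x y"
  by (rule Neg_eqI) auto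

lemma zero_object_iff: "zero_object K z \<longleftrightarrow> z \<in> Obj K \<and> \<I> z = Zero K z z"
proof
  assume "zero_object K z"
  then have z: "z \<in> Obj K" and "\<exists>!f. f \<in> Hom K z z" by (auto simp: zero_object_def)
  moreover have "\<I> z \<in> Hom K z z" "Zero K z z \<in> Hom K z z" using z Zero_Hom ident_in by auto
  ultimately show "z \<in> Obj K \<and> \<I> z = Zero K z z" by auto
next
  assume *: "z \<in> Obj K \<and> \<I> z = Zero K z z"
  show "zero_object K z"
    unfolding zero_object_def
  proof (intro conjI ballI)
    show "z \<in> Obj K" using * by simp
    fix x assume x: "x \<in> Obj K"
    show "\<exists>!f. f \<in> Hom K x z"
    proof (rule ex1I[where a = "Zero K x z"])
      fix f assume "f \<in> Hom K x z"
      then have f: "f \<in> Arr K" "Dom K f = x" "Cod K f = z" by (auto simp: Hom_def)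
      have "f = \<I> z \<cdot> f" using f by simp
      also have "\<dots> = Zero K x z" using * f by simp
      finally show "f = Zero K x z" .
    qed (use x * Zero_Hom in auto)
    show "\<exists>!f. f \<in> Hom K z x"
    proof (rule ex1I[where a = "Zero K z x"])
      fix f assume "f \<in> Hom K z x"
      then have f: "f \<in> Arr K" "Dom K f = z" "Cod K f = x" by (auto simp: Hom_def)
      have "f = f \<cdot> \<I> z" using f by simp
      also have "\<dots> = Zero K z x" using * f x by (simp del: comp_ident_right)
      finally show "f = Zero K z x" .
    qed (use x * Zero_Hom in auto)
  qed
qed

lemma zero_object_arr:
  assumes "zero_object K z" "f \<in> Arr K"
  shows "Dom K f = z \<Longrightarrow> f = Zero K z (Cod K f)" "Cod K f = z \<Longrightarrow> f = Zero K (Dom K f) z"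
proof -
  have z: "z \<in> Obj K" "\<I> z = Zero K z z" using assms(1) by (auto simp: zero_object_iff)
  show "f = Zero K z (Cod K f)" if "Dom K f = z"
  proof -
    have "f = f \<cdot> \<I> z" using assms that by simp
    also have "\<dots> = Zero K z (Cod K f)" unfolding z(2) using assms that z(1) by simp
    finally show ?thesis .
  qed
  show "f = Zero K (Dom K f) z" if "Cod K f = z"
  proof -
    have "f = \<I> z \<cdot> f" using assms that by simp
    also have "\<dots> = Zero K (Dom K f) z" unfolding z(2) using assms that z(1) by simp
    finally show ?thesis .
  qed
qed

end

locale additive_functor = K: additive_category K + L: additive_category L
  for K :: "('o, 'm, 'r) tricat_scheme" and L :: "('p, 'n, 's) tricat_scheme" +
  fixes Fo :: "'o \<Rightarrow> 'p" and Fm :: "'m \<Rightarrow> 'n"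
  assumes is_additive: "is_additive K L Fo Fm"
begin

sublocale cat_functor K L Fo Fm
  using is_additive by unfold_locales (simp add: is_additive_def)

lemma plus [simp]:
  "\<lbrakk>f \<in> Arr K; g \<in> Arr K; Dom K g = Dom K f; Cod K g = Cod K f\<rbrakk>
     \<Longrightarrow> Fm (Plus K f g) = Plus L (Fm f) (Fm g)"
  using is_additive K.dom_in[of f] K.cod_in[of f] unfolding is_additive_def Hom_def by blast

lemma zero [simp]:
  assumes "x \<in> Obj K" "y \<in> Obj K"
  shows "Fm (Zero K x y) = Zero L (Fo x) (Fo y)"
  using L.Plus_idem_Zero[of "Fm (Zero K x y)"] plus[of "Zero K x y" "Zero K x y"] assms
  by (simp del: plus)

lemma zero_object: "zero_object K z \<Longrightarrow> zero_object L (Fo z)"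
  using ident[of z] zero[of z z] by (auto simp: K.zero_object_iff L.zero_object_iff simp del: ident zero)

lemma direct_sum: "is_direct_sum K x y b \<Longrightarrow> is_direct_sum L (Fo x) (Fo y) (Fo b)"
proof -
  assume *: "is_direct_sum K x y b"
  then obtain i j p q where bp: "is_biproduct K x y b i j p q" and o: "x \<in> Obj K" "y \<in> Obj K" "b \<in> Obj K"
    by (auto simp: is_direct_sum_def)
  note arrs = bp[unfolded is_biproduct_def Hom_def, simplified]
  have "is_biproduct L (Fo x) (Fo y) (Fo b) (Fm i) (Fm j) (Fm p) (Fm q)"
    unfolding is_biproduct_def Hom_def
    using arrs o comp[of i p] comp[of j q] comp[of j p] comp[of i q]
      plus[of "i \<cdot>\<^bsub>K\<^esub> p" "j \<cdot>\<^bsub>K\<^esub> q"] comp[of p i] comp[of q j]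
    by (simp del: comp plus)
  then show ?thesis using o by (auto simp: is_direct_sum_def)
qed

end


section \<open>Exactness in triangulated categories\<close>

lemma (in additive_category) Neg_inject:
  "\<lbrakk>f \<in> Arr K; g \<in> Arr K; Neg K f = Neg K g\<rbrakk> \<Longrightarrow> f = g"
  by (metis Neg_Neg)

context triangulated_category
begin

sublocale shift: additive_functor K K "Sh K" "Shm K"
  by unfold_locales (rule shift_additive)

lemma shift_bij: "\<lbrakk>x \<in> Obj K; y \<in> Obj K\<rbrakk> \<Longrightarrow> bij_betw (Shm K) (Hom K x y) (Hom K (Sh K x) (Sh K y))"
  using shift_equivalence by (simp add: is_equivalence_def)

lemma shift_faithful:
  assumes "f \<in> Arr K" "g \<in> Arr K" "Dom K g = Dom K f" "Cod K g = Cod K f" "Shm K f = Shm K g"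
  shows "f = g"
proof -
  have "inj_on (Shm K) (Hom K (Dom K f) (Cod K f))"
    using shift_bij assms(1) by (auto simp: bij_betw_def)
  then show ?thesis using assms by (auto simp: Hom_def dest!: inj_onD)
qed

lemma shift_full:
  assumes "h \<in> Arr K" "Dom K h = Sh K x" "Cod K h = Sh K y" "x \<in> Obj K" "y \<in> Obj K"
  shows "\<exists>f\<in>Arr K. Dom K f = x \<and> Cod K f = y \<and> Shm K f = h"
proof -
  have "h \<in> Shm K ` Hom K x y"
    using shift_bij[of x y] assms by (auto simp: bij_betw_def Hom_def)
  then show ?thesis by (auto simp: Hom_def)
qed

lemma TriD:
  assumes "(f, g, h) \<in> Tri K"
  shows "f \<in> Arr K" "g \<in> Arr K" "h \<in> Arr K" "Cod K f = Dom K g" "Cod K g = Dom K h"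
    "Cod K h = Sh K (Dom K f)"
  using Tri_triangle[OF assms] by (auto simp: is_triangle_def)

lemma Tri_rotate: "(f, g, h) \<in> Tri K \<Longrightarrow> (g, h, Neg K (Shm K f)) \<in> Tri K"
  using TR2[of f g h] Tri_triangle by blast

lemma some_zero: obtains z where "zero_object K z" "z \<in> Obj K"
  using zero_exists by (auto simp: zero_object_def)

lemma Tri_map:
  assumes "(f, g, h) \<in> Tri K" "(f', g', h') \<in> Tri K" "u \<in> Arr K" "v \<in> Arr K"
    "Dom K u = Dom K f" "Cod K u = Dom K f'" "Dom K v = Dom K g" "Cod K v = Dom K g'"
    "f' \<cdot> u = v \<cdot> f"
  obtains w where "w \<in> Arr K" "Dom K w = Dom K h" "Cod K w = Dom K h'"
    "g' \<cdot> v = w \<cdot> g" "h' \<cdot> w = Shm K u \<cdot> h"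
  using TR3[OF assms(1,2), of u v] assms that by (auto simp: triangle_map_def Hom_def)

lemma Tri_comp_zero:
  assumes T: "(f, g, h) \<in> Tri K"
  shows "g \<cdot> f = Zero K (Dom K f) (Cod K g)"
proof -
  note t = TriD[OF T]
  obtain z where z: "zero_object K z" "z \<in> Obj K" using some_zero .
  have I: "(\<I> (Dom K f), Zero K (Dom K f) z, Zero K z (Sh K (Dom K f))) \<in> Tri K"
    using TR1_ident[OF _ z(1)] t by simp
  obtain w where "w \<in> Arr K" "Dom K w = z" "Cod K w = Dom K h" "g \<cdot> f = w \<cdot> Zero K (Dom K f) z"
    using Tri_map[OF I T, of "\<I> (Dom K f)" f] t z(2) by auto
  then show ?thesis using t by simp
qed

text \<open>Compare the triangle with the trivial triangle \<open>w \<rightarrow> w \<rightarrow> 0\<close> on the source \<open>w\<close> of \<open>u\<close>.\<close>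

lemma Tri_weak_kernel:
  assumes T: "(f, g, h) \<in> Tri K" and u: "u \<in> Arr K" "Cod K u = Dom K g"
    and gu: "g \<cdot> u = Zero K (Dom K u) (Cod K g)"
  shows "\<exists>v\<in>Arr K. Dom K v = Dom K u \<and> Cod K v = Dom K f \<and> f \<cdot> v = u"
proof -
  note t = TriD[OF T]
  obtain z where z: "zero_object K z" "z \<in> Obj K" using some_zero .
  define w where "w = Dom K u"
  have w: "w \<in> Obj K" using u by (simp add: w_def)
  have I: "(Zero K w z, Zero K z (Sh K w), Neg K (Shm K (\<I> w))) \<in> Tri K"
    using Tri_rotate[OF TR1_ident[OF w z(1)]] .
  \<comment> \<open>Rotating both triangles turns the third leg of the morphism of triangles into a shifted lift.\<close>
  obtain r where r: "r \<in> Arr K" "Dom K r = Sh K w" "Cod K r = Sh K (Dom K f)"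
    "Neg K (Shm K f) \<cdot> r = Shm K u \<cdot> Neg K (Shm K (\<I> w))"
    using Tri_map[OF I Tri_rotate[OF T], of u "Zero K z (Cod K g)"] t z(2) w u gu
    by (auto simp: w_def)
  obtain v where v: "v \<in> Arr K" "Dom K v = w" "Cod K v = Dom K f" "Shm K v = r"
    using shift_full[OF r(1-3) w] t by auto
  have "Neg K (Shm K (f \<cdot> v)) = Neg K (Shm K u)"
    using r v t u w by (simp add: w_def)
  then have "Shm K (f \<cdot> v) = Shm K u" by (rule Neg_inject[rotated 2]) (use r v t u in simp_all)
  then have "f \<cdot> v = u" by (rule shift_faithful[rotated 4]) (use v t u in \<open>auto simp: w_def\<close>)
  then show ?thesis using v w_def by auto
qed

text \<open>Dually, map the triangle to \<open>0 \<rightarrow> w \<rightarrow> w\<close>, where \<open>w\<close> is the target of \<open>u\<close>.\<close>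

lemma Tri_weak_cokernel:
  assumes T: "(f, g, h) \<in> Tri K" and u: "u \<in> Arr K" "Dom K u = Cod K f"
    and uf: "u \<cdot> f = Zero K (Dom K f) (Cod K u)"
  shows "\<exists>v\<in>Arr K. Dom K v = Cod K g \<and> Cod K v = Cod K u \<and> v \<cdot> g = u"
proof -
  note t = TriD[OF T]
  obtain z where z: "zero_object K z" "z \<in> Obj K" using some_zero .
  define w where "w = Cod K u"
  have w: "w \<in> Obj K" using u by (simp add: w_def)
  have Sz: "zero_object K (Sh K z)" by (rule shift.zero_object) (rule z(1))
  have "(\<I> w, Zero K w (Sh K z), Neg K (Shm K (Zero K z w))) \<in> Tri K"
    using TR1_ident[OF w Sz] z w by simp
  then have I: "(Zero K z w, \<I> w, Zero K w (Sh K z)) \<in> Tri K"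
    using TR2[of "Zero K z w" "\<I> w" "Zero K w (Sh K z)"] z w by (auto simp: is_triangle_def)
  obtain v where v: "v \<in> Arr K" "Dom K v = Dom K h" "Cod K v = w" and vg: "\<I> w \<cdot> u = v \<cdot> g"
    by (rule Tri_map[OF T I, of "Zero K (Dom K f) z" u]) (use t z(2) w u uf in \<open>simp_all add: w_def[symmetric]\<close>)
  have "v \<cdot> g = u" unfolding vg[symmetric] using u by (simp add: w_def)
  then show ?thesis using v t w_def by (intro bexI[where x = v]) simp_all
qed

text \<open>
  If the cone is zero then \<open>\<I>\<close> lifts through \<open>f\<close> and, one rotation further, extends along
  \<open>\<Sigma>f\<close>; conversely an invertible \<open>f\<close> kills both maps adjacent to the cone, whose identity therefore
  vanishes.
\<close>

lemma Tri_cone_zero_iff: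
  assumes T: "(f, g, h) \<in> Tri K"
  shows "zero_object K (Cod K g) \<longleftrightarrow> invertible_arr K f"
proof
  note t = TriD[OF T]
  note T' = Tri_rotate[OF T] and T'' = Tri_rotate[OF Tri_rotate[OF T]]
  {
    assume c: "zero_object K (Cod K g)"
    have g: "g = Zero K (Dom K g) (Cod K g)" using zero_object_arr(2)[OF c t(2) refl] .
    have h: "h = Zero K (Dom K h) (Cod K h)" using zero_object_arr(1)[OF c t(3) t(5)[symmetric]] by (simp only: t(5))
    have "g \<cdot> \<I> (Dom K g) = Zero K (Dom K (\<I> (Dom K g))) (Cod K g)"
      using t g by simp
    from Tri_weak_kernel[OF T _ _ this] t obtain v where
      v: "v \<in> Arr K" "Dom K v = Dom K g" "Cod K v = Dom K f" "f \<cdot> v = \<I> (Dom K g)" by auto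
    have "\<exists>v\<in>Arr K. Dom K v = Sh K (Cod K f) \<and> Cod K v = Cod K h \<and> v \<cdot> Neg K (Shm K f) = \<I> (Cod K h)"
      using t Tri_weak_cokernel[OF T'', of "\<I> (Cod K h)"] h by auto
    then obtain r where r: "r \<in> Arr K" "Dom K r = Sh K (Cod K f)" "Cod K r = Sh K (Dom K f)"
      "r \<cdot> Neg K (Shm K f) = \<I> (Sh K (Dom K f))" using t by auto
    obtain l where l: "l \<in> Arr K" "Dom K l = Cod K f" "Cod K l = Dom K f" "Shm K l = Neg K r"
      using shift_full[of "Neg K r" "Cod K f" "Dom K f"] r t by auto
    have "Shm K (l \<cdot> f) = Shm K (\<I> (Dom K f))" using l r t by simp
    then have lf: "l \<cdot> f = \<I> (Dom K f)" by (rule shift_faithful[rotated 4]) (use l t in auto)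
    have "l = v" using left_right_inverse_eq[of f l v] l v lf t by auto
    then show "invertible_arr K f" using l v lf t by (intro invertible_arrI[where g = l]) auto
  }
  {
    assume f: "invertible_arr K f"
    have "g = (g \<cdot> f) \<cdot> inverse_arr K f" using f t by simp
    also have "\<dots> = Zero K (Dom K g) (Cod K g)" unfolding Tri_comp_zero[OF T] using f t by simp
    finally have g: "g = Zero K (Dom K g) (Cod K g)" .
    have Sf: "invertible_arr K (Shm K f)" using f by simp
    have "Neg K (Shm K f \<cdot> h) = Zero K (Dom K h) (Sh K (Cod K f))"
      using Tri_comp_zero[OF T''] t by simp
    then have "Neg K (Neg K (Shm K f \<cdot> h)) = Zero K (Dom K h) (Sh K (Cod K f))" using t by simp
    then have Sfh: "Shm K f \<cdot> h = Zero K (Dom K h) (Sh K (Cod K f))" using t by simp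
    have "h = inverse_arr K (Shm K f) \<cdot> Shm K f \<cdot> h" using Sf t by simp
    also have "\<dots> = Zero K (Dom K h) (Cod K h)" unfolding Sfh using Sf t by simp
    finally have h: "h = Zero K (Dom K h) (Cod K h)" .
    have "h \<cdot> \<I> (Cod K g) = Zero K (Dom K (\<I> (Cod K g))) (Cod K h)" using t h by simp
    from Tri_weak_kernel[OF T' _ _ this] t obtain v where
      v: "v \<in> Arr K" "Dom K v = Cod K g" "Cod K v = Dom K g" "g \<cdot> v = \<I> (Cod K g)" by auto
    then have "\<I> (Cod K g) = Zero K (Cod K g) (Cod K g)" using g t
      by (metis comp_Zero_left cod_in)
    then show "zero_object K (Cod K g)" using t by (simp add: zero_object_iff)
  }
qed

text \<open>
  The connecting map of the cone of a split monomorphism \<open>i\<close> vanishes because \<open>\<Sigma>i\<close> is monic, so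
  the identity of the cone lifts through \<open>g\<close>.
\<close>

lemma split_mono_cone:
  assumes T: "(i, g, h) \<in> Tri K" and p: "p \<in> Arr K" "Dom K p = Cod K i" "Cod K p = Dom K i"
    and pi: "p \<cdot> i = \<I> (Dom K i)"
  shows "\<exists>v\<in>Arr K. Dom K v = Cod K g \<and> Cod K v = Dom K g \<and> g \<cdot> v = \<I> (Cod K g)"
proof -
  note t = TriD[OF T] and T' = Tri_rotate[OF T]
  have "Shm K i \<cdot> h = Zero K (Dom K h) (Sh K (Cod K i))"
  proof -
    have "Neg K (Shm K i \<cdot> h) = Zero K (Dom K h) (Sh K (Cod K i))"
      using Tri_comp_zero[OF Tri_rotate[OF T']] t
      by simp
    then have "Neg K (Neg K (Shm K i \<cdot> h)) = Zero K (Dom K h) (Sh K (Cod K i))" using t by simp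
    then show ?thesis using t by simp
  qed
  then have "Shm K p \<cdot> Shm K i \<cdot> h = Zero K (Dom K h) (Cod K h)" using p t by simp
  moreover have "Shm K p \<cdot> Shm K i \<cdot> h = Shm K (p \<cdot> i) \<cdot> h" using p t by simp
  ultimately have h: "h = Zero K (Dom K h) (Cod K h)" unfolding pi using t by simp
  have "h \<cdot> \<I> (Cod K g) = Zero K (Dom K (\<I> (Cod K g))) (Cod K h)" using t h by simp
  from Tri_weak_kernel[OF T' _ _ this] t show ?thesis by auto
qed

text \<open>
  Retracts split: the cone of \<open>i\<close> is a complement, whose inclusion is the factorization of the
  complementary idempotent \<open>1 - ip\<close> through the cone.
\<close>

lemma retract_direct_sum:
  assumes i: "i \<in> Arr K" and p: "p \<in> Arr K" "Dom K p = Cod K i" "Cod K p = Dom K i"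
    and pi: "p \<cdot> i = \<I> (Dom K i)"
  shows "\<exists>c. is_direct_sum K (Dom K i) c (Cod K i)"
proof -
  obtain g h where T: "(i, g, h) \<in> Tri K" using TR1_cone[OF i] by auto
  note t = TriD[OF T]
  have gi: "g \<cdot> i = Zero K (Dom K i) (Cod K g)" by (rule Tri_comp_zero[OF T])
  obtain v where v: "v \<in> Arr K" "Dom K v = Cod K g" "Cod K v = Dom K g" "g \<cdot> v = \<I> (Cod K g)"
    using split_mono_cone[OF T p pi] by blast
  define e where "e = Plus K (\<I> (Cod K i)) (Neg K (i \<cdot> p))"
  have e: "e \<in> Arr K" "Dom K e = Cod K i" "Cod K e = Cod K i" using i p by (auto simp: e_def)
  have he: "a \<cdot> e = Plus K a (Neg K (a \<cdot> i \<cdot> p))" if "a \<in> Arr K" "Dom K a = Cod K i" for a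
    using comp_plus_right[of "\<I> (Cod K i)" "Cod K i" "Cod K i" "Neg K (i \<cdot> p)" a "Cod K a"] that i p
    by (simp add: e_def Hom_def)
  have eh: "e \<cdot> a = Plus K a (Neg K (i \<cdot> p \<cdot> a))" if "a \<in> Arr K" "Cod K a = Cod K i" for a
    using comp_plus_left[of a "Dom K a" "Cod K i" "\<I> (Cod K i)" "Cod K i" "Neg K (i \<cdot> p)"] that i p
    by (simp add: e_def Hom_def)
  have "e \<cdot> i = Zero K (Dom K i) (Cod K e)" using eh[of i] i pi e by simp
  from Tri_weak_cokernel[OF T e(1,2) this] obtain j where
    j: "j \<in> Arr K" "Dom K j = Cod K g" "Cod K j = Cod K i" "j \<cdot> g = e" unfolding e(3) by blast
  have split_epi: "a = b" if "a \<in> Arr K" "b \<in> Arr K" "Dom K a = Cod K g" "Dom K b = Cod K g"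
    "a \<cdot> g = b \<cdot> g" for a b
  proof -
    have "a = (a \<cdot> g) \<cdot> v" using that(1,3) v t by simp
    also have "\<dots> = b" unfolding that(5) using that(2,4) v t by simp
    finally show ?thesis .
  qed
  have "p \<cdot> i \<cdot> p = (p \<cdot> i) \<cdot> p" using i p by simp
  also have "\<dots> = p" unfolding pi using p by simp
  finally have "p \<cdot> e = Zero K (Dom K p) (Cod K p)" using he[of p] p by simp
  then have pj: "p \<cdot> j = Zero K (Cod K g) (Dom K i)"
    using split_epi[of "p \<cdot> j" "Zero K (Cod K g) (Dom K i)"] p j t by simp
  have "g \<cdot> i \<cdot> p = (g \<cdot> i) \<cdot> p" using i p t by simp
  also have "\<dots> = Zero K (Dom K g) (Cod K g)" unfolding gi using p t by simp
  finally have "g \<cdot> e = g" using he[of g] t by simp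
  then have gj: "g \<cdot> j = \<I> (Cod K g)"
    using split_epi[of "g \<cdot> j" "\<I> (Cod K g)"] j t by simp
  have "Plus K (i \<cdot> p) e = \<I> (Cod K i)"
  proof -
    interpret G: comm_group "hom_group K (Cod K i) (Cod K i)" by (rule hom_comm_group) (use i in auto)
    have m: "i \<cdot> p \<in> carrier (hom_group K (Cod K i) (Cod K i))"
      "\<I> (Cod K i) \<in> carrier (hom_group K (Cod K i) (Cod K i))"
      "Neg K (i \<cdot> p) \<in> carrier (hom_group K (Cod K i) (Cod K i))"
      using i p by (auto simp: hom_group_def Hom_def)
    have "Plus K (i \<cdot> p) (Neg K (i \<cdot> p)) = Zero K (Cod K i) (Cod K i)" using i p by simp
    then show ?thesis
      using G.m_lcomm[OF m(1,2,3)] G.r_one[OF m(2)] by (simp add: e_def hom_group_def)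
  qed
  then have "is_biproduct K (Dom K i) (Cod K g) (Cod K i) i j p g"
    using i p t j gi pi pj gj by (simp add: is_biproduct_def Hom_def)
  moreover have "Dom K i \<in> Obj K" "Cod K i \<in> Obj K" "Cod K g \<in> Obj K" using i t(2) by auto
  ultimately show ?thesis unfolding is_direct_sum_def by blast
qed

end


section \<open>Thick subcategories\<close>

context triangulated_category
begin

lemma thick_subset: "thick K M \<Longrightarrow> M \<subseteq> Obj K"
  by (simp add: thick_def)

lemma thick_Iso: "\<lbrakk>thick K M; x \<in> M; Iso K x y \<noteq> {}\<rbrakk> \<Longrightarrow> y \<in> M"
  unfolding thick_def by blast

lemma thick_Iso_iff: "\<lbrakk>thick K M; Iso K x y \<noteq> {}\<rbrakk> \<Longrightarrow> x \<in> M \<longleftrightarrow> y \<in> M"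
  using thick_Iso Iso_sym by blast

lemma thick_zero: "\<lbrakk>thick K M; zero_object K z\<rbrakk> \<Longrightarrow> z \<in> M"
  by (simp add: thick_def)

lemma thick_shift: "\<lbrakk>thick K M; x \<in> Obj K\<rbrakk> \<Longrightarrow> x \<in> M \<longleftrightarrow> Sh K x \<in> M"
  unfolding thick_def by blast

lemma thick_cone:
  "\<lbrakk>thick K M; (f, g, h) \<in> Tri K; Dom K f \<in> M; Cod K f \<in> M\<rbrakk> \<Longrightarrow> Cod K g \<in> M"
  unfolding thick_def by blast

lemma thick_direct_sum: "\<lbrakk>thick K M; is_direct_sum K x y b; b \<in> M\<rbrakk> \<Longrightarrow> x \<in> M"
  unfolding thick_def by blast

lemma thick_retract:
  assumes "thick K M" "i \<in> Arr K" "p \<in> Arr K" "Dom K p = Cod K i" "Cod K p = Dom K i"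
    "p \<cdot> i = \<I> (Dom K i)" "Cod K i \<in> M"
  shows "Dom K i \<in> M"
  using retract_direct_sum[OF assms(2-6)] thick_direct_sum[OF assms(1)] assms(7) by auto

text \<open>
  The cone of the inclusion \<open>i\<close> of \<open>x\<close> is a retract of the complement \<open>y\<close>, and \<open>b\<close> is the third
  vertex of a triangle on \<open>x\<close> and that cone.
\<close>

lemma thick_direct_sum_iff:
  assumes M: "thick K M" and b: "is_direct_sum K x y b"
  shows "b \<in> M \<longleftrightarrow> x \<in> M \<and> y \<in> M"
proof
  obtain i j p q where o: "x \<in> Obj K" "y \<in> Obj K" "b \<in> Obj K" and bp: "is_biproduct K x y b i j p q"
    using b by (auto simp: is_direct_sum_def)
  have a: "i \<in> Arr K" "Dom K i = x" "Cod K i = b" "j \<in> Arr K" "Dom K j = y" "Cod K j = b"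
    "p \<in> Arr K" "Dom K p = b" "Cod K p = x" "q \<in> Arr K" "Dom K q = b" "Cod K q = y"
    and e: "p \<cdot> i = \<I> x" "q \<cdot> j = \<I> y" "p \<cdot> j = Zero K y x" "q \<cdot> i = Zero K x y"
      "Plus K (i \<cdot> p) (j \<cdot> q) = \<I> b"
    using bp by (auto simp: is_biproduct_def Hom_def)
  show "x \<in> M \<and> y \<in> M" if "b \<in> M"
    using thick_retract[OF M, of i p] thick_retract[OF M, of j q] a e that by simp
  assume xy: "x \<in> M \<and> y \<in> M"
  obtain g h where T: "(i, g, h) \<in> Tri K" using TR1_cone[OF a(1)] by auto
  note t = TriD[OF T]
  have gd: "Dom K g = b" using t a by simp
  obtain v where v: "v \<in> Arr K" "Dom K v = Cod K g" "Cod K v = b" "g \<cdot> v = \<I> (Cod K g)"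
    using split_mono_cone[OF T, of p] gd unfolding a by (auto simp: a(7) e(1))
  have "q \<cdot> i = Zero K (Dom K i) (Cod K q)" using a e by simp
  from Tri_weak_cokernel[OF T a(10) _ this] a obtain r where
    r: "r \<in> Arr K" "Dom K r = Cod K g" "Cod K r = y" and rg: "r \<cdot> g = q" by auto
  have "g \<cdot> i \<cdot> p = (g \<cdot> i) \<cdot> p" using a t by simp
  also have "\<dots> = Zero K b (Cod K g)" unfolding Tri_comp_zero[OF T] using a t by simp
  finally have gip: "g \<cdot> i \<cdot> p = Zero K b (Cod K g)" .
  have "g = g \<cdot> Plus K (i \<cdot> p) (j \<cdot> q)" unfolding e using t gd by simp
  also have "\<dots> = Plus K (g \<cdot> i \<cdot> p) (g \<cdot> j \<cdot> q)"
    using comp_plus_right[of "i \<cdot> p" b b "j \<cdot> q" g "Cod K g"] a t gd by (simp add: Hom_def)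
  also have "\<dots> = g \<cdot> j \<cdot> q" unfolding gip using a t gd by simp
  finally have gjq: "g = g \<cdot> j \<cdot> q" .
  have "(g \<cdot> j) \<cdot> r = (g \<cdot> j) \<cdot> r \<cdot> (g \<cdot> v)" unfolding v(4) using a t gd r by simp
  also have "\<dots> = (g \<cdot> j \<cdot> (r \<cdot> g)) \<cdot> v" using a t gd r v(1-3) by simp
  also have "\<dots> = \<I> (Cod K g)" unfolding rg gjq[symmetric] by (rule v(4))
  finally have "(g \<cdot> j) \<cdot> r = \<I> (Dom K r)" using r by simp
  then have "Dom K r \<in> M" using thick_retract[OF M r(1), of "g \<cdot> j"] a t gd r xy by simp
  then have c: "Cod K g \<in> M" using r by simp
  have "Dom K h \<in> M" "Cod K h \<in> M" using c xy t a thick_shift[OF M o(1)] by auto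
  then have "Cod K (Neg K (Shm K i)) \<in> M"
    using thick_cone[OF M Tri_rotate[OF Tri_rotate[OF T]]] by simp
  then show "b \<in> M" using a thick_shift[OF M o(3)] by simp
qed

lemma thick_Obj: "thick K (Obj K)"
  unfolding thick_def using TriD by (auto simp: zero_object_def is_direct_sum_def Iso_iff)

lemma thick_Inter:
  assumes "A \<noteq> {}" "\<And>M. M \<in> A \<Longrightarrow> thick K M"
  shows "thick K (\<Inter>A)"
proof -
  have "\<Inter>A \<subseteq> Obj K" using assms thick_subset by blast
  moreover have "\<forall>z. zero_object K z \<longrightarrow> z \<in> \<Inter>A" using assms(2) thick_zero by blast
  moreover have "\<forall>x y. x \<in> \<Inter>A \<and> Iso K x y \<noteq> {} \<longrightarrow> y \<in> \<Inter>A"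
    using assms(2) thick_Iso by blast
  moreover have "\<forall>x\<in>Obj K. (x \<in> \<Inter>A) = (Sh K x \<in> \<Inter>A)"
    using assms(2) thick_shift by blast
  moreover have "\<forall>f g h. (f, g, h) \<in> Tri K \<and> Dom K f \<in> \<Inter>A \<and> Cod K f \<in> \<Inter>A \<longrightarrow> Cod K g \<in> \<Inter>A"
    using assms(2) thick_cone by blast
  moreover have "\<forall>x y b. is_direct_sum K x y b \<and> b \<in> \<Inter>A \<longrightarrow> x \<in> \<Inter>A"
    using assms(2) thick_direct_sum by blast
  ultimately show ?thesis unfolding thick_def by (intro conjI)
qed

lemma thick_Int: "\<lbrakk>thick K M; thick K N\<rbrakk> \<Longrightarrow> thick K (M \<inter> N)"
  using thick_Inter[of "{M, N}"] by auto

lemma thick_closure_thick: "S \<subseteq> Obj K \<Longrightarrow> thick K (thick_closure K S)"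
  unfolding thick_closure_def using thick_Obj by (intro thick_Inter) auto

lemma thick_closure_upper: "S \<subseteq> thick_closure K S"
  by (auto simp: thick_closure_def)

lemma thick_closure_least: "\<lbrakk>thick K M; S \<subseteq> M\<rbrakk> \<Longrightarrow> thick_closure K S \<subseteq> M"
  by (auto simp: thick_closure_def)

lemma thick_closure_idem: "thick K M \<Longrightarrow> thick_closure K M = M"
  using thick_closure_least[of M M] thick_closure_upper[of M] by auto

end


section \<open>Exact functors\<close>

locale exact_functor = K: triangulated_category K + L: triangulated_category L
  for K :: "('o, 'm, 'r) tricat_scheme" and L :: "('p, 'n, 's) tricat_scheme" +
  fixes Fo :: "'o \<Rightarrow> 'p" and Fm :: "'m \<Rightarrow> 'n" and \<zeta> :: "'o \<Rightarrow> 'n"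
  assumes is_exact: "is_exact K L Fo Fm \<zeta>"
begin

sublocale additive_functor K L Fo Fm
  using is_exact by unfold_locales (simp add: is_exact_def)

lemma shift_iso [simp]:
  assumes "x \<in> Obj K"
  shows "\<zeta> x \<in> Arr L" "Dom L (\<zeta> x) = Fo (Sh K x)" "Cod L (\<zeta> x) = Sh L (Fo x)"
    "invertible_arr L (\<zeta> x)"
  using is_exact assms by (auto simp: is_exact_def L.Iso_iff)

lemma shift_natural:
  "f \<in> Arr K \<Longrightarrow> \<zeta> (Cod K f) \<cdot>\<^bsub>L\<^esub> Fm (Shm K f) = Shm L (Fm f) \<cdot>\<^bsub>L\<^esub> \<zeta> (Dom K f)"
  using is_exact K.dom_in[of f] K.cod_in[of f] unfolding is_exact_def Hom_def by blast

lemma triangle: "(f, g, h) \<in> Tri K \<Longrightarrow> (Fm f, Fm g, \<zeta> (Dom K f) \<cdot>\<^bsub>L\<^esub> Fm h) \<in> Tri L"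
  using is_exact by (simp add: is_exact_def)

text \<open>
  The cone of \<open>s\<close> is sent to a cone of \<open>Fs\<close>.  Hence the denominators of the Verdier quotient by the
  kernel are the morphisms inverted by \<open>F\<close>.
\<close>

lemma cone_in_kernel_iff:
  assumes "s \<in> Arr K"
  shows "s \<in> cone_in K (kernel K L Fo) \<longleftrightarrow> invertible_arr L (Fm s)"
proof -
  have *: "Cod K g \<in> kernel K L Fo \<longleftrightarrow> invertible_arr L (Fm s)" if "(s, g, h) \<in> Tri K" for g h
    using L.Tri_cone_zero_iff[OF triangle[OF that]] K.TriD[OF that] by (auto simp: kernel_def)
  then show ?thesis using K.TR1_cone[OF assms] by (auto simp: cone_in_def)
qed

lemma thick_vimage:
  assumes M: "thick L M"
  shows "thick K {x \<in> Obj K. Fo x \<in> M}"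
  unfolding thick_def
proof (intro conjI allI ballI impI)
  fix z assume "zero_object K z"
  then show "z \<in> {x \<in> Obj K. Fo x \<in> M}"
    using L.thick_zero[OF M zero_object] by (auto simp: zero_object_def)
next
  fix x y assume *: "x \<in> {x \<in> Obj K. Fo x \<in> M} \<and> Iso K x y \<noteq> {}"
  then have "y \<in> Obj K" by (auto simp: K.Iso_iff)
  then show "y \<in> {x \<in> Obj K. Fo x \<in> M}" using * L.thick_Iso[OF M _ Iso] by auto
next
  fix x assume x: "x \<in> Obj K"
  then have "\<zeta> x \<in> Iso L (Fo (Sh K x)) (Sh L (Fo x))" by (auto simp: L.Iso_iff)
  then have "Fo (Sh K x) \<in> M \<longleftrightarrow> Sh L (Fo x) \<in> M" using L.thick_Iso_iff[OF M, of "Fo (Sh K x)" "Sh L (Fo x)"] by auto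
  moreover have "Fo x \<in> M \<longleftrightarrow> Sh L (Fo x) \<in> M" by (rule L.thick_shift[OF M]) (use x in simp)
  ultimately show "(x \<in> {x \<in> Obj K. Fo x \<in> M}) = (Sh K x \<in> {x \<in> Obj K. Fo x \<in> M})"
    using x by simp
next
  fix f g h
  assume *: "(f, g, h) \<in> Tri K \<and> Dom K f \<in> {x \<in> Obj K. Fo x \<in> M} \<and> Cod K f \<in> {x \<in> Obj K. Fo x \<in> M}"
  then have T: "(f, g, h) \<in> Tri K" by simp
  note t = K.TriD[OF T]
  have "Cod L (Fm g) \<in> M" by (rule L.thick_cone[OF M triangle[OF T]]) (use * t in auto)
  then show "Cod K g \<in> {x \<in> Obj K. Fo x \<in> M}" using t by simp
next
  fix x y b assume *: "is_direct_sum K x y b \<and> b \<in> {x \<in> Obj K. Fo x \<in> M}"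
  then have "Fo x \<in> M" using L.thick_direct_sum[OF M direct_sum[of x y b]] by simp
  moreover have "x \<in> Obj K" using * by (auto simp: is_direct_sum_def)
  ultimately show "x \<in> {x \<in> Obj K. Fo x \<in> M}" by simp
qed auto

lemma thick_closure_image:
  assumes "S \<subseteq> Obj K"
  shows "thick_closure L (Fo ` thick_closure K S) = thick_closure L (Fo ` S)"
proof (rule antisym)
  have S: "Fo ` S \<subseteq> Obj L" using assms by auto
  have "thick_closure K S \<subseteq> {x \<in> Obj K. Fo x \<in> thick_closure L (Fo ` S)}"
    using assms L.thick_closure_upper[of "Fo ` S"]
    by (intro K.thick_closure_least thick_vimage L.thick_closure_thick S) auto
  then show "thick_closure L (Fo ` thick_closure K S) \<subseteq> thick_closure L (Fo ` S)"
    using S by (intro L.thick_closure_least L.thick_closure_thick) auto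
  have "thick_closure K S \<subseteq> Obj K" by (rule K.thick_closure_least[OF K.thick_Obj assms])
  then have "Fo ` thick_closure K S \<subseteq> Obj L" by auto
  then show "thick_closure L (Fo ` S) \<subseteq> thick_closure L (Fo ` thick_closure K S)"
    using K.thick_closure_upper[of S] L.thick_closure_upper[of "Fo ` thick_closure K S"]
    by (intro L.thick_closure_least L.thick_closure_thick) auto
qed

end

lemma is_exactI:
  assumes "is_functor K L Fo Fm" "triangulated_category K" "triangulated_category L"
    and "\<And>f g. \<lbrakk>f \<in> Arr K; g \<in> Arr K; Dom K g = Dom K f; Cod K g = Cod K f\<rbrakk>
           \<Longrightarrow> Fm (Plus K f g) = Plus L (Fm f) (Fm g)"
    and "\<And>x. x \<in> Obj K \<Longrightarrow> \<zeta> x \<in> Iso L (Fo (Sh K x)) (Sh L (Fo x))"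
    and "\<And>f. f \<in> Arr K \<Longrightarrow> \<zeta> (Cod K f) \<cdot>\<^bsub>L\<^esub> Fm (Shm K f) = Shm L (Fm f) \<cdot>\<^bsub>L\<^esub> \<zeta> (Dom K f)"
    and "\<And>f g h. (f, g, h) \<in> Tri K \<Longrightarrow> (Fm f, Fm g, \<zeta> (Dom K f) \<cdot>\<^bsub>L\<^esub> Fm h) \<in> Tri L"
  shows "is_exact K L Fo Fm \<zeta>"
  using assms by (auto simp: is_exact_def is_additive_def Hom_def)

lemma exact_functorI:
  "\<lbrakk>is_exact K L Fo Fm \<zeta>; triangulated_category K; triangulated_category L\<rbrakk> \<Longrightarrow> exact_functor K L Fo Fm \<zeta>"
  by (simp add: exact_functor_def exact_functor_axioms_def)

lemma (in triangulated_category) is_exact_ident: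
  "is_exact K K (\<lambda>x\<in>Obj K. x) (\<lambda>f\<in>Arr K. f) (\<lambda>x\<in>Obj K. \<I> (Sh K x))"
proof (intro is_exactI is_functorI category_axioms triangulated_category_axioms)
  fix f g h assume T: "(f, g, h) \<in> Tri K"
  then show "((\<lambda>f\<in>Arr K. f) f, (\<lambda>f\<in>Arr K. f) g,
      (\<lambda>x\<in>Obj K. \<I> (Sh K x)) (Dom K f) \<cdot> (\<lambda>f\<in>Arr K. f) h) \<in> Tri K"
    using TriD[OF T] by simp
qed (simp_all add: Iso_iff)

lemma is_exact_comp:
  assumes "exact_functor K L Fo Fm \<zeta>" "exact_functor L M Go Gm \<xi>"
  shows "is_exact K M (\<lambda>x\<in>Obj K. Go (Fo x)) (\<lambda>f\<in>Arr K. Gm (Fm f))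
    (\<lambda>x\<in>Obj K. \<xi> (Fo x) \<cdot>\<^bsub>M\<^esub> Gm (\<zeta> x))"
proof -
  interpret F: exact_functor K L Fo Fm \<zeta> by fact
  interpret G: exact_functor L M Go Gm \<xi> by fact
  show ?thesis
  proof (intro is_exactI is_functorI F.K.category_axioms G.L.category_axioms
      F.K.triangulated_category_axioms G.L.triangulated_category_axioms)
    fix x assume "x \<in> Obj K"
    then show "(\<lambda>x\<in>Obj K. \<xi> (Fo x) \<cdot>\<^bsub>M\<^esub> Gm (\<zeta> x)) x
        \<in> Iso M ((\<lambda>x\<in>Obj K. Go (Fo x)) (Sh K x)) (Sh M ((\<lambda>x\<in>Obj K. Go (Fo x)) x))"
      by (simp add: G.L.Iso_iff)
  next
    fix f assume f: "f \<in> Arr K"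
    have "(\<xi> (Fo (Cod K f)) \<cdot>\<^bsub>M\<^esub> Gm (\<zeta> (Cod K f))) \<cdot>\<^bsub>M\<^esub> Gm (Fm (Shm K f))
        = \<xi> (Fo (Cod K f)) \<cdot>\<^bsub>M\<^esub> Gm (\<zeta> (Cod K f) \<cdot>\<^bsub>L\<^esub> Fm (Shm K f))"
      using f by simp
    also have "\<dots> = (\<xi> (Cod L (Fm f)) \<cdot>\<^bsub>M\<^esub> Gm (Shm L (Fm f))) \<cdot>\<^bsub>M\<^esub> Gm (\<zeta> (Dom K f))"
      unfolding F.shift_natural[OF f] using f by simp
    also have "\<dots> = Shm M (Gm (Fm f)) \<cdot>\<^bsub>M\<^esub> \<xi> (Fo (Dom K f)) \<cdot>\<^bsub>M\<^esub> Gm (\<zeta> (Dom K f))"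
      using G.shift_natural[of "Fm f"] f by simp
    finally show "(\<lambda>x\<in>Obj K. \<xi> (Fo x) \<cdot>\<^bsub>M\<^esub> Gm (\<zeta> x)) (Cod K f) \<cdot>\<^bsub>M\<^esub> (\<lambda>f\<in>Arr K. Gm (Fm f)) (Shm K f)
        = Shm M ((\<lambda>f\<in>Arr K. Gm (Fm f)) f) \<cdot>\<^bsub>M\<^esub> (\<lambda>x\<in>Obj K. \<xi> (Fo x) \<cdot>\<^bsub>M\<^esub> Gm (\<zeta> x)) (Dom K f)"
      using f by simp
  next
    fix f g h assume T: "(f, g, h) \<in> Tri K"
    note t = F.K.TriD[OF T]
    show "((\<lambda>f\<in>Arr K. Gm (Fm f)) f, (\<lambda>f\<in>Arr K. Gm (Fm f)) g,
        (\<lambda>x\<in>Obj K. \<xi> (Fo x) \<cdot>\<^bsub>M\<^esub> Gm (\<zeta> x)) (Dom K f) \<cdot>\<^bsub>M\<^esub> (\<lambda>f\<in>Arr K. Gm (Fm f)) h) \<in> Tri M"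
      using G.triangle[OF F.triangle[OF T]] t by simp
  qed simp_all
qed


section \<open>Localizations\<close>

context exact_functor
begin

text \<open>
  Since denominators are the morphisms inverted by \<open>F\<close>, being a localization can be said without
  roofs: every morphism of \<open>L\<close> between objects in the image becomes an \<open>Ff\<close> after composing with some
  invertible \<open>Fs\<close>, and morphisms identified by \<open>F\<close> are already equalized by some such \<open>s\<close>.
\<close>

definition ess_surj where
  "ess_surj \<longleftrightarrow> (\<forall>d\<in>Obj L. \<exists>x\<in>Obj K. Iso L (Fo x) d \<noteq> {})"

definition roof_full where
  "roof_full \<longleftrightarrow> (\<forall>x\<in>Obj K. \<forall>y\<in>Obj K. \<forall>h\<in>Arr L. Dom L h = Fo x \<and> Cod L h = Fo y \<longrightarrow>
     (\<exists>s\<in>Arr K. \<exists>f\<in>Arr K. Dom K s = Dom K f \<and> Cod K s = x \<and> Cod K f = y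
        \<and> invertible_arr L (Fm s) \<and> h \<cdot>\<^bsub>L\<^esub> Fm s = Fm f))"

definition roof_faithful where
  "roof_faithful \<longleftrightarrow> (\<forall>f\<in>Arr K. \<forall>g\<in>Arr K. Dom K g = Dom K f \<and> Cod K g = Cod K f \<and> Fm f = Fm g \<longrightarrow>
     (\<exists>s\<in>Arr K. Cod K s = Dom K f \<and> invertible_arr L (Fm s) \<and> f \<cdot>\<^bsub>K\<^esub> s = g \<cdot>\<^bsub>K\<^esub> s))"

lemma ess_surjE:
  assumes ess_surj "d \<in> Obj L"
  obtains x i where "x \<in> Obj K" "invertible_arr L i" "i \<in> Arr L" "Dom L i = Fo x" "Cod L i = d"
  using assms by (fastforce simp: ess_surj_def L.Iso_iff)

lemma roof_fullE:
  assumes roof_full "h \<in> Arr L" "Dom L h = Fo x" "Cod L h = Fo y" "x \<in> Obj K" "y \<in> Obj K"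
  obtains s f where "s \<in> Arr K" "f \<in> Arr K" "Dom K s = Dom K f" "Cod K s = x" "Cod K f = y"
    "invertible_arr L (Fm s)" "h \<cdot>\<^bsub>L\<^esub> Fm s = Fm f"
  using assms unfolding roof_full_def by metis

lemma roof_faithfulE:
  assumes roof_faithful "f \<in> Arr K" "g \<in> Arr K" "Dom K g = Dom K f" "Cod K g = Cod K f" "Fm f = Fm g"
  obtains s where "s \<in> Arr K" "Cod K s = Dom K f" "invertible_arr L (Fm s)" "f \<cdot>\<^bsub>K\<^esub> s = g \<cdot>\<^bsub>K\<^esub> s"
  using assms unfolding roof_faithful_def by metis

lemma roofs_iff:
  "(s, f) \<in> roofs K (kernel K L Fo) x y \<longleftrightarrow> s \<in> Arr K \<and> f \<in> Arr K \<and> Dom K s = Dom K f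
     \<and> Cod K s = x \<and> Cod K f = y \<and> invertible_arr L (Fm s)"
  using cone_in_kernel_iff by (auto simp: roofs_def)

lemma roof_image_in:
  "\<rho> \<in> roofs K (kernel K L Fo) x y \<Longrightarrow> roof_image L Fm \<rho> \<in> Hom L (Fo x) (Fo y)"
  by (cases \<rho>) (auto simp: roofs_iff roof_image_def Hom_def)

lemma roof_equivI:
  assumes rf: roof_full and ff: roof_faithful
    and r: "(s, f) \<in> roofs K (kernel K L Fo) x y" "(t, g) \<in> roofs K (kernel K L Fo) x y"
    and eq: "roof_image L Fm (s, f) = roof_image L Fm (t, g)"
  shows "roof_equiv K (kernel K L Fo) (s, f) (t, g)"
proof -
  note st = r[unfolded roofs_iff]
  have inv: "invertible_arr L (Fm s)" "invertible_arr L (Fm t)" using st by auto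
  have eq: "Fm f \<cdot>\<^bsub>L\<^esub> inverse_arr L (Fm s) = Fm g \<cdot>\<^bsub>L\<^esub> inverse_arr L (Fm t)"
    using eq by (simp add: roof_image_def)
  \<comment> \<open>The Ore condition: \<open>(Ft)\<^sup>-\<^sup>1 Fs\<close> is represented by a roof, which completes \<open>s\<close>, \<open>t\<close> to a square.\<close>
  obtain a b where ab: "a \<in> Arr K" "b \<in> Arr K" "Dom K a = Dom K b" "Cod K a = Dom K s"
    "Cod K b = Dom K t" "invertible_arr L (Fm a)"
    and ab_eq: "(inverse_arr L (Fm t) \<cdot>\<^bsub>L\<^esub> Fm s) \<cdot>\<^bsub>L\<^esub> Fm a = Fm b"
    by (rule roof_fullE[OF rf, of "inverse_arr L (Fm t) \<cdot>\<^bsub>L\<^esub> Fm s" "Dom K s" "Dom K t"])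
      (use st inv in auto)
  have "Fm (t \<cdot>\<^bsub>K\<^esub> b) = Fm t \<cdot>\<^bsub>L\<^esub> (inverse_arr L (Fm t) \<cdot>\<^bsub>L\<^esub> Fm s) \<cdot>\<^bsub>L\<^esub> Fm a"
    unfolding ab_eq using st ab by simp
  also have "\<dots> = Fm (s \<cdot>\<^bsub>K\<^esub> a)" using st ab inv by simp
  finally have "Fm (s \<cdot>\<^bsub>K\<^esub> a) = Fm (t \<cdot>\<^bsub>K\<^esub> b)" ..
  then obtain r where r: "r \<in> Arr K" "Cod K r = Dom K a" "invertible_arr L (Fm r)"
    and r_eq: "(s \<cdot>\<^bsub>K\<^esub> a) \<cdot>\<^bsub>K\<^esub> r = (t \<cdot>\<^bsub>K\<^esub> b) \<cdot>\<^bsub>K\<^esub> r"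
    by (rule roof_faithfulE[OF ff, of "s \<cdot>\<^bsub>K\<^esub> a" "t \<cdot>\<^bsub>K\<^esub> b", rotated 4]) (use st ab in auto)
  have "Fm (f \<cdot>\<^bsub>K\<^esub> a \<cdot>\<^bsub>K\<^esub> r) = (Fm f \<cdot>\<^bsub>L\<^esub> inverse_arr L (Fm s)) \<cdot>\<^bsub>L\<^esub> Fm ((s \<cdot>\<^bsub>K\<^esub> a) \<cdot>\<^bsub>K\<^esub> r)"
    using st ab r inv by simp
  also have "\<dots> = Fm (g \<cdot>\<^bsub>K\<^esub> b \<cdot>\<^bsub>K\<^esub> r)" unfolding eq r_eq using st ab r inv by simp
  finally have "Fm (f \<cdot>\<^bsub>K\<^esub> a \<cdot>\<^bsub>K\<^esub> r) = Fm (g \<cdot>\<^bsub>K\<^esub> b \<cdot>\<^bsub>K\<^esub> r)" .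
  then obtain q where q: "q \<in> Arr K" "Cod K q = Dom K r" "invertible_arr L (Fm q)"
    and q_eq: "(f \<cdot>\<^bsub>K\<^esub> a \<cdot>\<^bsub>K\<^esub> r) \<cdot>\<^bsub>K\<^esub> q = (g \<cdot>\<^bsub>K\<^esub> b \<cdot>\<^bsub>K\<^esub> r) \<cdot>\<^bsub>K\<^esub> q"
    by (rule roof_faithfulE[OF ff, of "f \<cdot>\<^bsub>K\<^esub> a \<cdot>\<^bsub>K\<^esub> r" "g \<cdot>\<^bsub>K\<^esub> b \<cdot>\<^bsub>K\<^esub> r", rotated 4]) (use st ab r in auto)
  have "(s \<cdot>\<^bsub>K\<^esub> a \<cdot>\<^bsub>K\<^esub> r) \<cdot>\<^bsub>K\<^esub> q = (t \<cdot>\<^bsub>K\<^esub> b \<cdot>\<^bsub>K\<^esub> r) \<cdot>\<^bsub>K\<^esub> q"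
    using r_eq st ab r by simp
  then have sq: "s \<cdot>\<^bsub>K\<^esub> a \<cdot>\<^bsub>K\<^esub> r \<cdot>\<^bsub>K\<^esub> q = t \<cdot>\<^bsub>K\<^esub> b \<cdot>\<^bsub>K\<^esub> r \<cdot>\<^bsub>K\<^esub> q" using st ab r q by simp
  have fq: "f \<cdot>\<^bsub>K\<^esub> a \<cdot>\<^bsub>K\<^esub> r \<cdot>\<^bsub>K\<^esub> q = g \<cdot>\<^bsub>K\<^esub> b \<cdot>\<^bsub>K\<^esub> r \<cdot>\<^bsub>K\<^esub> q" using q_eq st ab r q by simp
  have ci: "s \<cdot>\<^bsub>K\<^esub> a \<cdot>\<^bsub>K\<^esub> r \<cdot>\<^bsub>K\<^esub> q \<in> cone_in K (kernel K L Fo)"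
    using st ab r q by (subst cone_in_kernel_iff) auto
  show ?thesis
    unfolding roof_equiv_def prod.case
    by (rule bexI[where x = "Dom K q"], rule bexI[where x = "a \<cdot>\<^bsub>K\<^esub> r \<cdot>\<^bsub>K\<^esub> q"],
        rule bexI[where x = "b \<cdot>\<^bsub>K\<^esub> r \<cdot>\<^bsub>K\<^esub> q"])
      (use sq fq ci st ab r q in \<open>auto simp: Hom_def\<close>)
qed

lemma is_localization_iff:
  "is_localization K L Fo Fm \<longleftrightarrow> ess_surj \<and> roof_full \<and> roof_faithful"
proof
  assume loc: "is_localization K L Fo Fm"
  show "ess_surj \<and> roof_full \<and> roof_faithful"
  proof (intro conjI)
    show ess_surj using loc by (simp add: is_localization_def ess_surj_def)
    show roof_full
      unfolding roof_full_def
    proof (intro ballI impI)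
      fix x y h assume x: "x \<in> Obj K" "y \<in> Obj K" and h: "h \<in> Arr L" "Dom L h = Fo x \<and> Cod L h = Fo y"
      then have "h \<in> roof_image L Fm ` roofs K (kernel K L Fo) x y"
        using loc by (simp add: is_localization_def Hom_def)
      then obtain s f where sf: "(s, f) \<in> roofs K (kernel K L Fo) x y" "h = roof_image L Fm (s, f)"
        by auto
      then have "h \<cdot>\<^bsub>L\<^esub> Fm s = Fm f" by (auto simp: roof_image_def roofs_iff)
      then show "\<exists>s\<in>Arr K. \<exists>f\<in>Arr K. Dom K s = Dom K f \<and> Cod K s = x \<and> Cod K f = y
          \<and> invertible_arr L (Fm s) \<and> h \<cdot>\<^bsub>L\<^esub> Fm s = Fm f"
        using sf(1) by (auto simp: roofs_iff)
    qed
    show roof_faithful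
      unfolding roof_faithful_def
    proof (intro ballI impI)
      fix f g assume f: "f \<in> Arr K" and g: "g \<in> Arr K"
        and eq: "Dom K g = Dom K f \<and> Cod K g = Cod K f \<and> Fm f = Fm g"
      let ?R = "roofs K (kernel K L Fo) (Dom K f) (Cod K f)"
      have "(\<I>\<^bsub>K\<^esub> (Dom K f), f) \<in> ?R" "(\<I>\<^bsub>K\<^esub> (Dom K f), g) \<in> ?R"
        using f g eq by (auto simp: roofs_iff)
      moreover have "roof_image L Fm (\<I>\<^bsub>K\<^esub> (Dom K f), f) = roof_image L Fm (\<I>\<^bsub>K\<^esub> (Dom K f), g)"
        using eq by (simp add: roof_image_def)
      ultimately have "roof_equiv K (kernel K L Fo) (\<I>\<^bsub>K\<^esub> (Dom K f), f) (\<I>\<^bsub>K\<^esub> (Dom K f), g)"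
        using loc f unfolding is_localization_def by (metis K.dom_in K.cod_in)
      then obtain a b where "a \<in> Arr K" "b \<in> Arr K" "Cod K a = Dom K f" "Cod K b = Dom K f"
        "\<I>\<^bsub>K\<^esub> (Dom K f) \<cdot>\<^bsub>K\<^esub> a = \<I>\<^bsub>K\<^esub> (Dom K f) \<cdot>\<^bsub>K\<^esub> b" "f \<cdot>\<^bsub>K\<^esub> a = g \<cdot>\<^bsub>K\<^esub> b"
        "\<I>\<^bsub>K\<^esub> (Dom K f) \<cdot>\<^bsub>K\<^esub> a \<in> cone_in K (kernel K L Fo)"
        using f by (auto simp: roof_equiv_def Hom_def)
      then show "\<exists>s\<in>Arr K. Cod K s = Dom K f \<and> invertible_arr L (Fm s) \<and> f \<cdot>\<^bsub>K\<^esub> s = g \<cdot>\<^bsub>K\<^esub> s"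
        using cone_in_kernel_iff by (intro bexI[where x = a]) auto
    qed
  qed
next
  assume *: "ess_surj \<and> roof_full \<and> roof_faithful"
  show "is_localization K L Fo Fm"
    unfolding is_localization_def
  proof (intro conjI ballI impI)
    show "\<exists>x\<in>Obj K. Iso L (Fo x) d \<noteq> {}" if "d \<in> Obj L" for d using * that by (simp add: ess_surj_def)
    fix x y assume x: "x \<in> Obj K" and y: "y \<in> Obj K"
    show "roof_image L Fm ` roofs K (kernel K L Fo) x y = Hom L (Fo x) (Fo y)"
    proof (rule antisym)
      show "roof_image L Fm ` roofs K (kernel K L Fo) x y \<subseteq> Hom L (Fo x) (Fo y)"
        using roof_image_in by auto
      show "Hom L (Fo x) (Fo y) \<subseteq> roof_image L Fm ` roofs K (kernel K L Fo) x y"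
      proof
        fix h assume "h \<in> Hom L (Fo x) (Fo y)"
        then have h: "h \<in> Arr L" "Dom L h = Fo x" "Cod L h = Fo y" by (auto simp: Hom_def)
        obtain s f where sf: "s \<in> Arr K" "f \<in> Arr K" "Dom K s = Dom K f" "Cod K s = x" "Cod K f = y"
          "invertible_arr L (Fm s)" and eq: "h \<cdot>\<^bsub>L\<^esub> Fm s = Fm f"
          by (rule roof_fullE[OF _ h x y]) (use * in auto)
        have "roof_image L Fm (s, f) = h"
          unfolding roof_image_def prod.case eq[symmetric] using sf h by simp
        then show "h \<in> roof_image L Fm ` roofs K (kernel K L Fo) x y"
          using sf by (intro image_eqI[where x = "(s, f)"]) (auto simp: roofs_iff)
      qed
    qed
    fix \<rho> \<sigma> assume "\<rho> \<in> roofs K (kernel K L Fo) x y" "\<sigma> \<in> roofs K (kernel K L Fo) x y"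
      "roof_image L Fm \<rho> = roof_image L Fm \<sigma>"
    then show "roof_equiv K (kernel K L Fo) \<rho> \<sigma>"
      using roof_equivI * by (cases \<rho>, cases \<sigma>) auto
  qed
qed

end

text \<open>
  A morphism \<open>s\<close> of \<open>L\<close> into some \<open>Fx\<close> becomes an \<open>Ft\<close> after precomposing with an isomorphism of
  \<open>L\<close>.  If \<open>G\<close> inverts \<open>s\<close> then the composite inverts \<open>t\<close>, so that denominators for \<open>G\<close> can be
  replaced by denominators in \<open>K\<close>.
\<close>

lemma is_localization_comp:
  assumes "exact_functor K L Fo Fm \<zeta>" "exact_functor L M Go Gm \<xi>"
    and locF: "is_localization K L Fo Fm" and locG: "is_localization L M Go Gm"
  shows "is_localization K M (\<lambda>x\<in>Obj K. Go (Fo x)) (\<lambda>f\<in>Arr K. Gm (Fm f))"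
proof -
  interpret F: exact_functor K L Fo Fm \<zeta> by fact
  interpret G: exact_functor L M Go Gm \<xi> by fact
  interpret H: exact_functor K M "\<lambda>x\<in>Obj K. Go (Fo x)" "\<lambda>f\<in>Arr K. Gm (Fm f)"
    "\<lambda>x\<in>Obj K. \<xi> (Fo x) \<cdot>\<^bsub>M\<^esub> Gm (\<zeta> x)"
    using is_exact_comp[OF assms(1,2)] by unfold_locales
  have F: "F.ess_surj" "F.roof_full" "F.roof_faithful" using locF F.is_localization_iff by auto
  have G: "G.ess_surj" "G.roof_full" "G.roof_faithful" using locG G.is_localization_iff by auto
  have lift: "\<exists>t\<in>Arr K. \<exists>j. invertible_arr L j \<and> Cod L j = Dom L s
      \<and> Dom L j = Fo (Dom K t) \<and> Cod K t = x \<and> s \<cdot>\<^bsub>L\<^esub> j = Fm t"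
    if s: "s \<in> Arr L" "Cod L s = Fo x" and x: "x \<in> Obj K" for s x
  proof -
    obtain w i where w: "w \<in> Obj K" and i: "invertible_arr L i" "i \<in> Arr L" "Dom L i = Fo w" "Cod L i = Dom L s"
      using F.ess_surjE[OF F(1), of "Dom L s"] s by auto
    obtain r t where "r \<in> Arr K" "t \<in> Arr K" "Dom K r = Dom K t" "Cod K r = w" "Cod K t = x"
      "invertible_arr L (Fm r)" "(s \<cdot>\<^bsub>L\<^esub> i) \<cdot>\<^bsub>L\<^esub> Fm r = Fm t"
      by (rule F.roof_fullE[OF F(2), of "s \<cdot>\<^bsub>L\<^esub> i" w x]) (use s i w x in auto)
    then show ?thesis using i s
      by (intro bexI[where x = t] exI[where x = "i \<cdot>\<^bsub>L\<^esub> Fm r"]) auto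
  qed
  have "H.ess_surj"
    unfolding H.ess_surj_def
  proof
    fix d assume d: "d \<in> Obj M"
    obtain y where y: "y \<in> Obj L" "Iso M (Go y) d \<noteq> {}" using G(1) d unfolding G.ess_surj_def by blast
    obtain x where x: "x \<in> Obj K" "Iso L (Fo x) y \<noteq> {}" using F(1) y unfolding F.ess_surj_def by blast
    show "\<exists>x\<in>Obj K. Iso M ((\<lambda>x\<in>Obj K. Go (Fo x)) x) d \<noteq> {}"
      using G.L.Iso_trans[OF G.Iso[OF x(2)] y(2)] x(1) by (intro bexI[where x = x]) auto
  qed
  moreover have "H.roof_full"
    unfolding H.roof_full_def
  proof (intro ballI impI)
    fix x y h assume x: "x \<in> Obj K" "y \<in> Obj K" and h: "h \<in> Arr M"
      and "Dom M h = (\<lambda>x\<in>Obj K. Go (Fo x)) x \<and> Cod M h = (\<lambda>x\<in>Obj K. Go (Fo x)) y"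
    then have h': "Dom M h = Go (Fo x)" "Cod M h = Go (Fo y)" by auto
    obtain s f where sf: "s \<in> Arr L" "f \<in> Arr L" "Dom L s = Dom L f" "Cod L s = Fo x" "Cod L f = Fo y"
      "invertible_arr M (Gm s)" and hs: "h \<cdot>\<^bsub>M\<^esub> Gm s = Gm f"
      by (rule G.roof_fullE[OF G(2) h h']) (use x in auto)
    obtain t j where t: "t \<in> Arr K" "invertible_arr L j" "Cod L j = Dom L s" "Dom L j = Fo (Dom K t)"
      "Cod K t = x" and st: "s \<cdot>\<^bsub>L\<^esub> j = Fm t"
      using lift[OF sf(1,4) x(1)] by auto
    note j = F.L.invertible_arr_arr[OF t(2)]
    obtain r g where r: "r \<in> Arr K" "g \<in> Arr K" "Dom K r = Dom K g" "Cod K r = Dom K t" "Cod K g = y"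
      "invertible_arr L (Fm r)" and fr: "(f \<cdot>\<^bsub>L\<^esub> j) \<cdot>\<^bsub>L\<^esub> Fm r = Fm g"
      by (rule F.roof_fullE[OF F(2), of "f \<cdot>\<^bsub>L\<^esub> j" "Dom K t" y]) (use sf t j x in auto)
    have tr: "Fm (t \<cdot>\<^bsub>K\<^esub> r) = s \<cdot>\<^bsub>L\<^esub> j \<cdot>\<^bsub>L\<^esub> Fm r"
      using st[symmetric] sf t j r by simp
    have "h \<cdot>\<^bsub>M\<^esub> Gm (Fm (t \<cdot>\<^bsub>K\<^esub> r)) = (h \<cdot>\<^bsub>M\<^esub> Gm s) \<cdot>\<^bsub>M\<^esub> Gm (j \<cdot>\<^bsub>L\<^esub> Fm r)"
      unfolding tr using sf t j r h h' by simp
    also have "\<dots> = Gm (Fm g)" unfolding hs fr[symmetric] using sf t j r by simp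
    finally have "h \<cdot>\<^bsub>M\<^esub> Gm (Fm (t \<cdot>\<^bsub>K\<^esub> r)) = Gm (Fm g)" .
    moreover have "invertible_arr M (Gm (Fm (t \<cdot>\<^bsub>K\<^esub> r)))" unfolding tr using sf t j r by simp
    ultimately show "\<exists>s\<in>Arr K. \<exists>f\<in>Arr K. Dom K s = Dom K f \<and> Cod K s = x \<and> Cod K f = y
        \<and> invertible_arr M ((\<lambda>f\<in>Arr K. Gm (Fm f)) s)
        \<and> h \<cdot>\<^bsub>M\<^esub> (\<lambda>f\<in>Arr K. Gm (Fm f)) s = (\<lambda>f\<in>Arr K. Gm (Fm f)) f"
      using t r by (intro bexI[where x = "t \<cdot>\<^bsub>K\<^esub> r"] bexI[where x = g]) (auto simp del: F.comp)
  qed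
  moreover have "H.roof_faithful"
    unfolding H.roof_faithful_def
  proof (intro ballI impI)
    fix f g assume f: "f \<in> Arr K" and g: "g \<in> Arr K"
      and "Dom K g = Dom K f \<and> Cod K g = Cod K f \<and> (\<lambda>f\<in>Arr K. Gm (Fm f)) f = (\<lambda>f\<in>Arr K. Gm (Fm f)) g"
    then have eq: "Dom K g = Dom K f" "Cod K g = Cod K f" "Gm (Fm f) = Gm (Fm g)" by auto
    obtain s where s: "s \<in> Arr L" "Cod L s = Fo (Dom K f)" "invertible_arr M (Gm s)"
      and fs: "Fm f \<cdot>\<^bsub>L\<^esub> s = Fm g \<cdot>\<^bsub>L\<^esub> s"
      by (rule G.roof_faithfulE[OF G(3), of "Fm f" "Fm g"]) (use f g eq in auto)
    obtain t j where t: "t \<in> Arr K" "invertible_arr L j" "Cod L j = Dom L s" "Dom L j = Fo (Dom K t)"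
      "Cod K t = Dom K f" and st: "s \<cdot>\<^bsub>L\<^esub> j = Fm t"
      using lift[OF s(1,2)] f by auto
    note j = F.L.invertible_arr_arr[OF t(2)]
    have "Fm (f \<cdot>\<^bsub>K\<^esub> t) = (Fm f \<cdot>\<^bsub>L\<^esub> s) \<cdot>\<^bsub>L\<^esub> j" using f t s j st[symmetric] by simp
    also have "\<dots> = Fm (g \<cdot>\<^bsub>K\<^esub> t)" unfolding fs using g t s j st[symmetric] eq by simp
    finally have "Fm (f \<cdot>\<^bsub>K\<^esub> t) = Fm (g \<cdot>\<^bsub>K\<^esub> t)" .
    then obtain r where r: "r \<in> Arr K" "Cod K r = Dom K t" "invertible_arr L (Fm r)"
      and rq: "(f \<cdot>\<^bsub>K\<^esub> t) \<cdot>\<^bsub>K\<^esub> r = (g \<cdot>\<^bsub>K\<^esub> t) \<cdot>\<^bsub>K\<^esub> r"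
      by (rule F.roof_faithfulE[OF F(3), of "f \<cdot>\<^bsub>K\<^esub> t" "g \<cdot>\<^bsub>K\<^esub> t", rotated 4]) (use f g t eq in auto)
    have "invertible_arr M (Gm (Fm t))" unfolding st[symmetric] using s t j by simp
    then show "\<exists>s\<in>Arr K. Cod K s = Dom K f \<and> invertible_arr M ((\<lambda>f\<in>Arr K. Gm (Fm f)) s)
        \<and> f \<cdot>\<^bsub>K\<^esub> s = g \<cdot>\<^bsub>K\<^esub> s"
      using t r rq f g eq by (intro bexI[where x = "t \<cdot>\<^bsub>K\<^esub> r"]) auto
  qed
  ultimately show ?thesis using H.is_localization_iff by simp
qed

lemma (in triangulated_category) is_localization_ident:
  "is_localization K K (\<lambda>x\<in>Obj K. x) (\<lambda>f\<in>Arr K. f)"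
proof -
  interpret I: exact_functor K K "\<lambda>x\<in>Obj K. x" "\<lambda>f\<in>Arr K. f" "\<lambda>x\<in>Obj K. \<I> (Sh K x)"
    by unfold_locales (rule is_exact_ident)
  have "I.ess_surj" unfolding I.ess_surj_def
  proof
    fix d assume d: "d \<in> Obj K"
    then have "\<I> d \<in> Iso K d d" by (simp add: Iso_iff)
    then show "\<exists>x\<in>Obj K. Iso K ((\<lambda>x\<in>Obj K. x) x) d \<noteq> {}" using d by (intro bexI[where x = d]) auto
  qed
  moreover have "I.roof_full" unfolding I.roof_full_def
  proof (intro ballI impI)
    fix x y h assume "x \<in> Obj K" "y \<in> Obj K" "h \<in> Arr K"
      "Dom K h = (\<lambda>x\<in>Obj K. x) x \<and> Cod K h = (\<lambda>x\<in>Obj K. x) y"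
    then show "\<exists>s\<in>Arr K. \<exists>f\<in>Arr K. Dom K s = Dom K f \<and> Cod K s = x \<and> Cod K f = y
        \<and> invertible_arr K ((\<lambda>f\<in>Arr K. f) s) \<and> h \<cdot> (\<lambda>f\<in>Arr K. f) s = (\<lambda>f\<in>Arr K. f) f"
      by (intro bexI[where x = "\<I> x"] bexI[where x = h]) auto
  qed
  moreover have "I.roof_faithful" unfolding I.roof_faithful_def
  proof (intro ballI impI)
    fix f g assume f: "f \<in> Arr K" "g \<in> Arr K" and eq: "Dom K g = Dom K f \<and> Cod K g = Cod K f
      \<and> (\<lambda>f\<in>Arr K. f) f = (\<lambda>f\<in>Arr K. f) g"
    have "g = f" using eq f by simp
    with f(1) show "\<exists>s\<in>Arr K. Cod K s = Dom K f \<and> invertible_arr K ((\<lambda>f\<in>Arr K. f) s) \<and> f \<cdot> s = g \<cdot> s"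
      by (intro bexI[where x = "\<I> (Dom K f)"]) auto
  qed
  ultimately show ?thesis using I.is_localization_iff by simp
qed


section \<open>Thick tensor ideals\<close>

context tt_category
begin

declare unit_in [simp] tensor_in [simp] tensor_ident [simp]

lemma tensor_arr [simp]:
  assumes "f \<in> Arr K" "g \<in> Arr K"
  shows "f \<otimes>\<^sub>m g \<in> Arr K" "Dom K (f \<otimes>\<^sub>m g) = Dom K f \<otimes>\<^sub>o Dom K g" "Cod K (f \<otimes>\<^sub>m g) = Cod K f \<otimes>\<^sub>o Cod K g"
  using tensor_hom[of f "Dom K f" "Cod K f" g "Dom K g" "Cod K g"] assms by (auto simp: Hom_def)

lemma interchange:
  assumes "f \<in> Arr K" "f' \<in> Arr K" "Cod K f = Dom K f'" "g \<in> Arr K" "g' \<in> Arr K" "Cod K g = Dom K g'"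
  shows "(f' \<cdot> f) \<otimes>\<^sub>m (g' \<cdot> g) = (f' \<otimes>\<^sub>m g') \<cdot> (f \<otimes>\<^sub>m g)"
  using tensor_comp[of f "Dom K f" "Dom K f'" f' "Cod K f'" g "Dom K g" "Dom K g'" g' "Cod K g'"] assms
  by (auto simp: Hom_def)

lemma assoc_arr [simp]:
  assumes "x \<in> Obj K" "y \<in> Obj K" "z \<in> Obj K"
  shows "Asc K x y z \<in> Arr K" "Dom K (Asc K x y z) = (x \<otimes>\<^sub>o y) \<otimes>\<^sub>o z"
    "Cod K (Asc K x y z) = x \<otimes>\<^sub>o (y \<otimes>\<^sub>o z)" "invertible_arr K (Asc K x y z)"
  using assoc_iso[OF assms] by (auto simp: Iso_iff)

lemma unitor_arr [simp]:
  assumes "x \<in> Obj K"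
  shows "Lun K x \<in> Arr K" "Dom K (Lun K x) = Unt K \<otimes>\<^sub>o x" "Cod K (Lun K x) = x" "invertible_arr K (Lun K x)"
    "Run K x \<in> Arr K" "Dom K (Run K x) = x \<otimes>\<^sub>o Unt K" "Cod K (Run K x) = x" "invertible_arr K (Run K x)"
  using lunit_iso[OF assms] runit_iso[OF assms] by (auto simp: Iso_iff)

lemma tensor_functors:
  assumes "a \<in> Obj K"
  shows "\<exists>\<zeta>. exact_functor K K (\<lambda>x. a \<otimes>\<^sub>o x) (\<lambda>f. \<I> a \<otimes>\<^sub>m f) \<zeta>"
    "\<exists>\<zeta>. exact_functor K K (\<lambda>x. x \<otimes>\<^sub>o a) (\<lambda>f. f \<otimes>\<^sub>m \<I> a) \<zeta>"
  using tensor_exact_right[OF assms] tensor_exact_left[OF assms] triangulated_category_axioms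
    exact_functorI by blast+

lemma invertible_tensor [simp]:
  assumes "invertible_arr K f" "invertible_arr K g"
  shows "invertible_arr K (f \<otimes>\<^sub>m g)"
proof -
  note a = invertible_arr_arr[OF assms(1)] invertible_arr_arr[OF assms(2)]
  show ?thesis
    by (rule invertible_arrI[where g = "inverse_arr K f \<otimes>\<^sub>m inverse_arr K g"])
      (use assms a in \<open>simp_all add: interchange[symmetric]\<close>)
qed

lemma tensor_Iso:
  assumes "x \<in> Obj K" "y \<in> Obj K" "z \<in> Obj K"
  shows tensor_commute_Iso: "Iso K (x \<otimes>\<^sub>o y) (y \<otimes>\<^sub>o x) \<noteq> {}"
    and tensor_assoc_Iso: "Iso K ((x \<otimes>\<^sub>o y) \<otimes>\<^sub>o z) (x \<otimes>\<^sub>o (y \<otimes>\<^sub>o z)) \<noteq> {}"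
    and tensor_lunit_Iso: "Iso K (Unt K \<otimes>\<^sub>o x) x \<noteq> {}"
    and tensor_runit_Iso: "Iso K (x \<otimes>\<^sub>o Unt K) x \<noteq> {}"
  using braid_iso assoc_iso lunit_iso runit_iso assms by blast+

lemma tensor_Iso_left:
  assumes "Iso K x y \<noteq> {}" "z \<in> Obj K"
  shows "Iso K (x \<otimes>\<^sub>o z) (y \<otimes>\<^sub>o z) \<noteq> {}"
proof -
  obtain \<zeta> where "exact_functor K K (\<lambda>x. x \<otimes>\<^sub>o z) (\<lambda>f. f \<otimes>\<^sub>m \<I> z) \<zeta>"
    using tensor_functors(2)[OF assms(2)] by blast
  then interpret T: exact_functor K K "\<lambda>x. x \<otimes>\<^sub>o z" "\<lambda>f. f \<otimes>\<^sub>m \<I> z" \<zeta> .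
  show ?thesis by (rule T.Iso[OF assms(1)])
qed

lemma thick_tensor_vimage:
  assumes "thick K M" "a \<in> Obj K"
  shows "thick K {x \<in> Obj K. a \<otimes>\<^sub>o x \<in> M}" "thick K {x \<in> Obj K. x \<otimes>\<^sub>o a \<in> M}"
  using tensor_functors[OF assms(2)] exact_functor.thick_vimage[OF _ assms(1)] by auto

lemma thick_ideal_thick: "thick_ideal K J \<Longrightarrow> thick K J"
  and thick_ideal_tensor: "\<lbrakk>thick_ideal K J; x \<in> Obj K; y \<in> J\<rbrakk> \<Longrightarrow> x \<otimes>\<^sub>o y \<in> J"
  and thick_ideal_subset: "thick_ideal K J \<Longrightarrow> J \<subseteq> Obj K"
  by (simp_all add: thick_ideal_def thick_subset)

lemma thick_ideal_commute:
  assumes "thick_ideal K J" "x \<in> Obj K" "y \<in> Obj K"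
  shows "x \<otimes>\<^sub>o y \<in> J \<longleftrightarrow> y \<otimes>\<^sub>o x \<in> J"
  by (rule thick_Iso_iff[OF thick_ideal_thick[OF assms(1)] tensor_commute_Iso[OF assms(2,3,3)]])

lemma thick_ideal_unit:
  assumes J: "thick_ideal K J" and "Unt K \<in> J"
  shows "J = Obj K"
proof
  show "J \<subseteq> Obj K" by (rule thick_ideal_subset[OF J])
  show "Obj K \<subseteq> J"
  proof
    fix x assume x: "x \<in> Obj K"
    then have "x \<otimes>\<^sub>o Unt K \<in> J" using thick_ideal_tensor[OF J] assms(2) by simp
    then show "x \<in> J" using thick_Iso[OF thick_ideal_thick[OF J] _ tensor_runit_Iso[OF x x x]] by simp
  qed
qed

lemma thick_ideal_Obj: "thick_ideal K (Obj K)"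
  by (simp add: thick_ideal_def thick_Obj)

lemma thick_ideal_Inter: "\<lbrakk>A \<noteq> {}; \<And>J. J \<in> A \<Longrightarrow> thick_ideal K J\<rbrakk> \<Longrightarrow> thick_ideal K (\<Inter>A)"
  using thick_Inter[of A] by (auto simp: thick_ideal_def)

lemma thick_ideal_colon:
  assumes J: "thick_ideal K J" and b: "b \<in> Obj K"
  shows "thick_ideal K {x \<in> Obj K. x \<otimes>\<^sub>o b \<in> J}"
  unfolding thick_ideal_def
proof (intro conjI ballI)
  show "thick K {x \<in> Obj K. x \<otimes>\<^sub>o b \<in> J}" by (rule thick_tensor_vimage(2)[OF thick_ideal_thick[OF J] b])
  fix x y assume x: "x \<in> Obj K" and y: "y \<in> {x \<in> Obj K. x \<otimes>\<^sub>o b \<in> J}"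
  then have "x \<otimes>\<^sub>o (y \<otimes>\<^sub>o b) \<in> J" using thick_ideal_tensor[OF J x] by auto
  then have "(x \<otimes>\<^sub>o y) \<otimes>\<^sub>o b \<in> J"
    using thick_Iso_iff[OF thick_ideal_thick[OF J] tensor_assoc_Iso[of x y b]] x y b by auto
  then show "x \<otimes>\<^sub>o y \<in> {x \<in> Obj K. x \<otimes>\<^sub>o b \<in> J}" using x y by auto
qed

lemma ideal_closure_ideal: "S \<subseteq> Obj K \<Longrightarrow> thick_ideal K (ideal_closure K S)"
  unfolding ideal_closure_def using thick_ideal_Obj by (intro thick_ideal_Inter) auto

lemma ideal_closure_upper: "S \<subseteq> ideal_closure K S"
  by (auto simp: ideal_closure_def)

lemma ideal_closure_least: "\<lbrakk>thick_ideal K J; S \<subseteq> J\<rbrakk> \<Longrightarrow> ideal_closure K S \<subseteq> J"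
  by (auto simp: ideal_closure_def)

lemma in_ideal_closure: "x \<in> ideal_closure K {x}"
  using ideal_closure_upper[of "{x}"] by auto

text \<open>
  For fixed \<open>b\<close> the objects \<open>u\<close> with \<open>u \<otimes> b \<in> J\<close> form a thick ideal, so membership in \<open>J\<close> can be
  tested on generators, one tensor factor at a time.
\<close>

lemma tensor_closure_in_ideal:
  assumes J: "thick_ideal K J" and A: "A \<subseteq> Obj K" and B: "B \<subseteq> Obj K"
    and AB: "\<And>a b. \<lbrakk>a \<in> A; b \<in> B\<rbrakk> \<Longrightarrow> a \<otimes>\<^sub>o b \<in> J"
    and s: "s \<in> ideal_closure K A" and t: "t \<in> ideal_closure K B"
  shows "s \<otimes>\<^sub>o t \<in> J"
proof -
  have sO: "s \<in> Obj K" using s thick_ideal_subset[OF ideal_closure_ideal[OF A]] by auto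
  have tO: "t \<in> Obj K" using t thick_ideal_subset[OF ideal_closure_ideal[OF B]] by auto
  have sb: "s \<otimes>\<^sub>o b \<in> J" if b: "b \<in> B" for b
  proof -
    have "ideal_closure K A \<subseteq> {u \<in> Obj K. u \<otimes>\<^sub>o b \<in> J}"
      using AB A B b by (intro ideal_closure_least thick_ideal_colon[OF J]) auto
    then show ?thesis using s by auto
  qed
  have "ideal_closure K B \<subseteq> {u \<in> Obj K. u \<otimes>\<^sub>o s \<in> J}"
  proof (intro ideal_closure_least thick_ideal_colon[OF J sO] subsetI CollectI conjI)
    fix b assume b: "b \<in> B"
    then show "b \<in> Obj K" using B by auto
    then show "b \<otimes>\<^sub>o s \<in> J" using sb[OF b] thick_ideal_commute[OF J sO] by simp
  qed
  then show ?thesis using t thick_ideal_commute[OF J sO tO] by auto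
qed

lemma prime_ideal_ideal: "prime_ideal K P \<Longrightarrow> thick_ideal K P"
  by (simp add: prime_ideal_def)

lemma prime_ideal_subset: "prime_ideal K P \<Longrightarrow> P \<subseteq> Obj K"
  using prime_ideal_ideal thick_ideal_subset by blast

lemma prime_ideal_unit: "prime_ideal K P \<Longrightarrow> Unt K \<notin> P"
  using thick_ideal_unit by (auto simp: prime_ideal_def)

lemma prime_ideal_tensor_iff:
  assumes P: "prime_ideal K P" and x: "x \<in> Obj K" "y \<in> Obj K"
  shows "x \<otimes>\<^sub>o y \<in> P \<longleftrightarrow> x \<in> P \<or> y \<in> P"
proof
  show "x \<otimes>\<^sub>o y \<in> P \<Longrightarrow> x \<in> P \<or> y \<in> P" using assms by (simp add: prime_ideal_def)
  note J = prime_ideal_ideal[OF P]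
  show "x \<in> P \<or> y \<in> P \<Longrightarrow> x \<otimes>\<^sub>o y \<in> P"
    using thick_ideal_tensor[OF J] thick_ideal_commute[OF J x] x by auto
qed

text \<open>
  The tensor analogue of Krull's lemma: an ideal \<open>J\<close> maximal among those avoiding \<open>S\<close> is prime.  If
  \<open>a, b \<notin> J\<close> then adjoining either to \<open>J\<close> yields an ideal meeting \<open>S\<close>; the tensor product of the two
  elements found lies in \<open>S\<close>, and in \<open>J\<close> as soon as \<open>a \<otimes> b \<in> J\<close>.
\<close>

lemma prime_ideal_avoiding:
  assumes I: "thick_ideal K I" and S: "S \<subseteq> Obj K" "Unt K \<in> S"
    and mult: "\<And>s t. \<lbrakk>s \<in> S; t \<in> S\<rbrakk> \<Longrightarrow> s \<otimes>\<^sub>o t \<in> S"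
    and disj: "I \<inter> S = {}"
  shows "\<exists>P. prime_ideal K P \<and> I \<subseteq> P \<and> P \<inter> S = {}"
proof -
  define \<A> where "\<A> = {J. thick_ideal K J \<and> I \<subseteq> J \<and> J \<inter> S = {}}"
  have "\<exists>J\<in>\<A>. \<forall>J'\<in>\<A>. J \<subseteq> J' \<longrightarrow> J' = J"
  proof (rule subset_Zorn_nonempty)
    show "\<A> \<noteq> {}" using I disj by (auto simp: \<A>_def)
    fix \<C> assume ne: "\<C> \<noteq> {}" and C: "subset.chain \<A> \<C>"
    have mem: "thick_ideal K J" "I \<subseteq> J" "J \<inter> S = {}" if "J \<in> \<C>" for J
      using C that by (auto simp: subset_chain_def \<A>_def)
    note th = thick_ideal_thick[OF mem(1)]
    have pair: "\<exists>J\<in>\<C>. x \<in> J \<and> y \<in> J" if "x \<in> \<Union>\<C>" "y \<in> \<Union>\<C>" for x y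
    proof -
      from that obtain J1 J2 where 1: "J1 \<in> \<C>" "x \<in> J1" and 2: "J2 \<in> \<C>" "y \<in> J2" by auto
      then have "J1 \<subseteq> J2 \<or> J2 \<subseteq> J1" using C by (simp add: subset_chain_def)
      then show ?thesis using 1 2 by auto
    qed
    have "thick K (\<Union>\<C>)"
      unfolding thick_def
    proof (intro conjI allI impI ballI)
      show "\<Union>\<C> \<subseteq> Obj K" using th thick_subset by blast
      show "z \<in> \<Union>\<C>" if "zero_object K z" for z using ne thick_zero[OF th that] by blast
      show "y \<in> \<Union>\<C>" if "x \<in> \<Union>\<C> \<and> Iso K x y \<noteq> {}" for x y
        using that thick_Iso[OF th] by blast
      show "(x \<in> \<Union>\<C>) = (Sh K x \<in> \<Union>\<C>)" if "x \<in> Obj K" for x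
        using thick_shift[OF th that] by blast
      show "Cod K g \<in> \<Union>\<C>" if "(f, g, h) \<in> Tri K \<and> Dom K f \<in> \<Union>\<C> \<and> Cod K f \<in> \<Union>\<C>" for f g h
        using pair[of "Dom K f" "Cod K f"] thick_cone[OF th] that by blast
      show "x \<in> \<Union>\<C>" if "is_direct_sum K x y b \<and> b \<in> \<Union>\<C>" for x y b
        using that thick_direct_sum[OF th] by blast
    qed
    then have "thick_ideal K (\<Union>\<C>)"
      unfolding thick_ideal_def using thick_ideal_tensor[OF mem(1)] by blast
    then show "\<Union>\<C> \<in> \<A>" using ne mem(2,3) unfolding \<A>_def by blast
  qed
  then obtain J where J_in: "J \<in> \<A>" and J_max: "\<forall>J'\<in>\<A>. J \<subseteq> J' \<longrightarrow> J' = J" by (rule bexE)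
  from J_in have J: "thick_ideal K J" "I \<subseteq> J" "J \<inter> S = {}" by (simp_all add: \<A>_def)
  have max: "J' = J" if "thick_ideal K J'" "J \<subseteq> J'" "J' \<inter> S = {}" for J'
    using J_max J(2) that unfolding \<A>_def by auto
  have meets: "\<exists>s\<in>S. s \<in> ideal_closure K (insert a J)" if a: "a \<in> Obj K" "a \<notin> J" for a
  proof (rule ccontr)
    assume *: "\<not> ?thesis"
    have sub: "insert a J \<subseteq> Obj K" using a thick_ideal_subset[OF J(1)] by auto
    have "ideal_closure K (insert a J) = J"
      by (rule max) (use ideal_closure_ideal[OF sub] ideal_closure_upper[of "insert a J"] * in auto)
    then show False using ideal_closure_upper[of "insert a J"] a by auto
  qed
  have "prime_ideal K J"
    unfolding prime_ideal_def
  proof (intro conjI ballI impI)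
    show "thick_ideal K J" by (rule J(1))
    show "J \<noteq> Obj K" using J(3) S by auto
    fix a b assume a: "a \<in> Obj K" and b: "b \<in> Obj K" and ab: "a \<otimes>\<^sub>o b \<in> J"
    show "a \<in> J \<or> b \<in> J"
    proof (rule ccontr)
      assume *: "\<not> (a \<in> J \<or> b \<in> J)"
      obtain s where s: "s \<in> S" "s \<in> ideal_closure K (insert a J)" using meets[OF a] * by auto
      obtain t where t: "t \<in> S" "t \<in> ideal_closure K (insert b J)" using meets[OF b] * by auto
      have JO: "J \<subseteq> Obj K" by (rule thick_ideal_subset[OF J(1)])
      have "s \<otimes>\<^sub>o t \<in> J"
      proof (rule tensor_closure_in_ideal[OF J(1) _ _ _ s(2) t(2)])
        fix u v assume uv: "u \<in> insert a J" "v \<in> insert b J"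
        then have O: "u \<in> Obj K" "v \<in> Obj K" using a b JO by auto
        then show "u \<otimes>\<^sub>o v \<in> J"
          using uv ab thick_ideal_tensor[OF J(1)] thick_ideal_commute[OF J(1) O] by auto
      qed (use a b JO in auto)
      then show False using mult[OF s(1) t(1)] J(3) by auto
    qed
  qed
  then show ?thesis using J by blast
qed

end

context rigid_tt_category
begin

text \<open>
  By the zigzag identity \<open>z\<close> is a retract of \<open>(z \<otimes> d) \<otimes> z\<close>, which lies in every ideal containing
  \<open>z \<otimes> z\<close>: in the rigid case all thick ideals are radical.
\<close>

lemma thick_ideal_radical:
  assumes J: "thick_ideal K J" and z: "z \<in> Obj K" and zz: "z \<otimes>\<^sub>o z \<in> J"
  shows "z \<in> J"
proof -
  obtain d ev co where dual: "is_dual K z d ev co" using dualizable[OF z] by blast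
  then have d: "d \<in> Obj K"
    and ev: "ev \<in> Arr K" "Dom K ev = d \<otimes>\<^sub>o z" "Cod K ev = Unt K"
    and co: "co \<in> Arr K" "Dom K co = Unt K" "Cod K co = z \<otimes>\<^sub>o d"
    and zigzag: "Run K z \<cdot> (\<I> z \<otimes>\<^sub>m ev) \<cdot> Asc K z d z \<cdot> (co \<otimes>\<^sub>m \<I> z) = Lun K z"
    by (auto simp: is_dual_def Hom_def)
  define i where "i = (co \<otimes>\<^sub>m \<I> z) \<cdot> inverse_arr K (Lun K z)"
  define p where "p = Run K z \<cdot> (\<I> z \<otimes>\<^sub>m ev) \<cdot> Asc K z d z"
  have i: "i \<in> Arr K" "Dom K i = z" "Cod K i = (z \<otimes>\<^sub>o d) \<otimes>\<^sub>o z"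
    using z d co by (simp_all add: i_def)
  have p: "p \<in> Arr K" "Dom K p = (z \<otimes>\<^sub>o d) \<otimes>\<^sub>o z" "Cod K p = z"
    using z d ev by (simp_all add: p_def)
  have "p \<cdot> i = (Run K z \<cdot> (\<I> z \<otimes>\<^sub>m ev) \<cdot> Asc K z d z \<cdot> (co \<otimes>\<^sub>m \<I> z)) \<cdot> inverse_arr K (Lun K z)"
    using z d ev co by (simp add: i_def p_def)
  also have "\<dots> = \<I> z" unfolding zigzag using z by simp
  finally have pi: "p \<cdot> i = \<I> (Dom K i)" using i by simp
  have "d \<otimes>\<^sub>o (z \<otimes>\<^sub>o z) \<in> J" by (rule thick_ideal_tensor[OF J d zz])
  then have "(d \<otimes>\<^sub>o z) \<otimes>\<^sub>o z \<in> J"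
    using thick_Iso_iff[OF thick_ideal_thick[OF J] tensor_assoc_Iso[OF d z z]] by simp
  then have "(z \<otimes>\<^sub>o d) \<otimes>\<^sub>o z \<in> J"
    using thick_Iso_iff[OF thick_ideal_thick[OF J] tensor_Iso_left[OF tensor_commute_Iso[OF d z z] z]] by simp
  then show ?thesis
    using thick_retract[OF thick_ideal_thick[OF J] i(1) p(1) _ _ pi] i p by simp
qed

lemma ideal_closure_Int:
  assumes x: "x \<in> Obj K" and y: "y \<in> Obj K"
  shows "ideal_closure K {x} \<inter> ideal_closure K {y} = ideal_closure K {x \<otimes>\<^sub>o y}"
proof
  have J: "thick_ideal K (ideal_closure K {x \<otimes>\<^sub>o y})" using x y by (intro ideal_closure_ideal) auto
  show "ideal_closure K {x} \<inter> ideal_closure K {y} \<subseteq> ideal_closure K {x \<otimes>\<^sub>o y}"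
  proof
    fix z assume z: "z \<in> ideal_closure K {x} \<inter> ideal_closure K {y}"
    have "z \<otimes>\<^sub>o z \<in> ideal_closure K {x \<otimes>\<^sub>o y}"
      by (rule tensor_closure_in_ideal[OF J, of "{x}" "{y}"]) (use x y z in_ideal_closure in auto)
    moreover have "z \<in> Obj K" using z thick_ideal_subset[OF ideal_closure_ideal[of "{x}"]] x by auto
    ultimately show "z \<in> ideal_closure K {x \<otimes>\<^sub>o y}" by (rule thick_ideal_radical[OF J, rotated])
  qed
  have Ix: "thick_ideal K (ideal_closure K {x})" and Iy: "thick_ideal K (ideal_closure K {y})"
    using x y by (auto intro: ideal_closure_ideal)
  have "x \<otimes>\<^sub>o y \<in> ideal_closure K {x}"
    using thick_ideal_tensor[OF Ix y in_ideal_closure] thick_ideal_commute[OF Ix x y] by simp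
  moreover have "x \<otimes>\<^sub>o y \<in> ideal_closure K {y}" by (rule thick_ideal_tensor[OF Iy x in_ideal_closure])
  ultimately show "ideal_closure K {x \<otimes>\<^sub>o y} \<subseteq> ideal_closure K {x} \<inter> ideal_closure K {y}"
    using ideal_closure_least[OF Ix] ideal_closure_least[OF Iy] by auto
qed

end


section \<open>Monoidal functors\<close>

locale monoidal_functor = K: tt_category K + L: tt_category L
  for K :: "('o, 'm, 'r) ttcat_scheme" and L :: "('p, 'n, 's) ttcat_scheme" +
  fixes Fo :: "'o \<Rightarrow> 'p" and Fm :: "'m \<Rightarrow> 'n" and \<mu> :: "'o \<times> 'o \<Rightarrow> 'n" and \<epsilon> :: 'n
  assumes is_monoidal: "is_monoidal K L Fo Fm \<mu> \<epsilon>"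
begin

sublocale cat_functor K L Fo Fm
  using is_monoidal by unfold_locales (simp add: is_monoidal_def)

lemma unit_comparison [simp]:
  "\<epsilon> \<in> Arr L" "Dom L \<epsilon> = Unt L" "Cod L \<epsilon> = Fo (Unt K)" "invertible_arr L \<epsilon>"
  using is_monoidal by (auto simp: is_monoidal_def L.Iso_iff)

lemma tensor_comparison [simp]:
  assumes "x \<in> Obj K" "y \<in> Obj K"
  shows "\<mu> (x, y) \<in> Arr L" "Dom L (\<mu> (x, y)) = Fo x \<otimes>\<^sub>o\<^bsub>L\<^esub> Fo y" "Cod L (\<mu> (x, y)) = Fo (x \<otimes>\<^sub>o\<^bsub>K\<^esub> y)"
    "invertible_arr L (\<mu> (x, y))"
proof -
  have "\<mu> (x, y) \<in> Iso L (Fo x \<otimes>\<^sub>o\<^bsub>L\<^esub> Fo y) (Fo (x \<otimes>\<^sub>o\<^bsub>K\<^esub> y))"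
    using is_monoidal assms unfolding is_monoidal_def by blast
  then show "\<mu> (x, y) \<in> Arr L" "Dom L (\<mu> (x, y)) = Fo x \<otimes>\<^sub>o\<^bsub>L\<^esub> Fo y"
    "Cod L (\<mu> (x, y)) = Fo (x \<otimes>\<^sub>o\<^bsub>K\<^esub> y)" "invertible_arr L (\<mu> (x, y))"
    by (auto simp: L.Iso_iff)
qed

lemma tensor_natural:
  assumes "f \<in> Arr K" "g \<in> Arr K"
  shows "\<mu> (Cod K f, Cod K g) \<cdot>\<^bsub>L\<^esub> (Fm f \<otimes>\<^sub>m\<^bsub>L\<^esub> Fm g) = Fm (f \<otimes>\<^sub>m\<^bsub>K\<^esub> g) \<cdot>\<^bsub>L\<^esub> \<mu> (Dom K f, Dom K g)"
proof -
  have "f \<in> Hom K (Dom K f) (Cod K f)" "g \<in> Hom K (Dom K g) (Cod K g)"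
    using assms by (auto simp: Hom_def)
  then show ?thesis
    using is_monoidal K.dom_in[OF assms(1)] K.cod_in[OF assms(1)] K.dom_in[OF assms(2)] K.cod_in[OF assms(2)]
    unfolding is_monoidal_def by blast
qed

lemma assoc_coherence:
  "\<lbrakk>x \<in> Obj K; y \<in> Obj K; z \<in> Obj K\<rbrakk> \<Longrightarrow>
    Fm (Asc K x y z) \<cdot>\<^bsub>L\<^esub> \<mu> (x \<otimes>\<^sub>o\<^bsub>K\<^esub> y, z) \<cdot>\<^bsub>L\<^esub> (\<mu> (x, y) \<otimes>\<^sub>m\<^bsub>L\<^esub> \<I>\<^bsub>L\<^esub> (Fo z))
      = \<mu> (x, y \<otimes>\<^sub>o\<^bsub>K\<^esub> z) \<cdot>\<^bsub>L\<^esub> (\<I>\<^bsub>L\<^esub> (Fo x) \<otimes>\<^sub>m\<^bsub>L\<^esub> \<mu> (y, z)) \<cdot>\<^bsub>L\<^esub> Asc L (Fo x) (Fo y) (Fo z)"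
  and lunit_coherence:
  "x \<in> Obj K \<Longrightarrow> Fm (Lun K x) \<cdot>\<^bsub>L\<^esub> \<mu> (Unt K, x) \<cdot>\<^bsub>L\<^esub> (\<epsilon> \<otimes>\<^sub>m\<^bsub>L\<^esub> \<I>\<^bsub>L\<^esub> (Fo x)) = Lun L (Fo x)"
  and runit_coherence:
  "x \<in> Obj K \<Longrightarrow> Fm (Run K x) \<cdot>\<^bsub>L\<^esub> \<mu> (x, Unt K) \<cdot>\<^bsub>L\<^esub> (\<I>\<^bsub>L\<^esub> (Fo x) \<otimes>\<^sub>m\<^bsub>L\<^esub> \<epsilon>) = Run L (Fo x)"
  using is_monoidal unfolding is_monoidal_def by blast+

lemma tensor_Iso: "\<lbrakk>x \<in> Obj K; y \<in> Obj K\<rbrakk> \<Longrightarrow> Iso L (Fo x \<otimes>\<^sub>o\<^bsub>L\<^esub> Fo y) (Fo (x \<otimes>\<^sub>o\<^bsub>K\<^esub> y)) \<noteq> {}"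
  using is_monoidal unfolding is_monoidal_def by blast

end

lemma is_monoidalI:
  assumes "is_functor K L Fo Fm" "\<epsilon> \<in> Iso L (Unt L) (Fo (Unt K))"
    and "\<And>x y. \<lbrakk>x \<in> Obj K; y \<in> Obj K\<rbrakk> \<Longrightarrow> \<mu> (x, y) \<in> Iso L (Fo x \<otimes>\<^sub>o\<^bsub>L\<^esub> Fo y) (Fo (x \<otimes>\<^sub>o\<^bsub>K\<^esub> y))"
    and "\<And>f g. \<lbrakk>f \<in> Arr K; g \<in> Arr K\<rbrakk> \<Longrightarrow>
         \<mu> (Cod K f, Cod K g) \<cdot>\<^bsub>L\<^esub> (Fm f \<otimes>\<^sub>m\<^bsub>L\<^esub> Fm g) = Fm (f \<otimes>\<^sub>m\<^bsub>K\<^esub> g) \<cdot>\<^bsub>L\<^esub> \<mu> (Dom K f, Dom K g)"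
    and "\<And>x y z. \<lbrakk>x \<in> Obj K; y \<in> Obj K; z \<in> Obj K\<rbrakk> \<Longrightarrow>
         Fm (Asc K x y z) \<cdot>\<^bsub>L\<^esub> \<mu> (x \<otimes>\<^sub>o\<^bsub>K\<^esub> y, z) \<cdot>\<^bsub>L\<^esub> (\<mu> (x, y) \<otimes>\<^sub>m\<^bsub>L\<^esub> \<I>\<^bsub>L\<^esub> (Fo z))
         = \<mu> (x, y \<otimes>\<^sub>o\<^bsub>K\<^esub> z) \<cdot>\<^bsub>L\<^esub> (\<I>\<^bsub>L\<^esub> (Fo x) \<otimes>\<^sub>m\<^bsub>L\<^esub> \<mu> (y, z)) \<cdot>\<^bsub>L\<^esub> Asc L (Fo x) (Fo y) (Fo z)"
    and "\<And>x. x \<in> Obj K \<Longrightarrow>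
         Fm (Lun K x) \<cdot>\<^bsub>L\<^esub> \<mu> (Unt K, x) \<cdot>\<^bsub>L\<^esub> (\<epsilon> \<otimes>\<^sub>m\<^bsub>L\<^esub> \<I>\<^bsub>L\<^esub> (Fo x)) = Lun L (Fo x)"
    and "\<And>x. x \<in> Obj K \<Longrightarrow>
         Fm (Run K x) \<cdot>\<^bsub>L\<^esub> \<mu> (x, Unt K) \<cdot>\<^bsub>L\<^esub> (\<I>\<^bsub>L\<^esub> (Fo x) \<otimes>\<^sub>m\<^bsub>L\<^esub> \<epsilon>) = Run L (Fo x)"
  shows "is_monoidal K L Fo Fm \<mu> \<epsilon>"
  using assms(1-3,5-7) assms(4) by (auto simp: is_monoidal_def Hom_def)

lemma (in tt_category) is_monoidal_ident:
  "is_monoidal K K (\<lambda>x\<in>Obj K. x) (\<lambda>f\<in>Arr K. f) (\<lambda>(x, y)\<in>Obj K \<times> Obj K. \<I> (x \<otimes>\<^sub>o y)) (\<I> (Unt K))"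
  by (intro is_monoidalI is_functorI category_axioms) (simp_all add: Iso_iff)

text \<open>
  Each coherence diagram of the composite is the image of the one of \<open>F\<close> pasted with the one of \<open>G\<close>
  along a naturality square of the comparison maps of \<open>G\<close>.
\<close>

lemma is_monoidal_comp:
  assumes "monoidal_functor K L Fo Fm \<mu> \<epsilon>" "monoidal_functor L M Go Gm \<nu> \<eta>"
  shows "is_monoidal K M (\<lambda>x\<in>Obj K. Go (Fo x)) (\<lambda>f\<in>Arr K. Gm (Fm f))
    (\<lambda>(x, y)\<in>Obj K \<times> Obj K. Gm (\<mu> (x, y)) \<cdot>\<^bsub>M\<^esub> \<nu> (Fo x, Fo y)) (Gm \<epsilon> \<cdot>\<^bsub>M\<^esub> \<eta>)"
proof -
  interpret F: monoidal_functor K L Fo Fm \<mu> \<epsilon> by fact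
  interpret G: monoidal_functor L M Go Gm \<nu> \<eta> by fact
  have nat_left: "\<nu> (Cod L a, w) \<cdot>\<^bsub>M\<^esub> (Gm a \<otimes>\<^sub>m\<^bsub>M\<^esub> \<I>\<^bsub>M\<^esub> (Go w)) = Gm (a \<otimes>\<^sub>m\<^bsub>L\<^esub> \<I>\<^bsub>L\<^esub> w) \<cdot>\<^bsub>M\<^esub> \<nu> (Dom L a, w)"
    if "a \<in> Arr L" "w \<in> Obj L" for a w
    using G.tensor_natural[of a "\<I>\<^bsub>L\<^esub> w"] that by simp
  have nat_right: "\<nu> (w, Cod L a) \<cdot>\<^bsub>M\<^esub> (\<I>\<^bsub>M\<^esub> (Go w) \<otimes>\<^sub>m\<^bsub>M\<^esub> Gm a) = Gm (\<I>\<^bsub>L\<^esub> w \<otimes>\<^sub>m\<^bsub>L\<^esub> a) \<cdot>\<^bsub>M\<^esub> \<nu> (w, Dom L a)"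
    if "a \<in> Arr L" "w \<in> Obj L" for a w
    using G.tensor_natural[of "\<I>\<^bsub>L\<^esub> w" a] that by simp
  have split_left: "(b \<cdot>\<^bsub>M\<^esub> a) \<otimes>\<^sub>m\<^bsub>M\<^esub> \<I>\<^bsub>M\<^esub> w = (b \<otimes>\<^sub>m\<^bsub>M\<^esub> \<I>\<^bsub>M\<^esub> w) \<cdot>\<^bsub>M\<^esub> (a \<otimes>\<^sub>m\<^bsub>M\<^esub> \<I>\<^bsub>M\<^esub> w)"
    if "a \<in> Arr M" "b \<in> Arr M" "Cod M a = Dom M b" "w \<in> Obj M" for a b w
    using G.L.interchange[of a b "\<I>\<^bsub>M\<^esub> w" "\<I>\<^bsub>M\<^esub> w"] that by simp
  have split_right: "\<I>\<^bsub>M\<^esub> w \<otimes>\<^sub>m\<^bsub>M\<^esub> (b \<cdot>\<^bsub>M\<^esub> a) = (\<I>\<^bsub>M\<^esub> w \<otimes>\<^sub>m\<^bsub>M\<^esub> b) \<cdot>\<^bsub>M\<^esub> (\<I>\<^bsub>M\<^esub> w \<otimes>\<^sub>m\<^bsub>M\<^esub> a)"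
    if "a \<in> Arr M" "b \<in> Arr M" "Cod M a = Dom M b" "w \<in> Obj M" for a b w
    using G.L.interchange[of "\<I>\<^bsub>M\<^esub> w" "\<I>\<^bsub>M\<^esub> w" a b] that by simp
  let ?\<kappa> = "\<lambda>x y. Gm (\<mu> (x, y)) \<cdot>\<^bsub>M\<^esub> \<nu> (Fo x, Fo y)"
  have natural: "?\<kappa> (Cod K f) (Cod K g) \<cdot>\<^bsub>M\<^esub> (Gm (Fm f) \<otimes>\<^sub>m\<^bsub>M\<^esub> Gm (Fm g))
      = Gm (Fm (f \<otimes>\<^sub>m\<^bsub>K\<^esub> g)) \<cdot>\<^bsub>M\<^esub> ?\<kappa> (Dom K f) (Dom K g)"
    if f: "f \<in> Arr K" and g: "g \<in> Arr K" for f g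
  proof -
    have "?\<kappa> (Cod K f) (Cod K g) \<cdot>\<^bsub>M\<^esub> (Gm (Fm f) \<otimes>\<^sub>m\<^bsub>M\<^esub> Gm (Fm g))
        = Gm (\<mu> (Cod K f, Cod K g)) \<cdot>\<^bsub>M\<^esub> \<nu> (Cod L (Fm f), Cod L (Fm g)) \<cdot>\<^bsub>M\<^esub> (Gm (Fm f) \<otimes>\<^sub>m\<^bsub>M\<^esub> Gm (Fm g))"
      using f g by simp
    also have "\<dots> = Gm (\<mu> (Cod K f, Cod K g) \<cdot>\<^bsub>L\<^esub> (Fm f \<otimes>\<^sub>m\<^bsub>L\<^esub> Fm g)) \<cdot>\<^bsub>M\<^esub> \<nu> (Fo (Dom K f), Fo (Dom K g))"
      using G.tensor_natural[of "Fm f" "Fm g"] f g by simp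
    also have "\<dots> = Gm (Fm (f \<otimes>\<^sub>m\<^bsub>K\<^esub> g)) \<cdot>\<^bsub>M\<^esub> ?\<kappa> (Dom K f) (Dom K g)"
      unfolding F.tensor_natural[OF f g] using f g by simp
    finally show ?thesis .
  qed
  have assoc: "Gm (Fm (Asc K x y z)) \<cdot>\<^bsub>M\<^esub> ?\<kappa> (x \<otimes>\<^sub>o\<^bsub>K\<^esub> y) z \<cdot>\<^bsub>M\<^esub> (?\<kappa> x y \<otimes>\<^sub>m\<^bsub>M\<^esub> \<I>\<^bsub>M\<^esub> (Go (Fo z)))
      = ?\<kappa> x (y \<otimes>\<^sub>o\<^bsub>K\<^esub> z) \<cdot>\<^bsub>M\<^esub> (\<I>\<^bsub>M\<^esub> (Go (Fo x)) \<otimes>\<^sub>m\<^bsub>M\<^esub> ?\<kappa> y z) \<cdot>\<^bsub>M\<^esub> Asc M (Go (Fo x)) (Go (Fo y)) (Go (Fo z))"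
    if x: "x \<in> Obj K" and y: "y \<in> Obj K" and z: "z \<in> Obj K" for x y z
  proof -
    let ?N1 = "\<nu> (Fo x, Fo y) \<otimes>\<^sub>m\<^bsub>M\<^esub> \<I>\<^bsub>M\<^esub> (Go (Fo z))"
    let ?N2 = "\<I>\<^bsub>M\<^esub> (Go (Fo x)) \<otimes>\<^sub>m\<^bsub>M\<^esub> \<nu> (Fo y, Fo z)"
    have "Gm (Fm (Asc K x y z)) \<cdot>\<^bsub>M\<^esub> ?\<kappa> (x \<otimes>\<^sub>o\<^bsub>K\<^esub> y) z \<cdot>\<^bsub>M\<^esub> (?\<kappa> x y \<otimes>\<^sub>m\<^bsub>M\<^esub> \<I>\<^bsub>M\<^esub> (Go (Fo z)))
        = Gm (Fm (Asc K x y z)) \<cdot>\<^bsub>M\<^esub> Gm (\<mu> (x \<otimes>\<^sub>o\<^bsub>K\<^esub> y, z)) \<cdot>\<^bsub>M\<^esub>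
          (\<nu> (Cod L (\<mu> (x, y)), Fo z) \<cdot>\<^bsub>M\<^esub> (Gm (\<mu> (x, y)) \<otimes>\<^sub>m\<^bsub>M\<^esub> \<I>\<^bsub>M\<^esub> (Go (Fo z)))) \<cdot>\<^bsub>M\<^esub> ?N1"
      using x y z by (simp add: split_left)
    also have "\<dots> = Gm (Fm (Asc K x y z) \<cdot>\<^bsub>L\<^esub> \<mu> (x \<otimes>\<^sub>o\<^bsub>K\<^esub> y, z) \<cdot>\<^bsub>L\<^esub> (\<mu> (x, y) \<otimes>\<^sub>m\<^bsub>L\<^esub> \<I>\<^bsub>L\<^esub> (Fo z)))
          \<cdot>\<^bsub>M\<^esub> \<nu> (Fo x \<otimes>\<^sub>o\<^bsub>L\<^esub> Fo y, Fo z) \<cdot>\<^bsub>M\<^esub> ?N1"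
      using nat_left[of "\<mu> (x, y)" "Fo z"] x y z by simp
    also have "\<dots> = Gm (\<mu> (x, y \<otimes>\<^sub>o\<^bsub>K\<^esub> z)) \<cdot>\<^bsub>M\<^esub> Gm (\<I>\<^bsub>L\<^esub> (Fo x) \<otimes>\<^sub>m\<^bsub>L\<^esub> \<mu> (y, z)) \<cdot>\<^bsub>M\<^esub>
          (Gm (Asc L (Fo x) (Fo y) (Fo z)) \<cdot>\<^bsub>M\<^esub> \<nu> (Fo x \<otimes>\<^sub>o\<^bsub>L\<^esub> Fo y, Fo z) \<cdot>\<^bsub>M\<^esub> ?N1)"
      unfolding F.assoc_coherence[OF x y z] using x y z by simp
    also have "\<dots> = Gm (\<mu> (x, y \<otimes>\<^sub>o\<^bsub>K\<^esub> z)) \<cdot>\<^bsub>M\<^esub> (Gm (\<I>\<^bsub>L\<^esub> (Fo x) \<otimes>\<^sub>m\<^bsub>L\<^esub> \<mu> (y, z)) \<cdot>\<^bsub>M\<^esub>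
          \<nu> (Fo x, Dom L (\<mu> (y, z)))) \<cdot>\<^bsub>M\<^esub> ?N2 \<cdot>\<^bsub>M\<^esub> Asc M (Go (Fo x)) (Go (Fo y)) (Go (Fo z))"
      using G.assoc_coherence[of "Fo x" "Fo y" "Fo z"] x y z by simp
    also have "\<dots> = Gm (\<mu> (x, y \<otimes>\<^sub>o\<^bsub>K\<^esub> z)) \<cdot>\<^bsub>M\<^esub> (\<nu> (Fo x, Cod L (\<mu> (y, z))) \<cdot>\<^bsub>M\<^esub>
          (\<I>\<^bsub>M\<^esub> (Go (Fo x)) \<otimes>\<^sub>m\<^bsub>M\<^esub> Gm (\<mu> (y, z)))) \<cdot>\<^bsub>M\<^esub> ?N2 \<cdot>\<^bsub>M\<^esub> Asc M (Go (Fo x)) (Go (Fo y)) (Go (Fo z))"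
      by (subst nat_right) (use x y z in auto)
    also have "\<dots> = ?\<kappa> x (y \<otimes>\<^sub>o\<^bsub>K\<^esub> z) \<cdot>\<^bsub>M\<^esub> (\<I>\<^bsub>M\<^esub> (Go (Fo x)) \<otimes>\<^sub>m\<^bsub>M\<^esub> ?\<kappa> y z)
        \<cdot>\<^bsub>M\<^esub> Asc M (Go (Fo x)) (Go (Fo y)) (Go (Fo z))"
      using x y z by (simp add: split_right)
    finally show ?thesis .
  qed
  have lunit: "Gm (Fm (Lun K x)) \<cdot>\<^bsub>M\<^esub> ?\<kappa> (Unt K) x \<cdot>\<^bsub>M\<^esub> ((Gm \<epsilon> \<cdot>\<^bsub>M\<^esub> \<eta>) \<otimes>\<^sub>m\<^bsub>M\<^esub> \<I>\<^bsub>M\<^esub> (Go (Fo x)))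
      = Lun M (Go (Fo x))" if x: "x \<in> Obj K" for x
  proof -
    let ?N = "\<eta> \<otimes>\<^sub>m\<^bsub>M\<^esub> \<I>\<^bsub>M\<^esub> (Go (Fo x))"
    have "Gm (Fm (Lun K x)) \<cdot>\<^bsub>M\<^esub> ?\<kappa> (Unt K) x \<cdot>\<^bsub>M\<^esub> ((Gm \<epsilon> \<cdot>\<^bsub>M\<^esub> \<eta>) \<otimes>\<^sub>m\<^bsub>M\<^esub> \<I>\<^bsub>M\<^esub> (Go (Fo x)))
        = Gm (Fm (Lun K x)) \<cdot>\<^bsub>M\<^esub> Gm (\<mu> (Unt K, x)) \<cdot>\<^bsub>M\<^esub>
          (\<nu> (Cod L \<epsilon>, Fo x) \<cdot>\<^bsub>M\<^esub> (Gm \<epsilon> \<otimes>\<^sub>m\<^bsub>M\<^esub> \<I>\<^bsub>M\<^esub> (Go (Fo x)))) \<cdot>\<^bsub>M\<^esub> ?N"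
      using x by (simp add: split_left)
    also have "\<dots> = Gm (Fm (Lun K x) \<cdot>\<^bsub>L\<^esub> \<mu> (Unt K, x) \<cdot>\<^bsub>L\<^esub> (\<epsilon> \<otimes>\<^sub>m\<^bsub>L\<^esub> \<I>\<^bsub>L\<^esub> (Fo x)))
        \<cdot>\<^bsub>M\<^esub> \<nu> (Unt L, Fo x) \<cdot>\<^bsub>M\<^esub> ?N"
      using nat_left[of \<epsilon> "Fo x"] x by simp
    also have "\<dots> = Lun M (Go (Fo x))"
      unfolding F.lunit_coherence[OF x] using G.lunit_coherence[of "Fo x"] x by simp
    finally show ?thesis .
  qed
  have runit: "Gm (Fm (Run K x)) \<cdot>\<^bsub>M\<^esub> ?\<kappa> x (Unt K) \<cdot>\<^bsub>M\<^esub> (\<I>\<^bsub>M\<^esub> (Go (Fo x)) \<otimes>\<^sub>m\<^bsub>M\<^esub> (Gm \<epsilon> \<cdot>\<^bsub>M\<^esub> \<eta>))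
      = Run M (Go (Fo x))" if x: "x \<in> Obj K" for x
  proof -
    let ?N = "\<I>\<^bsub>M\<^esub> (Go (Fo x)) \<otimes>\<^sub>m\<^bsub>M\<^esub> \<eta>"
    have "Gm (Fm (Run K x)) \<cdot>\<^bsub>M\<^esub> ?\<kappa> x (Unt K) \<cdot>\<^bsub>M\<^esub> (\<I>\<^bsub>M\<^esub> (Go (Fo x)) \<otimes>\<^sub>m\<^bsub>M\<^esub> (Gm \<epsilon> \<cdot>\<^bsub>M\<^esub> \<eta>))
        = Gm (Fm (Run K x)) \<cdot>\<^bsub>M\<^esub> Gm (\<mu> (x, Unt K)) \<cdot>\<^bsub>M\<^esub>
          (\<nu> (Fo x, Cod L \<epsilon>) \<cdot>\<^bsub>M\<^esub> (\<I>\<^bsub>M\<^esub> (Go (Fo x)) \<otimes>\<^sub>m\<^bsub>M\<^esub> Gm \<epsilon>)) \<cdot>\<^bsub>M\<^esub> ?N"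
      using x by (simp add: split_right)
    also have "\<dots> = Gm (Fm (Run K x) \<cdot>\<^bsub>L\<^esub> \<mu> (x, Unt K) \<cdot>\<^bsub>L\<^esub> (\<I>\<^bsub>L\<^esub> (Fo x) \<otimes>\<^sub>m\<^bsub>L\<^esub> \<epsilon>))
        \<cdot>\<^bsub>M\<^esub> \<nu> (Fo x, Unt L) \<cdot>\<^bsub>M\<^esub> ?N"
      using nat_right[of \<epsilon> "Fo x"] x by simp
    also have "\<dots> = Run M (Go (Fo x))"
      unfolding F.runit_coherence[OF x] using G.runit_coherence[of "Fo x"] x by simp
    finally show ?thesis .
  qed
  show ?thesis
  proof (intro is_monoidalI is_functorI F.K.category_axioms G.L.category_axioms)
    fix f g assume "f \<in> Arr K" "g \<in> Arr K"
    then show "(\<lambda>(x, y)\<in>Obj K \<times> Obj K. ?\<kappa> x y) (Cod K f, Cod K g) \<cdot>\<^bsub>M\<^esub>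
          ((\<lambda>f\<in>Arr K. Gm (Fm f)) f \<otimes>\<^sub>m\<^bsub>M\<^esub> (\<lambda>f\<in>Arr K. Gm (Fm f)) g)
        = (\<lambda>f\<in>Arr K. Gm (Fm f)) (f \<otimes>\<^sub>m\<^bsub>K\<^esub> g) \<cdot>\<^bsub>M\<^esub> (\<lambda>(x, y)\<in>Obj K \<times> Obj K. ?\<kappa> x y) (Dom K f, Dom K g)"
      using natural[of f g] by (simp del: G.L.assoc)
  next
    fix x y z assume "x \<in> Obj K" "y \<in> Obj K" "z \<in> Obj K"
    then show "(\<lambda>f\<in>Arr K. Gm (Fm f)) (Asc K x y z) \<cdot>\<^bsub>M\<^esub>
          (\<lambda>(x, y)\<in>Obj K \<times> Obj K. ?\<kappa> x y) (x \<otimes>\<^sub>o\<^bsub>K\<^esub> y, z) \<cdot>\<^bsub>M\<^esub>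
          ((\<lambda>(x, y)\<in>Obj K \<times> Obj K. ?\<kappa> x y) (x, y) \<otimes>\<^sub>m\<^bsub>M\<^esub> \<I>\<^bsub>M\<^esub> ((\<lambda>x\<in>Obj K. Go (Fo x)) z))
        = (\<lambda>(x, y)\<in>Obj K \<times> Obj K. ?\<kappa> x y) (x, y \<otimes>\<^sub>o\<^bsub>K\<^esub> z) \<cdot>\<^bsub>M\<^esub>
          (\<I>\<^bsub>M\<^esub> ((\<lambda>x\<in>Obj K. Go (Fo x)) x) \<otimes>\<^sub>m\<^bsub>M\<^esub> (\<lambda>(x, y)\<in>Obj K \<times> Obj K. ?\<kappa> x y) (y, z)) \<cdot>\<^bsub>M\<^esub>
          Asc M ((\<lambda>x\<in>Obj K. Go (Fo x)) x) ((\<lambda>x\<in>Obj K. Go (Fo x)) y) ((\<lambda>x\<in>Obj K. Go (Fo x)) z)"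
      using assoc[of x y z] by (simp del: G.L.assoc)
  next
    fix x assume "x \<in> Obj K"
    then show "(\<lambda>f\<in>Arr K. Gm (Fm f)) (Lun K x) \<cdot>\<^bsub>M\<^esub> (\<lambda>(x, y)\<in>Obj K \<times> Obj K. ?\<kappa> x y) (Unt K, x) \<cdot>\<^bsub>M\<^esub>
          ((Gm \<epsilon> \<cdot>\<^bsub>M\<^esub> \<eta>) \<otimes>\<^sub>m\<^bsub>M\<^esub> \<I>\<^bsub>M\<^esub> ((\<lambda>x\<in>Obj K. Go (Fo x)) x)) = Lun M ((\<lambda>x\<in>Obj K. Go (Fo x)) x)"
      and "(\<lambda>f\<in>Arr K. Gm (Fm f)) (Run K x) \<cdot>\<^bsub>M\<^esub> (\<lambda>(x, y)\<in>Obj K \<times> Obj K. ?\<kappa> x y) (x, Unt K) \<cdot>\<^bsub>M\<^esub>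
          (\<I>\<^bsub>M\<^esub> ((\<lambda>x\<in>Obj K. Go (Fo x)) x) \<otimes>\<^sub>m\<^bsub>M\<^esub> (Gm \<epsilon> \<cdot>\<^bsub>M\<^esub> \<eta>)) = Run M ((\<lambda>x\<in>Obj K. Go (Fo x)) x)"
      using lunit[of x] runit[of x] by (simp_all del: G.L.assoc)
  qed (simp_all add: G.L.Iso_iff)
qed


section \<open>Ideals along exact monoidal functors\<close>

locale exact_monoidal_functor = exact_functor K L Fo Fm \<zeta> + monoidal_functor K L Fo Fm \<mu> \<epsilon>
  for K :: "('o, 'm, 'r) ttcat_scheme" and L :: "('p, 'n, 's) ttcat_scheme" and Fo Fm \<zeta> \<mu> \<epsilon>
begin

lemma thick_ideal_vimage:
  assumes J: "thick_ideal L J"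
  shows "thick_ideal K {x \<in> Obj K. Fo x \<in> J}"
  unfolding thick_ideal_def
proof (intro conjI ballI)
  show "thick K {x \<in> Obj K. Fo x \<in> J}" by (rule thick_vimage[OF L.thick_ideal_thick[OF J]])
  fix x y assume x: "x \<in> Obj K" and y: "y \<in> {x \<in> Obj K. Fo x \<in> J}"
  have "Fo x \<otimes>\<^sub>o\<^bsub>L\<^esub> Fo y \<in> J" using L.thick_ideal_tensor[OF J] x y by auto
  then have "Fo (x \<otimes>\<^sub>o\<^bsub>K\<^esub> y) \<in> J" using L.thick_Iso[OF L.thick_ideal_thick[OF J] _ tensor_Iso] x y by auto
  then show "x \<otimes>\<^sub>o\<^bsub>K\<^esub> y \<in> {x \<in> Obj K. Fo x \<in> J}" using x y by auto
qed

lemma prime_ideal_vimage: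
  assumes P: "prime_ideal L P"
  shows "prime_ideal K {x \<in> Obj K. Fo x \<in> P}"
  unfolding prime_ideal_def
proof (intro conjI ballI impI)
  note J = L.prime_ideal_ideal[OF P]
  show "thick_ideal K {x \<in> Obj K. Fo x \<in> P}" by (rule thick_ideal_vimage[OF J])
  have "\<epsilon> \<in> Iso L (Unt L) (Fo (Unt K))" by (simp add: L.Iso_iff)
  then have "Fo (Unt K) \<notin> P"
    using L.thick_Iso_iff[OF L.thick_ideal_thick[OF J], of "Unt L" "Fo (Unt K)"] L.prime_ideal_unit[OF P] by auto
  then show "{x \<in> Obj K. Fo x \<in> P} \<noteq> Obj K" using K.unit_in by blast
  fix x y assume x: "x \<in> Obj K" and y: "y \<in> Obj K" and "x \<otimes>\<^sub>o\<^bsub>K\<^esub> y \<in> {x \<in> Obj K. Fo x \<in> P}"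
  then have "Fo x \<otimes>\<^sub>o\<^bsub>L\<^esub> Fo y \<in> P"
    using L.thick_Iso_iff[OF L.thick_ideal_thick[OF J] tensor_Iso[OF x y]] by auto
  then show "x \<in> {x \<in> Obj K. Fo x \<in> P} \<or> y \<in> {x \<in> Obj K. Fo x \<in> P}"
    using L.prime_ideal_tensor_iff[OF P] x y by auto
qed

text \<open>Every object of \<open>L\<close> is isomorphic to some \<open>Fa\<close>, and \<open>Fa \<otimes> Fy \<cong> F(a \<otimes> y)\<close>.\<close>

lemma thick_closure_image_ideal:
  assumes ess_surj and J: "thick_ideal K J"
  shows "thick_ideal L (thick_closure L (Fo ` J))"
proof -
  let ?N = "thick_closure L (Fo ` J)"
  have JO: "J \<subseteq> Obj K" by (rule K.thick_ideal_subset[OF J])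
  then have N: "thick L ?N" by (intro L.thick_closure_thick) auto
  have "d \<otimes>\<^sub>o\<^bsub>L\<^esub> z \<in> ?N" if d: "d \<in> Obj L" and z: "z \<in> ?N" for d z
  proof -
    obtain a where a: "a \<in> Obj K" "Iso L (Fo a) d \<noteq> {}"
      using \<open>ess_surj\<close> d unfolding ess_surj_def by blast
    have "?N \<subseteq> {u \<in> Obj L. d \<otimes>\<^sub>o\<^bsub>L\<^esub> u \<in> ?N}"
    proof (intro L.thick_closure_least L.thick_tensor_vimage(1)[OF N d] subsetI)
      fix u assume "u \<in> Fo ` J"
      then obtain y where y: "y \<in> J" "u = Fo y" by auto
      have yO: "y \<in> Obj K" using y JO by auto
      have "Fo (a \<otimes>\<^sub>o\<^bsub>K\<^esub> y) \<in> ?N"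
        using K.thick_ideal_tensor[OF J a(1) y(1)] L.thick_closure_upper[of "Fo ` J"] by auto
      then have "Fo a \<otimes>\<^sub>o\<^bsub>L\<^esub> Fo y \<in> ?N"
        using L.thick_Iso_iff[OF N tensor_Iso[OF a(1) yO]] by simp
      then have "d \<otimes>\<^sub>o\<^bsub>L\<^esub> Fo y \<in> ?N"
        using L.thick_Iso[OF N _ L.tensor_Iso_left[OF a(2), of "Fo y"]] yO by auto
      then show "u \<in> {u \<in> Obj L. d \<otimes>\<^sub>o\<^bsub>L\<^esub> u \<in> ?N}" using y yO by auto
    qed
    then show ?thesis using z by auto
  qed
  then show ?thesis using N by (simp add: thick_ideal_def)
qed

lemma thick_closure_image_ideal_closure:
  assumes ess_surj and x: "x \<in> Obj K"
  shows "thick_closure L (Fo ` ideal_closure K {x}) = ideal_closure L {Fo x}"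
proof
  have I: "thick_ideal L (ideal_closure L {Fo x})" using x by (intro L.ideal_closure_ideal) auto
  have "ideal_closure K {x} \<subseteq> {y \<in> Obj K. Fo y \<in> ideal_closure L {Fo x}}"
    using x L.in_ideal_closure by (intro K.ideal_closure_least thick_ideal_vimage[OF I]) auto
  then show "thick_closure L (Fo ` ideal_closure K {x}) \<subseteq> ideal_closure L {Fo x}"
    by (intro L.thick_closure_least L.thick_ideal_thick[OF I]) auto
  have "thick_ideal L (thick_closure L (Fo ` ideal_closure K {x}))"
    using x by (intro thick_closure_image_ideal[OF assms(1)] K.ideal_closure_ideal) auto
  then show "ideal_closure L {Fo x} \<subseteq> thick_closure L (Fo ` ideal_closure K {x})"
    using L.thick_closure_upper[of "Fo ` ideal_closure K {x}"] K.in_ideal_closure[of x]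
    by (intro L.ideal_closure_least) auto
qed

end


section \<open>The category of confluent monoidal localizations\<close>

lemma confluent_comp:
  assumes "exact_functor K L Fo Fm \<zeta>" "exact_functor L M Go Gm \<xi>"
    and F: "confluent K L Fo" and G: "confluent L M Go"
  shows "confluent K M (\<lambda>x\<in>Obj K. Go (Fo x))"
proof -
  interpret F: exact_functor K L Fo Fm \<zeta> by fact
  interpret G: exact_functor L M Go Gm \<xi> by fact
  have image: "thick_closure M ((\<lambda>x\<in>Obj K. Go (Fo x)) ` A) = thick_closure M (Go ` thick_closure L (Fo ` A))"
    if "A \<subseteq> Obj K" for A
  proof -
    have "(\<lambda>x\<in>Obj K. Go (Fo x)) ` A = Go ` Fo ` A" using that by auto
    moreover have "Fo ` A \<subseteq> Obj L" using that by auto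
    ultimately show ?thesis using G.thick_closure_image[of "Fo ` A"] by simp
  qed
  show ?thesis
    unfolding confluent_def
  proof (intro conjI allI impI)
    show "thick_closure M ((\<lambda>x\<in>Obj K. Go (Fo x)) ` Obj K) = Obj M"
      using image[of "Obj K"] F G by (simp add: confluent_def)
    fix A B assume AB: "thick K A \<and> thick K B"
    then have A: "A \<subseteq> Obj K" and B: "B \<subseteq> Obj K" and I: "A \<inter> B \<subseteq> Obj K"
      using F.K.thick_subset by auto
    have th: "thick L (thick_closure L (Fo ` A))" "thick L (thick_closure L (Fo ` B))"
      using A B by (auto intro!: F.L.thick_closure_thick)
    show "thick_closure M ((\<lambda>x\<in>Obj K. Go (Fo x)) ` A) \<inter> thick_closure M ((\<lambda>x\<in>Obj K. Go (Fo x)) ` B)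
        = thick_closure M ((\<lambda>x\<in>Obj K. Go (Fo x)) ` (A \<inter> B))"
      unfolding image[OF A] image[OF B] image[OF I]
      using F G AB th by (simp add: confluent_def)
  qed
qed

lemma (in triangulated_category) confluent_ident: "confluent K K (\<lambda>x\<in>Obj K. x)"
proof -
  have "(\<lambda>x\<in>Obj K. x) ` M = M" if "thick K M" for M
    using thick_subset[OF that] by auto
  then show ?thesis
    using thick_Obj by (simp add: confluent_def thick_closure_idem thick_Int)
qed

locale ttmor_arr =
  fixes F :: "('o, 'm) ttmor"
  assumes src: "rigid_tt_category (Src F)" and tgt: "rigid_tt_category (Tgt F)"
    and ext: "ttmor_extensional F" and cml: "confluent_monoidal_localization F"
begin

sublocale K: rigid_tt_category "Src F" by (rule src)
sublocale L: rigid_tt_category "Tgt F" by (rule tgt)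
sublocale exact_monoidal_functor "Src F" "Tgt F" "FO F" "FM F" "FShift F" "FTensor F" "FUnit F"
  using cml by unfold_locales (auto simp: confluent_monoidal_localization_def)

lemma localization: "is_localization (Src F) (Tgt F) (FO F) (FM F)"
  and confl: "confluent (Src F) (Tgt F) (FO F)"
  using cml by (auto simp: confluent_monoidal_localization_def)

lemma ess_surj: ess_surj
  using localization is_localization_iff by simp

end

lemma ttmor_arr_iff: "F \<in> Arr rttcat_conf_loc \<longleftrightarrow> ttmor_arr F"
  by (simp add: rttcat_conf_loc_def ttmor_arr_def)

lemma ttmor_ident_arr:
  assumes "rigid_tt_category K"
  shows "ttmor_arr (ttmor_ident K)"
proof -
  interpret rigid_tt_category K by fact
  show ?thesis
    using assms is_exact_ident is_monoidal_ident is_localization_ident confluent_ident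
    by (simp add: ttmor_arr_def confluent_monoidal_localization_def ttmor_extensional_def ttmor_ident_def)
qed

lemma ttmor_comp_arr:
  assumes "ttmor_arr F" "ttmor_arr G" "Tgt F = Src G"
  shows "ttmor_arr (ttmor_comp G F)"
proof -
  interpret F: ttmor_arr F by fact
  interpret G: ttmor_arr G by fact
  have eF: "exact_functor (Src F) (Src G) (FO F) (FM F) (FShift F)"
    using F.exact_functor_axioms assms(3) by simp
  have mF: "monoidal_functor (Src F) (Src G) (FO F) (FM F) (FTensor F) (FUnit F)"
    using F.monoidal_functor_axioms assms(3) by simp
  note eG = G.exact_functor_axioms and mG = G.monoidal_functor_axioms
  show ?thesis
    using F.src G.tgt is_exact_comp[OF eF eG] is_monoidal_comp[OF mF mG]
      is_localization_comp[OF eF eG] confluent_comp[OF eF eG]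
      F.localization G.localization F.confl G.confl assms(3)
    by (simp add: ttmor_arr_def confluent_monoidal_localization_def ttmor_extensional_def ttmor_comp_def)
qed

lemma category_rttcat_conf_loc: "category (rttcat_conf_loc :: (('o, 'm) ttcat, ('o, 'm) ttmor) cat)"
proof
  let ?C = "rttcat_conf_loc :: (('o, 'm) ttcat, ('o, 'm) ttmor) cat"
  have Hom: "F \<in> Hom ?C K L \<longleftrightarrow> ttmor_arr F \<and> Src F = K \<and> Tgt F = L" for F K L
    unfolding Hom_def mem_Collect_eq ttmor_arr_iff by (simp add: rttcat_conf_loc_def)
  have [simp]: "Ident ?C = ttmor_ident" "Comp ?C = ttmor_comp" by (simp_all add: rttcat_conf_loc_def)
  show "Dom ?C F \<in> Obj ?C" "Cod ?C F \<in> Obj ?C" if "F \<in> Arr ?C" for F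
    using that by (auto simp: rttcat_conf_loc_def)
  show "\<I>\<^bsub>?C\<^esub> K \<in> Hom ?C K K" if "K \<in> Obj ?C" for K
    using that ttmor_ident_arr[of K] unfolding Hom by (simp add: rttcat_conf_loc_def ttmor_ident_def)
  show "G \<cdot>\<^bsub>?C\<^esub> F \<in> Hom ?C K M" if "F \<in> Hom ?C K L" "G \<in> Hom ?C L M" for F G K L M
    using that ttmor_comp_arr[of F G] unfolding Hom by (simp add: ttmor_comp_def)
  show "\<I>\<^bsub>?C\<^esub> L \<cdot>\<^bsub>?C\<^esub> F = F" if "F \<in> Hom ?C K L" for F K L
  proof -
    have F: "ttmor_arr F" and L [simp]: "Tgt F = L" using that unfolding Hom by auto
    interpret F: ttmor_arr F by (rule F)
    note [simp] = F.obj[unfolded L] F.arr[unfolded L] F.dom[unfolded L] F.cod[unfolded L]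
      F.shift_iso[unfolded L] F.tensor_comparison[unfolded L] F.unit_comparison[unfolded L]
    interpret L: rigid_tt_category L using F.tgt by simp
    have e: "FO F \<in> extensional (Obj (Src F))" "FM F \<in> extensional (Arr (Src F))"
      "FShift F \<in> extensional (Obj (Src F))" "FTensor F \<in> extensional (Obj (Src F) \<times> Obj (Src F))"
      using F.ext by (auto simp: ttmor_extensional_def)
    show ?thesis
    proof (rule ttmor.equality)
      show "FO (\<I>\<^bsub>?C\<^esub> L \<cdot>\<^bsub>?C\<^esub> F) = FO F"
        by (rule extensionalityI[OF _ e(1)]) (auto simp: ttmor_comp_def ttmor_ident_def)
      show "FM (\<I>\<^bsub>?C\<^esub> L \<cdot>\<^bsub>?C\<^esub> F) = FM F"
        by (rule extensionalityI[OF _ e(2)]) (auto simp: ttmor_comp_def ttmor_ident_def)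
      show "FShift (\<I>\<^bsub>?C\<^esub> L \<cdot>\<^bsub>?C\<^esub> F) = FShift F"
        by (rule extensionalityI[OF _ e(3)]) (auto simp: ttmor_comp_def ttmor_ident_def)
      show "FTensor (\<I>\<^bsub>?C\<^esub> L \<cdot>\<^bsub>?C\<^esub> F) = FTensor F"
        by (rule extensionalityI[OF _ e(4)]) (auto simp: ttmor_comp_def ttmor_ident_def)
    qed (simp_all add: ttmor_comp_def ttmor_ident_def)
  qed
  show "F \<cdot>\<^bsub>?C\<^esub> \<I>\<^bsub>?C\<^esub> K = F" if "F \<in> Hom ?C K L" for F K L
  proof -
    have F: "ttmor_arr F" and K: "K = Src F" using that unfolding Hom by auto
    interpret F: ttmor_arr F by (rule F)
    have e: "FO F \<in> extensional (Obj (Src F))" "FM F \<in> extensional (Arr (Src F))"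
      "FShift F \<in> extensional (Obj (Src F))" "FTensor F \<in> extensional (Obj (Src F) \<times> Obj (Src F))"
      using F.ext by (auto simp: ttmor_extensional_def)
    show ?thesis
      unfolding K
    proof (rule ttmor.equality)
      show "FO (F \<cdot>\<^bsub>?C\<^esub> \<I>\<^bsub>?C\<^esub> (Src F)) = FO F"
        by (rule extensionalityI[OF _ e(1)]) (auto simp: ttmor_comp_def ttmor_ident_def)
      show "FM (F \<cdot>\<^bsub>?C\<^esub> \<I>\<^bsub>?C\<^esub> (Src F)) = FM F"
        by (rule extensionalityI[OF _ e(2)]) (auto simp: ttmor_comp_def ttmor_ident_def)
      show "FShift (F \<cdot>\<^bsub>?C\<^esub> \<I>\<^bsub>?C\<^esub> (Src F)) = FShift F"
        by (rule extensionalityI[OF _ e(3)]) (auto simp: ttmor_comp_def ttmor_ident_def)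
      show "FTensor (F \<cdot>\<^bsub>?C\<^esub> \<I>\<^bsub>?C\<^esub> (Src F)) = FTensor F"
        by (rule extensionalityI[OF _ e(4)]) (auto simp: ttmor_comp_def ttmor_ident_def)
    qed (simp_all add: ttmor_comp_def ttmor_ident_def)
  qed
  show "(H \<cdot>\<^bsub>?C\<^esub> G) \<cdot>\<^bsub>?C\<^esub> F = H \<cdot>\<^bsub>?C\<^esub> (G \<cdot>\<^bsub>?C\<^esub> F)"
    if "F \<in> Hom ?C K L" "G \<in> Hom ?C L M" "H \<in> Hom ?C M N" for F G H K L M N
  proof -
    have arrs: "ttmor_arr F" "ttmor_arr G" "ttmor_arr H" and eqs: "Tgt F = Src G" "Tgt G = Src H"
      using that unfolding Hom by auto
    interpret F: ttmor_arr F by (rule arrs)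
    interpret G: ttmor_arr G by (rule arrs)
    interpret H: ttmor_arr H by (rule arrs)
    note [simp] = F.obj[unfolded eqs] F.arr[unfolded eqs] F.dom[unfolded eqs] F.cod[unfolded eqs]
      F.shift_iso[unfolded eqs] F.tensor_comparison[unfolded eqs] F.unit_comparison[unfolded eqs]
      G.obj[unfolded eqs] G.arr[unfolded eqs] G.dom[unfolded eqs] G.cod[unfolded eqs]
      G.shift_iso[unfolded eqs] G.tensor_comparison[unfolded eqs] G.unit_comparison[unfolded eqs]
    show ?thesis
      by (rule ttmor.equality)
        (auto simp: ttmor_comp_def eqs intro!: restrict_ext)
  qed
qed


section \<open>Spaces of points of complete lattices are sober\<close>

lemma irreducible_closedin_meets:
  assumes "irreducible_closedin X Z" "openin X U" "openin X V" "Z \<inter> U \<noteq> {}" "Z \<inter> V \<noteq> {}"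
  shows "Z \<inter> (U \<inter> V) \<noteq> {}"
proof
  assume *: "Z \<inter> (U \<inter> V) = {}"
  have "closedin X (Z - U)" "closedin X (Z - V)"
    using assms(1-3) by (auto simp: irreducible_closedin_def intro: closedin_diff)
  moreover have "Z = (Z - U) \<union> (Z - V)" using * by auto
  ultimately have "Z = Z - U \<or> Z = Z - V" using assms(1) unfolding irreducible_closedin_def by blast
  then show False using assms(4,5) by auto
qed

context complete_lattice
begin

lemma points_mono: "\<lbrakk>p \<in> points L; x \<in> carrier L; y \<in> carrier L; x \<sqsubseteq> y; p x\<rbrakk> \<Longrightarrow> p y"
  by (auto simp: points_def)

lemma points_top: "p \<in> points L \<Longrightarrow> p \<top>"
  and points_meet: "\<lbrakk>p \<in> points L; x \<in> carrier L; y \<in> carrier L\<rbrakk> \<Longrightarrow> p (x \<sqinter> y) \<longleftrightarrow> p x \<and> p y"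
  and points_sup: "\<lbrakk>p \<in> points L; A \<subseteq> carrier L\<rbrakk> \<Longrightarrow> p (\<Squnion>A) \<longleftrightarrow> (\<exists>a\<in>A. p a)"
  and points_ext: "p \<in> points L \<Longrightarrow> p \<in> extensional (carrier L)"
  by (auto simp: points_def)

lemma openin_point_space: "openin (point_space L) U \<longleftrightarrow> (\<exists>l\<in>carrier L. U = {p \<in> points L. p l})"
proof -
  let ?O = "\<lambda>U. \<exists>l\<in>carrier L. U = {p \<in> points L. p l}"
  have "istopology ?O"
    unfolding istopology_def
  proof (intro conjI allI impI)
    fix S T assume "?O S" "?O T"
    then obtain l m where lm: "l \<in> carrier L" "m \<in> carrier L"
      "S = {p \<in> points L. p l}" "T = {p \<in> points L. p m}" by auto
    then have "S \<inter> T = {p \<in> points L. p (l \<sqinter> m)}" using points_meet[OF _ lm(1,2)] by blast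
    then show "?O (S \<inter> T)" by (rule bexI[where x = "l \<sqinter> m"]) (use lm(1,2) in simp)
  next
    fix \<K> assume "\<forall>S\<in>\<K>. ?O S"
    then obtain l where l: "\<And>S. S \<in> \<K> \<Longrightarrow> l S \<in> carrier L \<and> S = {p \<in> points L. p (l S)}" by metis
    have sub: "l ` \<K> \<subseteq> carrier L" using l by auto
    have "\<Union>\<K> = {p \<in> points L. p (\<Squnion>(l ` \<K>))}"
    proof (intro Set.set_eqI iffI)
      fix p assume "p \<in> \<Union>\<K>"
      then obtain S where "S \<in> \<K>" "p \<in> S" by auto
      then have "p \<in> points L" "p (l S)" using l by auto
      then show "p \<in> {p \<in> points L. p (\<Squnion>(l ` \<K>))}" using points_sup[OF _ sub] \<open>S \<in> \<K>\<close> by auto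
    next
      fix p assume "p \<in> {p \<in> points L. p (\<Squnion>(l ` \<K>))}"
      then obtain S where "p \<in> points L" "S \<in> \<K>" "p (l S)" using points_sup[OF _ sub] by auto
      then show "p \<in> \<Union>\<K>" using l[of S] by blast
    qed
    then show "?O (\<Union>\<K>)"
      by (rule bexI[where x = "\<Squnion>(l ` \<K>)"]) (rule sup_closed[OF sub])
  qed
  then show ?thesis unfolding point_space_def by simp
qed

lemma topspace_point_space: "topspace (point_space L) = points L"
proof -
  have "openin (point_space L) (points L)"
    unfolding openin_point_space using points_top by (intro bexI[where x = \<top>]) auto
  moreover have "U \<subseteq> points L" if "openin (point_space L) U" for U
    using that unfolding openin_point_space by auto
  ultimately show ?thesis by (meson openin_subset openin_topspace subset_antisym)
qed

lemma in_closure_point: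
  assumes "p \<in> points L"
  shows "q \<in> point_space L closure_of {p} \<longleftrightarrow> q \<in> points L \<and> (\<forall>l\<in>carrier L. q l \<longrightarrow> p l)"
proof -
  have "q \<in> point_space L closure_of {p}
      \<longleftrightarrow> q \<in> points L \<and> (\<forall>U. q \<in> U \<and> openin (point_space L) U \<longrightarrow> p \<in> U)"
    unfolding in_closure_of topspace_point_space by simp
  also have "\<dots> \<longleftrightarrow> q \<in> points L \<and> (\<forall>l\<in>carrier L. q l \<longrightarrow> p l)"
  proof (intro conj_cong refl iffI ballI allI impI)
    fix l assume q: "q \<in> points L" "\<forall>U. q \<in> U \<and> openin (point_space L) U \<longrightarrow> p \<in> U"
      and l: "l \<in> carrier L" "q l"
    have "openin (point_space L) {r \<in> points L. r l}"
      unfolding openin_point_space using l(1) by (intro bexI[where x = l]) simp_all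
    then have "p \<in> {r \<in> points L. r l}"
      using q(2)[rule_format, of "{r \<in> points L. r l}"] q(1) l(2) by blast
    then show "p l" by simp
  next
    fix U assume *: "q \<in> points L" "\<forall>l\<in>carrier L. q l \<longrightarrow> p l" "q \<in> U \<and> openin (point_space L) U"
    then obtain l where "l \<in> carrier L" "U = {p \<in> points L. p l}" unfolding openin_point_space by blast
    then show "p \<in> U" using * assms by auto
  qed
  finally show ?thesis .
qed

text \<open>
  The generic point of an irreducible closed set \<open>Z\<close> declares \<open>l\<close> true iff some point of \<open>Z\<close> does;
  irreducibility is what makes this preserve binary meets.
\<close>

theorem sober_point_space: "sober_space (point_space L)"
  unfolding sober_space_def
proof (intro allI impI)
  fix Z assume Z: "irreducible_closedin (point_space L) Z"
  then have cl: "closedin (point_space L) Z" and ne: "Z \<noteq> {}" by (auto simp: irreducible_closedin_def)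
  have Zp: "Z \<subseteq> points L" using closedin_subset[OF cl] by (simp add: topspace_point_space)
  define p where "p = (\<lambda>l\<in>carrier L. \<exists>q\<in>Z. q l)"
  have opn: "openin (point_space L) {q \<in> points L. q l}" if "l \<in> carrier L" for l
    unfolding openin_point_space using that by auto
  have p_pt: "p \<in> points L"
    unfolding points_def mem_Collect_eq
  proof (intro conjI ballI allI impI)
    show "p \<in> extensional (carrier L)" by (simp add: p_def)
    show "p \<top>" using ne Zp points_top by (auto simp: p_def)
    fix x y assume x: "x \<in> carrier L" and y: "y \<in> carrier L"
    show "p x \<le> p y" if "x \<sqsubseteq> y"
    proof (rule le_boolI)
      assume "p x"
      then obtain q where "q \<in> Z" "q x" using x by (auto simp: p_def)
      then have "q y" using points_mono[OF _ x y that] Zp by auto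
      then show "p y" using \<open>q \<in> Z\<close> y by (auto simp: p_def)
    qed
    have pm: "q (x \<sqinter> y) \<longleftrightarrow> q x \<and> q y" if "q \<in> Z" for q
      by (rule points_meet) (use that Zp x y in auto)
    show "p (x \<sqinter> y) \<longleftrightarrow> p x \<and> p y"
    proof
      assume "p (x \<sqinter> y)"
      then obtain q where "q \<in> Z" "q (x \<sqinter> y)" using x y by (auto simp: p_def)
      then show "p x \<and> p y" using x y pm[of q] by (auto simp: p_def)
    next
      assume *: "p x \<and> p y"
      have "Z \<inter> {q \<in> points L. q x} \<noteq> {}" "Z \<inter> {q \<in> points L. q y} \<noteq> {}"
        using * x y Zp by (auto simp: p_def)
      from irreducible_closedin_meets[OF Z opn[OF x] opn[OF y] this]
      obtain q where "q \<in> Z" "q x" "q y" by auto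
      then show "p (x \<sqinter> y)" using x y pm[of q] by (auto simp: p_def)
    qed
  next
    fix A assume A: "A \<subseteq> carrier L"
    have "(\<exists>q\<in>Z. q (\<Squnion>A)) \<longleftrightarrow> (\<exists>q\<in>Z. \<exists>a\<in>A. q a)" using points_sup[OF _ A] Zp by blast
    also have "\<dots> \<longleftrightarrow> (\<exists>a\<in>A. p a)" using A by (auto simp: p_def)
    finally show "p (\<Squnion>A) \<longleftrightarrow> (\<exists>a\<in>A. p a)" using sup_closed[OF A] by (simp add: p_def)
  qed
  have closure: "point_space L closure_of {p} = Z"
  proof (rule Set.set_eqI)
    fix q
    show "q \<in> point_space L closure_of {p} \<longleftrightarrow> q \<in> Z"
    proof
      assume "q \<in> Z"
      then show "q \<in> point_space L closure_of {p}"
        unfolding in_closure_point[OF p_pt] using Zp by (auto simp: p_def)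
    next
      assume "q \<in> point_space L closure_of {p}"
      then have q: "q \<in> points L" "\<And>l. l \<in> carrier L \<Longrightarrow> q l \<Longrightarrow> p l"
        unfolding in_closure_point[OF p_pt] by auto
      have "openin (point_space L) (points L - Z)"
        using openin_diff[OF openin_topspace cl] by (simp add: topspace_point_space)
      then obtain l where l: "l \<in> carrier L" "points L - Z = {q \<in> points L. q l}"
        unfolding openin_point_space by auto
      then have "\<not> p l" using Zp by (auto simp: p_def)
      then show "q \<in> Z" using q l by blast
    qed
  qed
  show "\<exists>!z. z \<in> topspace (point_space L) \<and> point_space L closure_of {z} = Z"
  proof (rule ex1I[where a = p])
    show "p \<in> topspace (point_space L) \<and> point_space L closure_of {p} = Z"
      using p_pt closure by (simp add: topspace_point_space)
    fix r assume r: "r \<in> topspace (point_space L) \<and> point_space L closure_of {r} = Z"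
    then have r_pt: "r \<in> points L" by (simp add: topspace_point_space)
    have "r \<in> point_space L closure_of {p}" "p \<in> point_space L closure_of {r}"
      using r closure in_closure_point[OF r_pt, of r] in_closure_point[OF p_pt, of p] r_pt p_pt by auto
    then have "r l \<longleftrightarrow> p l" if "l \<in> carrier L" for l
      unfolding in_closure_point[OF p_pt] in_closure_point[OF r_pt] using that by blast
    then show "r = p" using points_ext[OF r_pt] points_ext[OF p_pt] by (intro extensionalityI) auto
  qed
qed

end


section \<open>The non-tensor spectrum\<close>

context triangulated_category
begin

lemma carrier_thick_lattice [simp]: "M \<in> carrier (thick_lattice K) \<longleftrightarrow> thick K M"
  and le_thick_lattice [simp]: "le (thick_lattice K) = (\<subseteq>)"
  by (simp_all add: thick_lattice_def inclusion_order_def)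

lemma thick_Union_subset: "A \<subseteq> carrier (thick_lattice K) \<Longrightarrow> \<Union>A \<subseteq> Obj K"
proof
  fix x assume "A \<subseteq> carrier (thick_lattice K)" "x \<in> \<Union>A"
  then obtain M where "M \<in> A" "thick K M" "x \<in> M" using carrier_thick_lattice by blast
  then show "x \<in> Obj K" using thick_subset by auto
qed

lemma least_thick_lattice:
  assumes A: "A \<subseteq> carrier (thick_lattice K)"
  shows "least (thick_lattice K) (thick_closure K (\<Union>A)) (Upper (thick_lattice K) A)"
proof (rule least_UpperI[OF _ _ A])
  note th = thick_closure_thick[OF thick_Union_subset[OF A]]
  have thA: "\<forall>M\<in>A. thick K M" using A carrier_thick_lattice by blast
  show "thick_closure K (\<Union>A) \<in> carrier (thick_lattice K)" using th by simp
  show "M \<sqsubseteq>\<^bsub>thick_lattice K\<^esub> thick_closure K (\<Union>A)" if "M \<in> A" for M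
    using that thick_closure_upper[of "\<Union>A"] by auto
  show "thick_closure K (\<Union>A) \<sqsubseteq>\<^bsub>thick_lattice K\<^esub> N" if "N \<in> Upper (thick_lattice K) A" for N
  proof -
    have "thick K N" "\<Union>A \<subseteq> N" using that thA by (auto simp: Upper_def)
    then show ?thesis using thick_closure_least by simp
  qed
qed

lemma greatest_thick_lattice:
  assumes A: "A \<subseteq> carrier (thick_lattice K)"
  shows "greatest (thick_lattice K) (\<Inter>(insert (Obj K) A)) (Lower (thick_lattice K) A)"
proof (rule greatest_LowerI[OF _ _ A])
  show "\<Inter>(insert (Obj K) A) \<in> carrier (thick_lattice K)"
    unfolding carrier_thick_lattice using A thick_Obj carrier_thick_lattice
    by (intro thick_Inter) (auto simp del: carrier_thick_lattice)
  show "\<Inter>(insert (Obj K) A) \<sqsubseteq>\<^bsub>thick_lattice K\<^esub> M" if "M \<in> A" for M using that by auto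
  show "N \<sqsubseteq>\<^bsub>thick_lattice K\<^esub> \<Inter>(insert (Obj K) A)" if N: "N \<in> Lower (thick_lattice K) A" for N
  proof -
    have "\<forall>M\<in>A. thick K M" using A carrier_thick_lattice by blast
    then have "\<forall>M\<in>A. N \<subseteq> M" using N by (auto simp: Lower_def)
    moreover have "thick K N" using N by (simp add: Lower_def)
    ultimately show ?thesis using thick_subset[of N] by auto
  qed
qed

lemma complete_thick_lattice: "complete_lattice (thick_lattice K)"
proof (rule partial_order.complete_latticeI)
  show "partial_order (thick_lattice K)"
    by standard (auto simp: thick_lattice_def inclusion_order_def)
qed (use least_thick_lattice greatest_thick_lattice in blast)+

sublocale TL: complete_lattice "thick_lattice K"
  by (rule complete_thick_lattice)

lemma thick_lattice_sup: "A \<subseteq> carrier (thick_lattice K) \<Longrightarrow> \<Squnion>\<^bsub>thick_lattice K\<^esub>A = thick_closure K (\<Union>A)"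
  by (rule TL.least_unique[OF TL.sup_lub least_thick_lattice])

lemma thick_lattice_meet:
  assumes "thick K M" "thick K N"
  shows "M \<sqinter>\<^bsub>thick_lattice K\<^esub> N = M \<inter> N"
proof -
  have A: "{M, N} \<subseteq> carrier (thick_lattice K)" using assms by simp
  have "M \<sqinter>\<^bsub>thick_lattice K\<^esub> N = \<Inter>(insert (Obj K) {M, N})"
    unfolding meet_def by (rule TL.greatest_unique[OF TL.inf_glb[OF A] greatest_thick_lattice[OF A]])
  then show ?thesis using thick_subset assms by auto
qed

lemma thick_lattice_top: "\<top>\<^bsub>thick_lattice K\<^esub> = Obj K"
  by (rule TL.greatest_unique[OF TL.top_greatest]) (auto simp: greatest_def thick_Obj dest: thick_subset[THEN subsetD])

lemma points_thick_iff:
  "p \<in> points (thick_lattice K) \<longleftrightarrow> p \<in> extensional (carrier (thick_lattice K))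
    \<and> (\<forall>M N. thick K M \<and> thick K N \<and> M \<subseteq> N \<and> p M \<longrightarrow> p N)
    \<and> p (Obj K) \<and> (\<forall>M N. thick K M \<and> thick K N \<longrightarrow> (p (M \<inter> N) \<longleftrightarrow> p M \<and> p N))
    \<and> (\<forall>A. (\<forall>M\<in>A. thick K M) \<longrightarrow> (p (thick_closure K (\<Union>A)) \<longleftrightarrow> (\<exists>M\<in>A. p M)))"
proof -
  have "(\<forall>A\<subseteq>carrier (thick_lattice K). p (\<Squnion>\<^bsub>thick_lattice K\<^esub>A) \<longleftrightarrow> (\<exists>M\<in>A. p M)) \<longleftrightarrow>
      (\<forall>A. (\<forall>M\<in>A. thick K M) \<longrightarrow> (p (thick_closure K (\<Union>A)) \<longleftrightarrow> (\<exists>M\<in>A. p M)))"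
  proof -
    have "A \<subseteq> carrier (thick_lattice K) \<longleftrightarrow> (\<forall>M\<in>A. thick K M)" for A
      using carrier_thick_lattice by blast
    then show ?thesis using thick_lattice_sup by simp
  qed
  moreover have "(\<forall>M\<in>carrier (thick_lattice K). \<forall>N\<in>carrier (thick_lattice K).
      p (M \<sqinter>\<^bsub>thick_lattice K\<^esub> N) \<longleftrightarrow> p M \<and> p N) \<longleftrightarrow>
      (\<forall>M N. thick K M \<and> thick K N \<longrightarrow> (p (M \<inter> N) \<longleftrightarrow> p M \<and> p N))"
    unfolding Ball_def carrier_thick_lattice by (auto simp: thick_lattice_meet)
  moreover have "(\<forall>M\<in>carrier (thick_lattice K). \<forall>N\<in>carrier (thick_lattice K).
      M \<sqsubseteq>\<^bsub>thick_lattice K\<^esub> N \<longrightarrow> p M \<le> p N) \<longleftrightarrow>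
      (\<forall>M N. thick K M \<and> thick K N \<and> M \<subseteq> N \<and> p M \<longrightarrow> p N)"
    unfolding Ball_def carrier_thick_lattice le_thick_lattice by auto
  ultimately show ?thesis unfolding points_def mem_Collect_eq thick_lattice_top by simp
qed

lemma topspace_Spcnt: "topspace (Spcnt K) = points (thick_lattice K)"
  by (simp add: Spcnt_def TL.topspace_point_space)

lemma openin_Spcnt: "openin (Spcnt K) U \<longleftrightarrow> (\<exists>M. thick K M \<and> U = {p \<in> points (thick_lattice K). p M})"
  by (simp add: Spcnt_def TL.openin_point_space Bex_def)

lemma sober_Spcnt: "sober_space (Spcnt K)"
  by (simp add: Spcnt_def TL.sober_point_space)

end

context ttmor_arr
begin

lemma Spcnt_map_apply: "thick (Src F) M \<Longrightarrow> Spcnt_map F p M = p (thick_closure (Tgt F) (FO F ` M))"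
  by (simp add: Spcnt_map_def)

lemma thick_image: "thick (Src F) M \<Longrightarrow> thick (Tgt F) (thick_closure (Tgt F) (FO F ` M))"
  using K.thick_subset[of M] by (intro L.thick_closure_thick) auto

text \<open>Confluence says precisely that taking images preserves finite meets; joins are preserved by
  every exact functor.\<close>

lemma Spcnt_map_point:
  assumes p: "p \<in> points (thick_lattice (Tgt F))"
  shows "Spcnt_map F p \<in> points (thick_lattice (Src F))"
  unfolding K.points_thick_iff
proof (intro conjI allI impI)
  note pt = p[unfolded L.points_thick_iff]
  let ?\<Phi> = "\<lambda>M. thick_closure (Tgt F) (FO F ` M)"
  show "Spcnt_map F p \<in> extensional (carrier (thick_lattice (Src F)))" by (simp add: Spcnt_map_def)
  show "Spcnt_map F p (Obj (Src F))"
    using pt confl by (simp add: Spcnt_map_apply K.thick_Obj confluent_def)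
  show "Spcnt_map F p N"
    if "thick (Src F) M \<and> thick (Src F) N \<and> M \<subseteq> N \<and> Spcnt_map F p M" for M N
  proof -
    have MN: "thick (Src F) M" "thick (Src F) N" "M \<subseteq> N" "p (?\<Phi> M)"
      using that by (auto simp: Spcnt_map_apply)
    have "?\<Phi> M \<subseteq> ?\<Phi> N"
      using MN(3) L.thick_closure_upper[of "FO F ` N"] by (intro L.thick_closure_least thick_image MN) auto
    then show ?thesis using pt MN thick_image[OF MN(1)] thick_image[OF MN(2)] by (auto simp: Spcnt_map_apply)
  qed
  show "Spcnt_map F p (M \<inter> N) = (Spcnt_map F p M \<and> Spcnt_map F p N)"
    if MN: "thick (Src F) M \<and> thick (Src F) N" for M N
  proof -
    have "?\<Phi> (M \<inter> N) = ?\<Phi> M \<inter> ?\<Phi> N" using confl MN by (simp add: confluent_def)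
    moreover have "p (?\<Phi> M \<inter> ?\<Phi> N) \<longleftrightarrow> p (?\<Phi> M) \<and> p (?\<Phi> N)" using pt MN thick_image by simp
    ultimately show ?thesis using MN by (simp add: Spcnt_map_apply K.thick_Int)
  qed
  show "Spcnt_map F p (thick_closure (Src F) (\<Union>A)) = (\<exists>M\<in>A. Spcnt_map F p M)"
    if A: "\<forall>M\<in>A. thick (Src F) M" for A
  proof -
    have AO: "\<Union>A \<subseteq> Obj (Src F)" using A K.thick_subset by blast
    have th: "\<forall>N\<in>?\<Phi> ` A. thick (Tgt F) N" using A thick_image by auto
    then have UO: "\<Union>(?\<Phi> ` A) \<subseteq> Obj (Tgt F)" using L.thick_subset by blast
    have "thick_closure (Tgt F) (FO F ` thick_closure (Src F) (\<Union>A)) = thick_closure (Tgt F) (FO F ` \<Union>A)"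
      by (rule thick_closure_image[OF AO])
    also have "\<dots> = thick_closure (Tgt F) (\<Union>(?\<Phi> ` A))"
    proof (rule antisym)
      have "FO F ` \<Union>A \<subseteq> \<Union>(?\<Phi> ` A)"
        unfolding image_Union by (rule UN_mono[OF subset_refl L.thick_closure_upper])
      then show "thick_closure (Tgt F) (FO F ` \<Union>A) \<subseteq> thick_closure (Tgt F) (\<Union>(?\<Phi> ` A))"
        using L.thick_closure_upper[of "\<Union>(?\<Phi> ` A)"]
        by (intro L.thick_closure_least L.thick_closure_thick[OF UO]) auto
      have FO: "FO F ` \<Union>A \<subseteq> Obj (Tgt F)" using AO by auto
      have "?\<Phi> M \<subseteq> thick_closure (Tgt F) (FO F ` \<Union>A)" if "M \<in> A" for M
        using that L.thick_closure_upper[of "FO F ` \<Union>A"]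
        by (intro L.thick_closure_least L.thick_closure_thick[OF FO]) auto
      then show "thick_closure (Tgt F) (\<Union>(?\<Phi> ` A)) \<subseteq> thick_closure (Tgt F) (FO F ` \<Union>A)"
        by (intro L.thick_closure_least L.thick_closure_thick[OF FO]) auto
    qed
    finally have eq: "?\<Phi> (thick_closure (Src F) (\<Union>A)) = thick_closure (Tgt F) (\<Union>(?\<Phi> ` A))" .
    have "p (thick_closure (Tgt F) (\<Union>(?\<Phi> ` A))) \<longleftrightarrow> (\<exists>N\<in>?\<Phi> ` A. p N)" using pt th by blast
    then show ?thesis
      using eq A by (simp add: Spcnt_map_apply K.thick_closure_thick[OF AO])
  qed
qed

lemma continuous_Spcnt_map: "continuous_map (Spcnt (Tgt F)) (Spcnt (Src F)) (Spcnt_map F)"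
  unfolding continuous_map_def L.topspace_Spcnt K.topspace_Spcnt
proof (intro conjI allI impI)
  show "Spcnt_map F \<in> points (thick_lattice (Tgt F)) \<rightarrow> points (thick_lattice (Src F))"
    using Spcnt_map_point by auto
  fix U assume "openin (Spcnt (Src F)) U"
  then obtain M where M: "thick (Src F) M" "U = {p \<in> points (thick_lattice (Src F)). p M}"
    unfolding K.openin_Spcnt by auto
  then have "{p \<in> points (thick_lattice (Tgt F)). Spcnt_map F p \<in> U}
      = {p \<in> points (thick_lattice (Tgt F)). p (thick_closure (Tgt F) (FO F ` M))}"
    using Spcnt_map_point by (auto simp: Spcnt_map_apply)
  then show "openin (Spcnt (Tgt F)) {p \<in> points (thick_lattice (Tgt F)). Spcnt_map F p \<in> U}"
    unfolding L.openin_Spcnt using thick_image[OF M(1)] by blast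
qed

end

lemma Spcnt_map_ident:
  assumes "rigid_tt_category K" "p \<in> topspace (Spcnt K)"
  shows "Spcnt_map (ttmor_ident K) p = p"
proof -
  interpret rigid_tt_category K by fact
  have p: "p \<in> extensional (carrier (thick_lattice K))"
    using assms(2) by (simp add: topspace_Spcnt points_thick_iff)
  show ?thesis
  proof (rule extensionalityI[OF _ p])
    show "Spcnt_map (ttmor_ident K) p \<in> extensional (carrier (thick_lattice K))"
      by (simp add: Spcnt_map_def ttmor_ident_def)
    fix M assume "M \<in> carrier (thick_lattice K)"
    then have M: "thick K M" by simp
    have "(\<lambda>x\<in>Obj K. x) ` M = M" using thick_subset[OF M] by auto
    then show "Spcnt_map (ttmor_ident K) p M = p M"
      using M by (simp add: Spcnt_map_def ttmor_ident_def thick_closure_idem)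
  qed
qed

lemma Spcnt_map_comp:
  assumes "ttmor_arr F" "ttmor_arr G" "Tgt F = Src G"
  shows "Spcnt_map (ttmor_comp G F) p = Spcnt_map F (Spcnt_map G p)"
proof -
  interpret F: ttmor_arr F by fact
  interpret G: ttmor_arr G by fact
  show ?thesis
  proof (rule extensionalityI[where A = "carrier (thick_lattice (Src F))"])
    show "Spcnt_map (ttmor_comp G F) p \<in> extensional (carrier (thick_lattice (Src F)))"
      by (simp add: Spcnt_map_def ttmor_comp_def)
    show "Spcnt_map F (Spcnt_map G p) \<in> extensional (carrier (thick_lattice (Src F)))"
      by (simp add: Spcnt_map_def)
    fix M assume "M \<in> carrier (thick_lattice (Src F))"
    then have M: "thick (Src F) M" by simp
    have MO: "M \<subseteq> Obj (Src F)" by (rule F.K.thick_subset[OF M])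
    then have FM: "FO F ` M \<subseteq> Obj (Src G)" using F.obj assms(3) by auto
    have "Spcnt_map (ttmor_comp G F) p M = p (thick_closure (Tgt G) ((\<lambda>x\<in>Obj (Src F). FO G (FO F x)) ` M))"
      using M by (simp add: Spcnt_map_def ttmor_comp_def)
    also have "(\<lambda>x\<in>Obj (Src F). FO G (FO F x)) ` M = FO G ` FO F ` M" using MO by auto
    also have "p (thick_closure (Tgt G) (FO G ` FO F ` M))
        = p (thick_closure (Tgt G) (FO G ` thick_closure (Src G) (FO F ` M)))"
      using G.thick_closure_image[OF FM] by simp
    also have "\<dots> = Spcnt_map G p (thick_closure (Src G) (FO F ` M))"
      using G.K.thick_closure_thick[OF FM] by (simp add: G.Spcnt_map_apply)
    also have "\<dots> = Spcnt_map F (Spcnt_map G p) M"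
      using M assms(3) by (simp add: F.Spcnt_map_apply)
    finally show "Spcnt_map (ttmor_comp G F) p M = Spcnt_map F (Spcnt_map G p) M" .
  qed
qed


section \<open>The Hochster dual of the Balmer spectrum\<close>

lemma openin_topology_generated_by_basis:
  assumes "\<And>B C. \<lbrakk>B \<in> \<B>; C \<in> \<B>\<rbrakk> \<Longrightarrow> B \<inter> C \<in> \<B>"
  shows "openin (topology_generated_by \<B>) U \<longleftrightarrow> (\<forall>p\<in>U. \<exists>B\<in>\<B>. p \<in> B \<and> B \<subseteq> U)"
proof
  assume "openin (topology_generated_by \<B>) U"
  then have "generate_topology_on \<B> U" by (simp add: openin_topology_generated_by_iff)
  then show "\<forall>p\<in>U. \<exists>B\<in>\<B>. p \<in> B \<and> B \<subseteq> U"
  proof induction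
    case (Int a b)
    show ?case
    proof
      fix p assume p: "p \<in> a \<inter> b"
      obtain B where B: "B \<in> \<B>" "p \<in> B" "B \<subseteq> a" using Int.IH(1) p by blast
      obtain C where C: "C \<in> \<B>" "p \<in> C" "C \<subseteq> b" using Int.IH(2) p by blast
      show "\<exists>B\<in>\<B>. p \<in> B \<and> B \<subseteq> a \<inter> b"
        by (rule bexI[OF _ assms[OF B(1) C(1)]]) (use B C in auto)
    qed
  next
    case (UN \<K>)
    show ?case
    proof
      fix p assume "p \<in> \<Union>\<K>"
      then obtain k where k: "k \<in> \<K>" "p \<in> k" by auto
      then obtain B where "B \<in> \<B>" "p \<in> B" "B \<subseteq> k" using UN.IH by blast
      then show "\<exists>B\<in>\<B>. p \<in> B \<and> B \<subseteq> \<Union>\<K>" using k by blast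
    qed
  qed auto
next
  assume *: "\<forall>p\<in>U. \<exists>B\<in>\<B>. p \<in> B \<and> B \<subseteq> U"
  have "U = \<Union>{B \<in> \<B>. B \<subseteq> U}" using * by blast
  moreover have "openin (topology_generated_by \<B>) (\<Union>{B \<in> \<B>. B \<subseteq> U})"
    by (rule openin_Union) (auto intro: topology_generated_by_Basis)
  ultimately show "openin (topology_generated_by \<B>) U" by simp
qed

context tt_category
begin

definition primes_containing :: "'o \<Rightarrow> 'o set set"
  where "primes_containing x = {P. prime_ideal K P \<and> x \<in> P}"

lemma primes_containing_Int:
  assumes "x \<in> Obj K" "y \<in> Obj K"
  shows "\<exists>b\<in>Obj K. primes_containing x \<inter> primes_containing y = primes_containing b"
proof -
  obtain b where b: "is_direct_sum K x y b" using direct_sum_exists[OF assms] by auto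
  have "b \<in> Obj K" using b by (simp add: is_direct_sum_def)
  moreover have "primes_containing x \<inter> primes_containing y = primes_containing b"
    using thick_direct_sum_iff[OF thick_ideal_thick[OF prime_ideal_ideal] b]
    by (auto simp: primes_containing_def)
  ultimately show ?thesis by blast
qed

lemma primes_containing_Un:
  assumes "x \<in> Obj K" "y \<in> Obj K"
  shows "primes_containing (x \<otimes>\<^sub>o y) = primes_containing x \<union> primes_containing y"
  using prime_ideal_tensor_iff[OF _ assms] by (auto simp: primes_containing_def)

lemma primes_containing_unit: "primes_containing (Unt K) = {}"
  using prime_ideal_unit by (auto simp: primes_containing_def)

lemma supp_eq: "supp K x = {P. prime_ideal K P} - primes_containing x"
  by (auto simp: supp_def primes_containing_def)

lemma Spc_eq: "Spc K = topology_generated_by (primes_containing ` Obj K)"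
proof -
  have "{P. prime_ideal K P} - supp K x = primes_containing x" for x
    by (auto simp: supp_def primes_containing_def)
  then show ?thesis by (simp add: Spc_def)
qed

lemma openin_Spc:
  "openin (Spc K) U \<longleftrightarrow> (\<forall>P\<in>U. \<exists>x\<in>Obj K. P \<in> primes_containing x \<and> primes_containing x \<subseteq> U)"
proof -
  have "openin (Spc K) U \<longleftrightarrow>
      (\<forall>P\<in>U. \<exists>B\<in>primes_containing ` Obj K. P \<in> B \<and> B \<subseteq> U)"
    unfolding Spc_eq
  proof (rule openin_topology_generated_by_basis)
    fix B C assume "B \<in> primes_containing ` Obj K" "C \<in> primes_containing ` Obj K"
    then show "B \<inter> C \<in> primes_containing ` Obj K" using primes_containing_Int by blast
  qed
  then show ?thesis by simp
qed

lemma topspace_Spc: "topspace (Spc K) = {P. prime_ideal K P}"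
proof -
  obtain z where z: "zero_object K z" "z \<in> Obj K" using some_zero .
  have "primes_containing z = {P. prime_ideal K P}"
    using thick_zero[OF thick_ideal_thick[OF prime_ideal_ideal] z(1)] by (auto simp: primes_containing_def)
  moreover have "primes_containing x \<subseteq> {P. prime_ideal K P}" for x by (auto simp: primes_containing_def)
  ultimately have "\<Union>(primes_containing ` Obj K) = {P. prime_ideal K P}" using z(2) by blast
  then show ?thesis unfolding Spc_eq by (simp add: topology_generated_by_topspace)
qed

lemma openin_primes_containing: "x \<in> Obj K \<Longrightarrow> openin (Spc K) (primes_containing x)"
  unfolding openin_Spc by blast

text \<open>
  Given a cover, the objects \<open>s\<close> for which finitely many members cover the primes containing \<open>s\<close>
  form a multiplicative set.  If it missed the ideal generated by \<open>x\<close>, a prime avoiding it would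
  contain \<open>x\<close> yet lie in no member of the cover.
\<close>

lemma compactin_primes_containing:
  assumes x: "x \<in> Obj K"
  shows "compactin (Spc K) (primes_containing x)"
  unfolding compactin_def
proof (intro conjI allI impI)
  show "primes_containing x \<subseteq> topspace (Spc K)" by (auto simp: topspace_Spc primes_containing_def)
  fix \<U> assume cover: "Ball \<U> (openin (Spc K)) \<and> primes_containing x \<subseteq> \<Union>\<U>"
  define S where "S = {s \<in> Obj K. \<exists>\<F>. finite \<F> \<and> \<F> \<subseteq> \<U> \<and> primes_containing s \<subseteq> \<Union>\<F>}"
  have unit: "Unt K \<in> S" unfolding S_def mem_Collect_eq
    by (intro conjI exI[where x = "{}"]) (auto simp: primes_containing_unit)
  have mult: "s \<otimes>\<^sub>o t \<in> S" if st: "s \<in> S" "t \<in> S" for s t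
  proof -
    obtain \<F> where F: "finite \<F>" "\<F> \<subseteq> \<U>" "primes_containing s \<subseteq> \<Union>\<F>" and s: "s \<in> Obj K"
      using st(1) by (auto simp: S_def)
    obtain \<G> where G: "finite \<G>" "\<G> \<subseteq> \<U>" "primes_containing t \<subseteq> \<Union>\<G>" and t: "t \<in> Obj K"
      using st(2) by (auto simp: S_def)
    have "finite (\<F> \<union> \<G>)" "\<F> \<union> \<G> \<subseteq> \<U>" "primes_containing (s \<otimes>\<^sub>o t) \<subseteq> \<Union>(\<F> \<union> \<G>)"
      unfolding primes_containing_Un[OF s t] using F G by auto
    then show ?thesis unfolding S_def using s t tensor_in by blast
  qed
  have I: "thick_ideal K (ideal_closure K {x})" using x by (intro ideal_closure_ideal) simp
  have "\<exists>s\<in>S. s \<in> ideal_closure K {x}"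
  proof (rule ccontr)
    assume "\<not> ?thesis"
    then have "ideal_closure K {x} \<inter> S = {}" by auto
    moreover have "S \<subseteq> Obj K" by (auto simp: S_def)
    ultimately obtain P where P: "prime_ideal K P" "ideal_closure K {x} \<subseteq> P" "P \<inter> S = {}"
      using prime_ideal_avoiding[OF I _ unit mult] by blast
    then have "P \<in> primes_containing x" using in_ideal_closure by (auto simp: primes_containing_def)
    then obtain W where W: "W \<in> \<U>" "P \<in> W" using cover by auto
    have "openin (Spc K) W" using W cover by auto
    then obtain a where a: "a \<in> Obj K" "P \<in> primes_containing a" "primes_containing a \<subseteq> W"
      using W(2) unfolding openin_Spc by blast
    have "a \<in> S" unfolding S_def mem_Collect_eq
      using a W by (intro conjI exI[where x = "{W}"]) auto
    then show False using a(2) P(3) by (auto simp: primes_containing_def)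
  qed
  then obtain s where s: "s \<in> S" "s \<in> ideal_closure K {x}" by auto
  have "primes_containing x \<subseteq> primes_containing s"
  proof
    fix P assume "P \<in> primes_containing x"
    then have P: "prime_ideal K P" "x \<in> P" by (auto simp: primes_containing_def)
    then have "ideal_closure K {x} \<subseteq> P" by (intro ideal_closure_least prime_ideal_ideal) auto
    then show "P \<in> primes_containing s" using s P by (auto simp: primes_containing_def)
  qed
  then show "\<exists>\<F>. finite \<F> \<and> \<F> \<subseteq> \<U> \<and> primes_containing x \<subseteq> \<Union>\<F>"
    using s(1) unfolding S_def by blast
qed

text \<open>
  The sets of primes containing one object form a basis closed under finite unions, so a compact
  open set is one of them: the closed sets with compact complement are the supports.
\<close>

lemma hochster_generators_eq:
  "{C. closedin (Spc K) C \<and> compactin (Spc K) (topspace (Spc K) - C)} = supp K ` Obj K"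
proof (intro antisym subsetI)
  fix C assume "C \<in> supp K ` Obj K"
  then obtain x where x: "x \<in> Obj K" "C = supp K x" by auto
  have "topspace (Spc K) - C = primes_containing x"
    unfolding x topspace_Spc by (auto simp: supp_eq primes_containing_def)
  moreover have "C \<subseteq> topspace (Spc K)" unfolding x topspace_Spc by (auto simp: supp_eq)
  ultimately show "C \<in> {C. closedin (Spc K) C \<and> compactin (Spc K) (topspace (Spc K) - C)}"
    using openin_primes_containing[OF x(1)] compactin_primes_containing[OF x(1)] by (simp add: closedin_def)
next
  fix C assume "C \<in> {C. closedin (Spc K) C \<and> compactin (Spc K) (topspace (Spc K) - C)}"
  then have C: "C \<subseteq> topspace (Spc K)" and opn: "openin (Spc K) (topspace (Spc K) - C)"
    and cpt: "compactin (Spc K) (topspace (Spc K) - C)" by (auto simp: closedin_def)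
  let ?D = "topspace (Spc K) - C"
  let ?\<B> = "{B \<in> primes_containing ` Obj K. B \<subseteq> ?D}"
  have "?D \<subseteq> \<Union>?\<B>"
  proof
    fix P assume "P \<in> ?D"
    then obtain a where "a \<in> Obj K" "P \<in> primes_containing a" "primes_containing a \<subseteq> ?D"
      using opn unfolding openin_Spc by blast
    then show "P \<in> \<Union>?\<B>" by blast
  qed
  moreover have "\<forall>B\<in>?\<B>. openin (Spc K) B" using openin_primes_containing by auto
  ultimately obtain \<F> where F: "finite \<F>" "\<F> \<subseteq> ?\<B>" "?D \<subseteq> \<Union>\<F>"
    using cpt unfolding compactin_def by meson
  have "\<exists>a\<in>Obj K. \<Union>\<F> = primes_containing a"
    using F(1,2)
  proof (induction \<F> rule: finite_induct)
    case empty
    then show ?case using primes_containing_unit unit_in by auto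
  next
    case (insert B \<F>)
    then obtain a where a: "a \<in> Obj K" "\<Union>\<F> = primes_containing a" by auto
    obtain c where c: "c \<in> Obj K" "B = primes_containing c" using insert.prems by auto
    show ?case
      by (rule bexI[where x = "c \<otimes>\<^sub>o a"]) (use a c primes_containing_Un[OF c(1) a(1)] in auto)
  qed
  then obtain a where a: "a \<in> Obj K" "\<Union>\<F> = primes_containing a" by blast
  have "\<Union>\<F> \<subseteq> ?D" using F(2) by blast
  then have "?D = primes_containing a" using F(3) a(2) by simp
  then have "C = supp K a" using C unfolding topspace_Spc supp_eq by blast
  then show "C \<in> supp K ` Obj K" using a(1) by simp
qed

lemma Spc_dual_eq: "Spc_dual K = topology_generated_by (supp K ` Obj K)"
  unfolding Spc_dual_def hochster_dual_def hochster_generators_eq ..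

lemma in_supp: "P \<in> supp K x \<longleftrightarrow> prime_ideal K P \<and> x \<notin> P"
  by (simp add: supp_def)

lemma supp_tensor: "\<lbrakk>x \<in> Obj K; y \<in> Obj K\<rbrakk> \<Longrightarrow> supp K (x \<otimes>\<^sub>o y) = supp K x \<inter> supp K y"
  unfolding supp_eq using primes_containing_Un by auto

lemma openin_Spc_dual:
  "openin (Spc_dual K) U \<longleftrightarrow> (\<forall>P\<in>U. \<exists>x\<in>Obj K. P \<in> supp K x \<and> supp K x \<subseteq> U)"
proof -
  have "openin (Spc_dual K) U \<longleftrightarrow> (\<forall>P\<in>U. \<exists>B\<in>supp K ` Obj K. P \<in> B \<and> B \<subseteq> U)"
    unfolding Spc_dual_eq
  proof (rule openin_topology_generated_by_basis)
    fix B C assume "B \<in> supp K ` Obj K" "C \<in> supp K ` Obj K"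
    then obtain x y where "x \<in> Obj K" "y \<in> Obj K" "B = supp K x" "C = supp K y" by auto
    then have "B \<inter> C = supp K (x \<otimes>\<^sub>o y)" "x \<otimes>\<^sub>o y \<in> Obj K" using supp_tensor by auto
    then show "B \<inter> C \<in> supp K ` Obj K" by blast
  qed
  then show ?thesis by simp
qed

lemma openin_supp: "x \<in> Obj K \<Longrightarrow> openin (Spc_dual K) (supp K x)"
  unfolding openin_Spc_dual by blast

lemma topspace_Spc_dual: "topspace (Spc_dual K) = {P. prime_ideal K P}"
proof -
  have "supp K (Unt K) = {P. prime_ideal K P}" by (auto simp: supp_eq primes_containing_unit)
  moreover have "supp K x \<subseteq> {P. prime_ideal K P}" for x by (auto simp: supp_def)
  ultimately have "\<Union>(supp K ` Obj K) = {P. prime_ideal K P}" using unit_in by blast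
  then show ?thesis unfolding Spc_dual_eq by (simp add: topology_generated_by_topspace)
qed

lemma continuous_map_Spc_dualI:
  assumes "\<And>p. p \<in> topspace X \<Longrightarrow> prime_ideal K (f p)"
    and "\<And>x. x \<in> Obj K \<Longrightarrow> openin X {p \<in> topspace X. x \<notin> f p}"
  shows "continuous_map X (Spc_dual K) f"
  unfolding continuous_map_def topspace_Spc_dual
proof (intro conjI allI impI)
  show "f \<in> topspace X \<rightarrow> {P. prime_ideal K P}" using assms(1) by auto
  fix U assume U: "openin (Spc_dual K) U"
  have "\<exists>T. openin X T \<and> p \<in> T \<and> T \<subseteq> {p \<in> topspace X. f p \<in> U}"
    if "p \<in> {p \<in> topspace X. f p \<in> U}" for p
  proof -
    have p: "p \<in> topspace X" "f p \<in> U" using that by auto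
    obtain x where x: "x \<in> Obj K" "f p \<in> supp K x" "supp K x \<subseteq> U"
      using U p(2) unfolding openin_Spc_dual by blast
    show ?thesis
    proof (intro exI conjI)
      show "openin X {p \<in> topspace X. x \<notin> f p}" by (rule assms(2)[OF x(1)])
      show "p \<in> {p \<in> topspace X. x \<notin> f p}" using p x(2) by (simp add: in_supp)
      show "{p \<in> topspace X. x \<notin> f p} \<subseteq> {p \<in> topspace X. f p \<in> U}"
        using x(3) assms(1) in_supp by blast
    qed
  qed
  then show "openin X {p \<in> topspace X. f p \<in> U}"
    by (subst openin_subopen) blast
qed

lemma in_closure_Spc_dual:
  assumes P: "prime_ideal K P"
  shows "Q \<in> Spc_dual K closure_of {P} \<longleftrightarrow> prime_ideal K Q \<and> P \<subseteq> Q"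
proof
  assume Q: "Q \<in> Spc_dual K closure_of {P}"
  then have pQ: "prime_ideal K Q" unfolding in_closure_of topspace_Spc_dual by simp
  have "x \<in> Q" if "x \<in> P" for x
  proof (rule ccontr)
    assume "x \<notin> Q"
    then have "Q \<in> supp K x" using pQ by (simp add: in_supp)
    moreover have "openin (Spc_dual K) (supp K x)"
      using that prime_ideal_subset[OF P] by (intro openin_supp) auto
    ultimately have "P \<in> supp K x" using Q unfolding in_closure_of by blast
    then show False using that by (simp add: in_supp)
  qed
  then show "prime_ideal K Q \<and> P \<subseteq> Q" using pQ by auto
next
  assume Q: "prime_ideal K Q \<and> P \<subseteq> Q"
  have "P \<in> T" if T: "Q \<in> T" "openin (Spc_dual K) T" for T
  proof -
    obtain x where x: "Q \<in> supp K x" "supp K x \<subseteq> T" using T unfolding openin_Spc_dual by blast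
    then have "P \<in> supp K x" using Q P by (auto simp: in_supp)
    then show ?thesis using x by auto
  qed
  then show "Q \<in> Spc_dual K closure_of {P}" unfolding in_closure_of topspace_Spc_dual using Q by auto
qed

text \<open>
  The generic point of an irreducible closed set is the intersection of its members, because
  \<open>supp x \<inter> supp y = supp (x \<otimes> y)\<close> translates irreducibility into primality.
\<close>

theorem sober_Spc_dual: "sober_space (Spc_dual K)"
  unfolding sober_space_def
proof (intro allI impI)
  fix Z assume Z: "irreducible_closedin (Spc_dual K) Z"
  then have cl: "closedin (Spc_dual K) Z" and ne: "Z \<noteq> {}" by (auto simp: irreducible_closedin_def)
  have Zp: "prime_ideal K Q" if "Q \<in> Z" for Q
    using closedin_subset[OF cl] that unfolding topspace_Spc_dual by auto
  let ?P = "\<Inter>Z"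
  have P: "prime_ideal K ?P"
    unfolding prime_ideal_def
  proof (intro conjI ballI impI)
    show "thick_ideal K ?P" using ne Zp prime_ideal_ideal by (intro thick_ideal_Inter) auto
    obtain Q where "Q \<in> Z" using ne by auto
    then have "Unt K \<notin> ?P" using prime_ideal_unit[OF Zp] by blast
    then show "?P \<noteq> Obj K" using unit_in by blast
    fix x y assume x: "x \<in> Obj K" and y: "y \<in> Obj K" and xy: "x \<otimes>\<^sub>o y \<in> ?P"
    show "x \<in> ?P \<or> y \<in> ?P"
    proof (rule ccontr)
      assume "\<not> (x \<in> ?P \<or> y \<in> ?P)"
      then have "Z \<inter> supp K x \<noteq> {}" "Z \<inter> supp K y \<noteq> {}" using Zp in_supp by blast+
      from irreducible_closedin_meets[OF Z openin_supp[OF x] openin_supp[OF y] this]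
      obtain Q where "Q \<in> Z" "Q \<in> supp K (x \<otimes>\<^sub>o y)" using supp_tensor[OF x y] by auto
      then show False using xy by (auto simp: in_supp)
    qed
  qed
  have closure: "Spc_dual K closure_of {?P} = Z"
  proof (intro antisym subsetI)
    fix Q assume "Q \<in> Spc_dual K closure_of {?P}"
    then have Q: "prime_ideal K Q" "?P \<subseteq> Q" unfolding in_closure_Spc_dual[OF P] by auto
    show "Q \<in> Z"
    proof (rule ccontr)
      assume "Q \<notin> Z"
      moreover have "openin (Spc_dual K) (topspace (Spc_dual K) - Z)"
        using cl by (rule openin_diff[OF openin_topspace])
      ultimately obtain x where x: "x \<in> Obj K" "Q \<in> supp K x" "supp K x \<subseteq> topspace (Spc_dual K) - Z"
        using Q(1) unfolding openin_Spc_dual topspace_Spc_dual by blast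
      then have "x \<in> ?P" using Zp in_supp by blast
      then show False using x(2) Q(2) by (auto simp: in_supp)
    qed
  next
    fix Q assume "Q \<in> Z"
    then show "Q \<in> Spc_dual K closure_of {?P}" unfolding in_closure_Spc_dual[OF P] using Zp by auto
  qed
  show "\<exists>!P. P \<in> topspace (Spc_dual K) \<and> Spc_dual K closure_of {P} = Z"
  proof (rule ex1I[where a = ?P])
    show "?P \<in> topspace (Spc_dual K) \<and> Spc_dual K closure_of {?P} = Z"
      using P closure by (simp add: topspace_Spc_dual)
    fix R assume "R \<in> topspace (Spc_dual K) \<and> Spc_dual K closure_of {R} = Z"
    then have R: "prime_ideal K R" "Spc_dual K closure_of {R} = Spc_dual K closure_of {?P}"
      using closure by (auto simp: topspace_Spc_dual)
    then show "R = ?P"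
      using in_closure_Spc_dual[OF R(1), of R] in_closure_Spc_dual[OF R(1), of ?P]
        in_closure_Spc_dual[OF P, of R] in_closure_Spc_dual[OF P, of ?P] P by auto
  qed
qed

end

context ttmor_arr
begin

lemma continuous_Spc_map: "continuous_map (Spc_dual (Tgt F)) (Spc_dual (Src F)) (Spc_map F)"
proof (rule K.continuous_map_Spc_dualI)
  show "prime_ideal (Src F) (Spc_map F P)" if "P \<in> topspace (Spc_dual (Tgt F))" for P
    using prime_ideal_vimage[of P] that by (simp add: L.topspace_Spc_dual Spc_map_def)
  fix x assume x: "x \<in> Obj (Src F)"
  have "{P \<in> topspace (Spc_dual (Tgt F)). x \<notin> Spc_map F P} = supp (Tgt F) (FO F x)"
    using x by (auto simp: L.topspace_Spc_dual Spc_map_def supp_def)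
  then show "openin (Spc_dual (Tgt F)) {P \<in> topspace (Spc_dual (Tgt F)). x \<notin> Spc_map F P}"
    using L.openin_supp[of "FO F x"] x by simp
qed

end

lemma Spc_map_ident:
  assumes "rigid_tt_category K" "P \<in> topspace (Spc_dual K)"
  shows "Spc_map (ttmor_ident K) P = P"
proof -
  interpret rigid_tt_category K by fact
  have "P \<subseteq> Obj K" using assms(2) prime_ideal_subset by (simp add: topspace_Spc_dual)
  then show ?thesis by (auto simp: Spc_map_def ttmor_ident_def)
qed

lemma Spc_map_comp:
  assumes "ttmor_arr F" "Tgt F = Src G"
  shows "Spc_map (ttmor_comp G F) P = Spc_map F (Spc_map G P)"
proof -
  interpret F: ttmor_arr F by fact
  show ?thesis using F.obj[unfolded assms(2)] by (auto simp: Spc_map_def ttmor_comp_def)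
qed


section \<open>The comparison map\<close>

context rigid_tt_category
begin

lemma comparison_eq:
  "comparison K p = {x \<in> Obj K. \<not> p (ideal_closure K {x})}"
proof -
  have "ideal_closure K {x} \<in> carrier (ideal_lattice K)" if "x \<in> Obj K" for x
    using that ideal_closure_ideal[of "{x}"] by (simp add: ideal_lattice_def inclusion_order_def)
  then show ?thesis by (auto simp: comparison_def prime_of_point_def)
qed

text \<open>
  A point \<open>p\<close> is given by the largest thick subcategory \<open>N\<close> that it sends to \<open>0\<close>, and \<open>\<langle>x\<rangle> \<subseteq> N\<close> iff
  \<open>a \<otimes> x \<in> N\<close> for all \<open>a\<close>.  The latter description exhibits the comparison image as a thick ideal,
  being an intersection of preimages of \<open>N\<close> under exact functors.  It is prime because rigidity
  gives \<open>\<langle>x\<rangle> \<inter> \<langle>y\<rangle> = \<langle>x \<otimes> y\<rangle>\<close> and \<open>p\<close> preserves meets.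
\<close>

lemma comparison_prime:
  assumes p: "p \<in> points (thick_lattice K)"
  shows "prime_ideal K (comparison K p)"
proof -
  note pt = p[unfolded points_thick_iff]
  define N where "N = thick_closure K (\<Union>{M. thick K M \<and> \<not> p M})"
  have N: "thick K N" unfolding N_def using thick_subset by (intro thick_closure_thick) blast
  have "p N \<longleftrightarrow> (\<exists>M\<in>{M. thick K M \<and> \<not> p M}. p M)"
    unfolding N_def using pt by (metis (no_types, lifting) mem_Collect_eq)
  then have pN: "\<not> p N" by simp
  have le_N: "\<not> p M \<longleftrightarrow> M \<subseteq> N" if M: "thick K M" for M
  proof
    show "M \<subseteq> N" if "\<not> p M"
      using thick_closure_upper[of "\<Union>{M. thick K M \<and> \<not> p M}"] M that unfolding N_def by blast
    show "\<not> p M" if "M \<subseteq> N" using pt M N that pN by blast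
  qed
  have I: "thick_ideal K (ideal_closure K {x})" if "x \<in> Obj K" for x
    using that by (intro ideal_closure_ideal) simp
  let ?J = "\<Inter>a\<in>Obj K. {x \<in> Obj K. a \<otimes>\<^sub>o x \<in> N}"
  have J: "thick_ideal K ?J"
    unfolding thick_ideal_def
  proof (intro conjI ballI)
    have "Obj K \<noteq> {}" using unit_in by blast
    then show "thick K ?J" using thick_tensor_vimage(1)[OF N] by (intro thick_Inter) auto
    fix x y assume x: "x \<in> Obj K" and y: "y \<in> ?J"
    have yO: "y \<in> Obj K" using y unit_in by blast
    have "a \<otimes>\<^sub>o (x \<otimes>\<^sub>o y) \<in> N" if a: "a \<in> Obj K" for a
    proof -
      have "(a \<otimes>\<^sub>o x) \<otimes>\<^sub>o y \<in> N" using y tensor_in[OF a x] by blast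
      then show ?thesis using thick_Iso_iff[OF N tensor_assoc_Iso[OF a x yO]] by simp
    qed
    then show "x \<otimes>\<^sub>o y \<in> ?J" using x yO by simp
  qed
  have "comparison K p = ?J"
  proof (intro antisym subsetI)
    fix x assume "x \<in> comparison K p"
    then have x: "x \<in> Obj K" "\<not> p (ideal_closure K {x})" by (auto simp: comparison_eq)
    then have "ideal_closure K {x} \<subseteq> N" using le_N[OF thick_ideal_thick[OF I[OF x(1)]]] by simp
    then have "a \<otimes>\<^sub>o x \<in> N" if "a \<in> Obj K" for a
      using thick_ideal_tensor[OF I[OF x(1)] that in_ideal_closure] by auto
    then show "x \<in> ?J" using x(1) by simp
  next
    fix x assume x: "x \<in> ?J"
    have xO: "x \<in> Obj K" using x unit_in by blast
    have "ideal_closure K {x} \<subseteq> ?J" by (rule ideal_closure_least[OF J]) (use x in blast)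
    also have "?J \<subseteq> N"
    proof
      fix y assume y: "y \<in> ?J"
      then have "Unt K \<otimes>\<^sub>o y \<in> N" "y \<in> Obj K" using unit_in by blast+
      then show "y \<in> N" using thick_Iso_iff[OF N tensor_lunit_Iso[of y y y]] by simp
    qed
    finally have "\<not> p (ideal_closure K {x})" using le_N[OF thick_ideal_thick[OF I[OF xO]]] by simp
    then show "x \<in> comparison K p" using xO by (simp add: comparison_eq)
  qed
  then have ideal: "thick_ideal K (comparison K p)" using J by simp
  show ?thesis
    unfolding prime_ideal_def
  proof (intro conjI ballI impI)
    show "thick_ideal K (comparison K p)" by (rule ideal)
    have "ideal_closure K {Unt K} = Obj K"
      by (rule thick_ideal_unit[OF I in_ideal_closure]) simp
    then have "Unt K \<notin> comparison K p" using pt by (simp add: comparison_eq)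
    then show "comparison K p \<noteq> Obj K" using unit_in by blast
    fix x y assume x: "x \<in> Obj K" and y: "y \<in> Obj K" and xy: "x \<otimes>\<^sub>o y \<in> comparison K p"
    have "p (ideal_closure K {x \<otimes>\<^sub>o y}) \<longleftrightarrow> p (ideal_closure K {x}) \<and> p (ideal_closure K {y})"
      unfolding ideal_closure_Int[OF x y, symmetric]
      using pt thick_ideal_thick[OF I[OF x]] thick_ideal_thick[OF I[OF y]] by blast
    then show "x \<in> comparison K p \<or> y \<in> comparison K p" using x y xy by (auto simp: comparison_eq)
  qed
qed

lemma continuous_comparison: "continuous_map (Spcnt K) (Spc_dual K) (comparison K)"
proof (rule continuous_map_Spc_dualI)
  show "prime_ideal K (comparison K p)" if "p \<in> topspace (Spcnt K)" for p
    using that comparison_prime by (simp add: topspace_Spcnt)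
  fix x assume x: "x \<in> Obj K"
  have "thick K (ideal_closure K {x})"
    using x by (intro thick_ideal_thick ideal_closure_ideal) simp
  moreover have "{p \<in> topspace (Spcnt K). x \<notin> comparison K p}
      = {p \<in> points (thick_lattice K). p (ideal_closure K {x})}"
    using x by (auto simp: topspace_Spcnt comparison_eq)
  ultimately show "openin (Spcnt K) {p \<in> topspace (Spcnt K). x \<notin> comparison K p}"
    unfolding openin_Spcnt by blast
qed

end

lemma (in ttmor_arr) comparison_natural:
  "comparison (Src F) (Spcnt_map F p) = Spc_map F (comparison (Tgt F) p)"
proof -
  have "Spcnt_map F p (ideal_closure (Src F) {x}) = p (ideal_closure (Tgt F) {FO F x})"
    if x: "x \<in> Obj (Src F)" for x
  proof -
    have "thick (Src F) (ideal_closure (Src F) {x})"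
      using x by (intro K.thick_ideal_thick K.ideal_closure_ideal) simp
    then show ?thesis
      using thick_closure_image_ideal_closure[OF ess_surj x] by (simp add: Spcnt_map_apply)
  qed
  then show ?thesis by (auto simp: K.comparison_eq L.comparison_eq Spc_map_def)
qed

theorem theorem6p2p5:
  shows "sob_natural_transformation
           (op_cat (rttcat_conf_loc :: (('o, 'm) ttcat, ('o, 'm) ttmor) cat))
           Spcnt Spcnt_map Spc_dual Spc_map comparison"
proof -
  let ?C = "rttcat_conf_loc :: (('o, 'm) ttcat, ('o, 'm) ttmor) cat"
  interpret C: category ?C by (rule category_rttcat_conf_loc)
  have ops: "Obj (op_cat ?C) = {K. rigid_tt_category K}" "Arr (op_cat ?C) = {F. ttmor_arr F}"
    "Dom (op_cat ?C) = Tgt" "Cod (op_cat ?C) = Src" "Ident (op_cat ?C) = ttmor_ident"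
    "Comp (op_cat ?C) F G = ttmor_comp G F" for F G
    using ttmor_arr_iff by (auto simp: op_cat_def rttcat_conf_loc_def)
  have tri: "triangulated_category K" and tt: "tt_category K" if "rigid_tt_category K" for K :: "('o, 'm) ttcat"
    using that by (auto simp: rigid_tt_category_def tt_category_def)
  have Spcnt: "sob_functor (op_cat ?C) Spcnt Spcnt_map"
    unfolding sob_functor_def ops
    by (intro conjI ballI allI impI)
      (simp_all add: C.category_op_cat tri triangulated_category.sober_Spcnt
        ttmor_arr.continuous_Spcnt_map Spcnt_map_ident Spcnt_map_comp)
  have Spc: "sob_functor (op_cat ?C) Spc_dual Spc_map"
    unfolding sob_functor_def ops
    by (intro conjI ballI allI impI)
      (simp_all add: C.category_op_cat tt tt_category.sober_Spc_dual
        ttmor_arr.continuous_Spc_map Spc_map_ident Spc_map_comp)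
  show ?thesis
    unfolding sob_natural_transformation_def ops
    using Spcnt Spc rigid_tt_category.continuous_comparison ttmor_arr.comparison_natural by auto
qed

end
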